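(* Let $1\leq p_1,p_2<\infty$, and let $w_1,w_2$ be non-increasing sequences of positive numbers with $\sum_k w_1(k)=\sum_k w_2(k)=\infty$. If either $p_1<\max\{2,p_2\}$ or $p_2>2$, then $$\mathcal{K}(\mathfrak{C}_{\mathfrak{l}(w_1,p_1)},\mathfrak{C}_{\mathfrak{l}(w_2,p_2)})\subsetneq\mathcal{FSS}(\mathfrak{C}_{\mathfrak{l}(w_1,p_1)},\mathfrak{C}_{\mathfrak{l}(w_2,p_2)})\subsetneq\mathcal{SS}(\mathfrak{C}_{\mathfrak{l}(w_1,p_1)},\mathfrak{C}_{\mathfrak{l}(w_2,p_2)}).$$
   Context: The Lorentz sequence space $\mathfrak{l}(w,p)$ is the completion of $c_{00}$ (finitely supported sequences) in the norm $\|(x_k)\|=\big(\sum_k w(k)(x_k^\dagger)^p\big)^{1/p}$, where $(x_k^\dagger)$ is the non-increasing rearrangement of $(|x_k|)$. For a symmetric sequence space $\mathcal{E}$, $\mathfrak{C}_{\mathcal{E}}$ is the space of compact operators $A$ on a separable infinite-dimensional Hilbert space whose sequence of singular values $(s_i(A))$ belongs to $\mathcal{E}$, with norm $\|A\|=\|(s_i(A))\|_{\mathcal{E}}$. $\mathcal{K}(X,Y)$ denotes the compact operators. $\mathcal{SS}(X,Y)$ denotes the strictly singular operators, i.e. bounded operators that are not isomorphisms (onto their images) on any closed infinite-dimensional subspace of $X$. $\mathcal{FSS}(X,Y)$ denotes the finitely strictly singular operators, i.e. bounded operators $T:X\to Y$ such that for every $\varepsilon>0$ there is $N\in\mathbb{N}$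 such that every subspace of $X$ of dimension at least $N$ contains a norm-one vector $x$ with $\|Tx\|<\varepsilon$. *)

theory Defs
  imports "HOL-Analysis.Analysis"
begin

section \<open>Complex Hilbert spaces\<close>

class complex_vector = real_vector +
  fixes scaleC :: "complex \<Rightarrow> 'a \<Rightarrow> 'a"  (infixr "*\<^sub>C" 75)
  assumes scaleC_add_right: "c *\<^sub>C (x + y) = c *\<^sub>C x + c *\<^sub>C y"
    and scaleC_add_left: "(c + d) *\<^sub>C x = c *\<^sub>C x + d *\<^sub>C x"
    and scaleC_scaleC: "c *\<^sub>C (d *\<^sub>C x) = (c * d) *\<^sub>C x"
    and scaleC_one: "1 *\<^sub>C x = x"
    and scaleR_scaleC: "r *\<^sub>R x = complex_of_real r *\<^sub>C x"

global_interpretation complex_vector: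
  vector_space "scaleC :: complex \<Rightarrow> 'a \<Rightarrow> 'a::complex_vector"
  by unfold_locales (simp_all add: scaleC_add_right scaleC_add_left scaleC_scaleC scaleC_one)

class complex_normed_vector = complex_vector + real_normed_vector +
  assumes norm_scaleC: "norm (c *\<^sub>C x) = cmod c * norm x"

class complex_hilbert = complex_normed_vector + banach +
  fixes cinner :: "'a \<Rightarrow> 'a \<Rightarrow> complex"
  assumes cinner_commute: "cinner x y = cnj (cinner y x)"
    and cinner_add_left: "cinner (x + y) z = cinner x z + cinner y z"
    and cinner_scaleC_left: "cinner (c *\<^sub>C x) y = c * cinner x y"
    and norm_eq_sqrt_cinner: "norm x = sqrt (Re (cinner x x))"

instantiation blinfun :: (real_normed_vector, complex_normed_vector) complex_vector
begin

lift_definition scaleC_blinfun :: "complex \<Rightarrow> 'a \<Rightarrow>\<^sub>L 'b \<Rightarrow> 'a \<Rightarrow>\<^sub>L 'b"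
  is "\<lambda>c f x. c *\<^sub>C f x"
proof -
  fix c and f :: "'a \<Rightarrow> 'b"
  assume "bounded_linear f"
  then interpret bounded_linear f .
  obtain K where K: "\<And>x. norm (f x) \<le> norm x * K"
    using bounded by blast
  show "bounded_linear (\<lambda>x. c *\<^sub>C f x)"
  proof (rule bounded_linear_intro)
    show "norm (c *\<^sub>C f x) \<le> norm x * (cmod c * K)" for x
      using mult_left_mono[OF K[of x], of "cmod c"] by (simp add: norm_scaleC algebra_simps)
  qed (simp_all add: add scaleR scaleC_add_right scaleR_scaleC scaleC_scaleC mult.commute)
qed

instance
  by standard
    (transfer; simp add: fun_eq_iff scaleC_add_right scaleC_add_left scaleC_scaleC scaleC_one
      scaleR_scaleC)+

end

definition fin_dim :: "'a::complex_vector set \<Rightarrow> bool" where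
  "fin_dim Z \<longleftrightarrow> (\<exists>B. finite B \<and> Z \<subseteq> complex_vector.span B)"


section \<open>Normed spaces on carrier sets, and classes of operators between them\<close>

record 'a nspace =
  pts :: "'a set"
  nm :: "'a \<Rightarrow> real"

text \<open>The case distinction is only there because the locale \<^locale>\<open>Metric_space\<close> requires the
  distance to be symmetric and non-negative outside the carrier as well.\<close>

definition ntop :: "'a::complex_vector nspace \<Rightarrow> 'a topology" where
  "ntop X = Metric_space.mtopology (pts X)
     (\<lambda>x y. if x \<in> pts X \<and> y \<in> pts X then nm X (x - y) else 0)"

definition bounded_ops ::
  "'a::complex_vector nspace \<Rightarrow> 'b::complex_vector nspace \<Rightarrow> ('a \<Rightarrow> 'b) set" where
  "bounded_ops X Y = {T \<in> pts X \<rightarrow>\<^sub>E pts Y.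
     (\<forall>x\<in>pts X. \<forall>y\<in>pts X. T (x + y) = T x + T y) \<and>
     (\<forall>c. \<forall>x\<in>pts X. T (c *\<^sub>C x) = c *\<^sub>C T x) \<and>
     (\<exists>C. \<forall>x\<in>pts X. nm Y (T x) \<le> C * nm X x)}"

definition compact_ops ::
  "'a::complex_vector nspace \<Rightarrow> 'b::complex_vector nspace \<Rightarrow> ('a \<Rightarrow> 'b) set" where
  "compact_ops X Y = {T \<in> bounded_ops X Y.
     compactin (ntop Y) (ntop Y closure_of (T ` {x \<in> pts X. nm X x \<le> 1}))}"

definition strictly_singular_ops ::
  "'a::complex_vector nspace \<Rightarrow> 'b::complex_vector nspace \<Rightarrow> ('a \<Rightarrow> 'b) set" where
  "strictly_singular_ops X Y = {T \<in> bounded_ops X Y.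
     \<forall>Z. complex_vector.subspace Z \<longrightarrow> closedin (ntop X) Z \<longrightarrow> \<not> fin_dim Z \<longrightarrow>
       \<not> embedding_map (subtopology (ntop X) Z) (ntop Y) T}"

text \<open>\<^const>\<open>vector_space.dim\<close> is 0 on infinite-dimensional spaces, which therefore have to be
  listed separately.\<close>

definition finitely_strictly_singular_ops ::
  "'a::complex_vector nspace \<Rightarrow> 'b::complex_vector nspace \<Rightarrow> ('a \<Rightarrow> 'b) set" where
  "finitely_strictly_singular_ops X Y = {T \<in> bounded_ops X Y.
     \<forall>\<epsilon>>0. \<exists>N::nat. \<forall>Z. complex_vector.subspace Z \<longrightarrow> Z \<subseteq> pts X \<longrightarrow>
       \<not> fin_dim Z \<or> N \<le> complex_vector.dim Z \<longrightarrow>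
       (\<exists>x\<in>Z. nm X x = 1 \<and> nm Y (T x) < \<epsilon>)}"


section \<open>Lorentz sequence spaces\<close>

text \<open>Sequences are indexed from 0. For bounded \<open>x\<close>, \<open>rearr x k\<close> is the
  \<open>(k + 1)\<close>-st largest modulus of an entry of \<open>x\<close>.\<close>

definition rearr :: "(nat \<Rightarrow> complex) \<Rightarrow> nat \<Rightarrow> real" where
  "rearr x k = Inf {t. 0 \<le> t \<and> finite {j. t < cmod (x j)} \<and> card {j. t < cmod (x j)} \<le> k}"

definition c00 :: "(nat \<Rightarrow> complex) set" where
  "c00 = {x. finite {k. x k \<noteq> 0}}"

definition lorentz_norm :: "(nat \<Rightarrow> real) \<Rightarrow> real \<Rightarrow> (nat \<Rightarrow> complex) \<Rightarrow> real" where
  "lorentz_norm w p x = (\<Sum>k. w k * rearr x k powr p) powr (1 / p)"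

text \<open>The bounded sequences for which the series defining the norm converges form a Banach space
  containing \<^const>\<open>c00\<close>. The completion of \<^const>\<open>c00\<close> is realised as its closure in there.\<close>

definition lorentz :: "(nat \<Rightarrow> real) \<Rightarrow> real \<Rightarrow> (nat \<Rightarrow> complex) nspace" where
  "lorentz w p =
     \<lparr>pts = {x. bounded (range x) \<and> summable (\<lambda>k. w k * rearr x k powr p) \<and>
             (\<forall>\<epsilon>>0. \<exists>y\<in>c00. lorentz_norm w p (\<lambda>k. x k - y k) < \<epsilon>)},
      nm = lorentz_norm w p\<rparr>"


section \<open>Spaces of compact operators on a Hilbert space\<close>

text \<open>Elements of the type \<open>'h \<Rightarrow>\<^sub>L 'h\<close> are in general only real-linear.\<close>

definition compact_clinear :: "('h::complex_hilbert \<Rightarrow>\<^sub>L 'h) \<Rightarrow> bool" where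
  "compact_clinear A \<longleftrightarrow> (\<forall>c x. A (c *\<^sub>C x) = c *\<^sub>C A x) \<and>
     compact (closure (blinfun_apply A ` cball 0 1))"

definition adj :: "('h::complex_hilbert \<Rightarrow>\<^sub>L 'h) \<Rightarrow> 'h \<Rightarrow>\<^sub>L 'h" where
  "adj A = (THE B. \<forall>x y. cinner (A x) y = cinner x (blinfun_apply B y))"

text \<open>The singular values of \<open>A\<close> are the square roots of the eigenvalues of \<open>A\<^sup>* A\<close>, in
  non-increasing order and repeated according to multiplicity; they are followed by zeros if \<open>A\<close>
  has finite rank, while for \<open>A\<close> of infinite rank the value 0 does not occur. The limit condition
  keeps the sets \<open>{i. s i = t}\<close> finite, so that \<^const>\<open>card\<close> is meaningful.\<close>

definition singular_values :: "('h::complex_hilbert \<Rightarrow>\<^sub>L 'h) \<Rightarrow> nat \<Rightarrow> real" where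
  "singular_values A = (THE s. decseq s \<and> s \<longlonglongrightarrow> 0 \<and>
     (\<forall>t>0. card {i. s i = t} =
        complex_vector.dim {x. adj A (A x) = complex_of_real (t\<^sup>2) *\<^sub>C x}))"

definition schatten ::
  "(nat \<Rightarrow> complex) nspace \<Rightarrow> ('h::complex_hilbert \<Rightarrow>\<^sub>L 'h) nspace" where
  "schatten E =
     \<lparr>pts = {A. compact_clinear A \<and> (\<lambda>i. complex_of_real (singular_values A i)) \<in> pts E},
      nm = (\<lambda>A. nm E (\<lambda>i. complex_of_real (singular_values A i)))\<rparr>"

end

theory Submission imports Defs
begin

text \<open>
  Both operators that show the inclusions to be strict have the form \<open>J' \<circ> Q\<close>, where \<open>Q\<close> is a
  projection of the first space onto a mixed sequence space, the \<open>\<ell>\<^sub>a\<close>-sum of Hilbert spaces of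
  dimensions \<open>d n\<close>, and \<open>J'\<close> embeds the \<open>\<ell>\<^sub>b\<close>-sum of the same Hilbert spaces into the second space, with
  \<open>a < b\<close>. For every \<open>d\<close>, the class with parameters \<open>w, p\<close> has complemented subspaces of this kind for the
  exponents \<open>p\<close> and 2 (\<open>complemented_lorentz_blocks\<close>, \<open>complemented_hilbert\<close>), and the
  hypothesis on the exponents says precisely that \<open>a \<in> {p1, 2}\<close> and \<open>b \<in> {p2, 2}\<close> can be
  chosen with \<open>a < b\<close>.

  By an argument of Milman, a space of sequences of blocks that is large enough contains a vector whose
  maximal block norm is attained at \<open>N\<close> places (\<open>flat_vector_exists\<close>). The quotient of its norms for the
  exponents \<open>b\<close> and \<open>a\<close> is at most \<open>N powr (1 / b - 1 / a)\<close>, which tends to 0 (\<open>small_image\<close>). If all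
  blocks are one-dimensional, then dimension \<open>N\<close> is large enough, so the operator is finitely strictly
  singular; it is not compact, since the images of the unit vectors are separated. If the dimensions of the
  blocks are unbounded, an infinite-dimensional space is still large enough, so the operator is
  strictly singular; but it is bounded below on each block, uniformly, and therefore not finitely strictly
  singular.

  The general inclusions are soft, once finitely many functionals are known to recognise the norm of a given
  operator up to a small error (\<open>finitely_many_functionals_almost_norm\<close>).

  All estimates for the norm of a Lorentz--Schatten class come from one inequality,
  \<open>matrix_coefficients_le_singular_values\<close>: the norm of \<open>A\<close> is the supremum of
  \<open>(\<Sum>k. w k * cmod (cinner (A (x k)) (y k)) powr p) powr (1 / p)\<close> over all orthogonal
  families \<open>x, y\<close> of vectors of norm at most 1, attained at the singular vectors. It rests on a singular value decomposition of
  compact operators, \<open>svd_exists\<close>, which is obtained by maximising \<open>norm (A x)\<close> over unit vectors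
  step by step.
\<close>

section \<open>Inner products\<close>

lemma cinner_add_right: "cinner x (y + z) = cinner x y + cinner x z"
  by (metis cinner_commute cinner_add_left complex_cnj_add)

lemma cinner_scaleC_right: "cinner x (c *\<^sub>C y) = cnj c * cinner x y"
  by (metis cinner_commute cinner_scaleC_left complex_cnj_mult)

lemma cinner_scaleR_left: "cinner (r *\<^sub>R x) y = of_real r * cinner x y"
  by (simp add: scaleR_scaleC cinner_scaleC_left)

lemma cinner_scaleR_right: "cinner x (r *\<^sub>R y) = of_real r * cinner x y"
  by (simp add: scaleR_scaleC cinner_scaleC_right)

interpretation cinner_left: additive "\<lambda>x. cinner x y" for y :: "'a::complex_hilbert"
  by standard (rule cinner_add_left)

interpretation cinner_right: additive "cinner x" for x :: "'a::complex_hilbert"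
  by standard (rule cinner_add_right)

lemmas cinner_linear [simp] =
  cinner_add_left cinner_add_right cinner_scaleC_left cinner_scaleC_right
  cinner_scaleR_left cinner_scaleR_right
  cinner_left.zero cinner_right.zero cinner_left.minus cinner_right.minus
  cinner_left.diff cinner_right.diff

lemma cinner_self: "cinner x x = complex_of_real ((norm x)\<^sup>2)"
proof -
  have "Im (cinner x x) = 0"
    using cinner_commute[of x x] by (simp add: complex_eq_iff)
  moreover have "0 \<le> Re (cinner x x)"
    using norm_ge_zero[of x] unfolding norm_eq_sqrt_cinner[of x] by simp
  ultimately show ?thesis
    by (simp add: complex_eq_iff norm_eq_sqrt_cinner)
qed

lemma cmod_cinner_commute: "cmod (cinner x y) = cmod (cinner y x)"
  by (subst cinner_commute) simp

lemma norm_add_sq: "(norm (x + y))\<^sup>2 = (norm x)\<^sup>2 + (norm y)\<^sup>2 + 2 * Re (cinner x y)"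
  for x y :: "'a::complex_hilbert"
proof -
  have "complex_of_real ((norm (x + y))\<^sup>2) = cinner (x + y) (x + y)"
    by (rule cinner_self[symmetric])
  also have "\<dots> = of_real ((norm x)\<^sup>2) + of_real ((norm y)\<^sup>2) + (cinner x y + cnj (cinner x y))"
    unfolding cinner_add_left cinner_add_right
    by (simp add: cinner_self cinner_commute[of y x])
  also have "\<dots> = of_real ((norm x)\<^sup>2 + (norm y)\<^sup>2 + 2 * Re (cinner x y))"
    by (simp add: complex_add_cnj)
  finally show ?thesis
    unfolding of_real_eq_iff .
qed

lemma norm_diff_sq: "(norm (x - y))\<^sup>2 = (norm x)\<^sup>2 + (norm y)\<^sup>2 - 2 * Re (cinner x y)"
  for x y :: "'a::complex_hilbert"
  using norm_add_sq[of x "- y"] by simp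

lemma cauchy_schwarz: "cmod (cinner x y) \<le> norm x * norm y"
proof (cases "y = 0")
  case False
  define c where "c = cinner x y / of_real ((norm y)\<^sup>2)"
  have y: "norm y > 0" using False by simp
  have "cinner x (c *\<^sub>C y) = of_real ((cmod (cinner x y))\<^sup>2 / (norm y)\<^sup>2)"
    by (simp add: c_def complex_norm_square mult.commute del: of_real_power)
  moreover have "cmod c = cmod (cinner x y) / (norm y)\<^sup>2"
    by (simp add: c_def norm_divide norm_power)
  then have "norm (c *\<^sub>C y) = cmod (cinner x y) / norm y"
    by (simp add: norm_scaleC power2_eq_square)
  then have "(norm (c *\<^sub>C y))\<^sup>2 = (cmod (cinner x y))\<^sup>2 / (norm y)\<^sup>2"
    by (simp add: power_divide)
  ultimately have "(norm (x - c *\<^sub>C y))\<^sup>2 = (norm x)\<^sup>2 - (cmod (cinner x y))\<^sup>2 / (norm y)\<^sup>2"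
    by (simp add: norm_diff_sq del: cinner_linear)
  then have "(cmod (cinner x y))\<^sup>2 / (norm y)\<^sup>2 \<le> (norm x)\<^sup>2"
    by (metis diff_ge_0_iff_ge zero_le_power2)
  then have "(cmod (cinner x y))\<^sup>2 \<le> (norm x * norm y)\<^sup>2"
    using y by (simp add: field_simps power_mult_distrib)
  then show ?thesis
    by (rule power2_le_imp_le) simp
qed simp

lemma bounded_linear_cinner_left: "bounded_linear (\<lambda>x. cinner x y)"
  by (rule bounded_linear_intro[where K = "norm y"])
    (simp_all add: cauchy_schwarz scaleR_conv_of_real)

lemma bounded_linear_cinner_right: "bounded_linear (cinner x)"
  by (rule bounded_linear_intro[where K = "norm x"])
    (simp_all add: cauchy_schwarz scaleR_conv_of_real mult.commute[of "norm x"]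
      flip: mult.commute[of "norm x"])

lemmas cinner_sum_left = cinner_left.sum
lemmas cinner_sum_right = cinner_right.sum

lemma bounded_linear_scaleC: "bounded_linear ((*\<^sub>C) c :: 'a \<Rightarrow> 'a::complex_normed_vector)"
  by (rule bounded_linear_intro[where K = "cmod c"])
    (simp_all add: scaleC_add_right scaleR_scaleC scaleC_scaleC norm_scaleC mult.commute)

lemma scaleC_simps [simp]:
  "0 *\<^sub>C x = 0" "c *\<^sub>C 0 = 0" "(- c) *\<^sub>C x = - (c *\<^sub>C x)" "c *\<^sub>C (- x) = - (c *\<^sub>C x)"
  "1 *\<^sub>C x = x" "c *\<^sub>C (d *\<^sub>C x) = (c * d) *\<^sub>C x"
  for x :: "'a::complex_vector"
  by (simp_all add: scaleC_scaleC)

lemma cinner_all_zero: "(\<And>y. cinner x y = 0) \<Longrightarrow> x = 0"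
  by (metis cinner_self norm_eq_zero of_real_eq_0_iff power_eq_0_iff)

lemma pythagoras:
  fixes u :: "'i \<Rightarrow> 'a::complex_hilbert"
  assumes "finite I" "\<And>i j. i \<in> I \<Longrightarrow> j \<in> I \<Longrightarrow> i \<noteq> j \<Longrightarrow> cinner (u i) (u j) = 0"
  shows "(norm (\<Sum>i\<in>I. u i))\<^sup>2 = (\<Sum>i\<in>I. (norm (u i))\<^sup>2)"
  using assms
proof (induction I)
  case (insert i I)
  have "cinner (u i) (\<Sum>j\<in>I. u j) = 0"
    unfolding cinner_sum_right using insert by (intro sum.neutral) auto
  then show ?case
    using insert by (simp add: norm_add_sq)
qed simp

text \<open>Zero vectors are admitted, because the left singular vectors belonging to the singular
  value 0 will be taken to be 0.\<close>

definition ortho_fam :: "('i \<Rightarrow> 'a::complex_hilbert) \<Rightarrow> bool" where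
  "ortho_fam x \<longleftrightarrow> (\<forall>i j. i \<noteq> j \<longrightarrow> cinner (x i) (x j) = 0) \<and> (\<forall>i. norm (x i) \<le> 1)"

lemma bessel:
  fixes x :: "'i \<Rightarrow> 'a::complex_hilbert"
  assumes x: "ortho_fam x"
  shows "(\<Sum>i\<in>I. (cmod (cinner z (x i)))\<^sup>2) \<le> (norm z)\<^sup>2"
proof (cases "finite I")
  case True
  define S where "S = (\<Sum>i\<in>I. (cmod (cinner z (x i)))\<^sup>2)"
  define u where "u i = cinner z (x i) *\<^sub>C x i" for i
  have "(norm (\<Sum>i\<in>I. u i))\<^sup>2 = (\<Sum>i\<in>I. (norm (u i))\<^sup>2)"
    by (rule pythagoras[OF True]) (use x in \<open>simp add: u_def ortho_fam_def\<close>)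
  also have "\<dots> \<le> S"
    unfolding S_def
  proof (rule sum_mono)
    fix i
    have "norm (x i) \<le> 1" using x by (simp add: ortho_fam_def)
    then show "(norm (u i))\<^sup>2 \<le> (cmod (cinner z (x i)))\<^sup>2"
      by (intro power_mono) (simp_all add: u_def norm_scaleC mult_left_le)
  qed
  finally have 1: "(norm (\<Sum>i\<in>I. u i))\<^sup>2 \<le> S" .
  have "cinner z (\<Sum>i\<in>I. u i) = (\<Sum>i\<in>I. cnj (cinner z (x i)) * cinner z (x i))"
    by (simp add: cinner_sum_right u_def)
  also have "\<dots> = of_real S"
    unfolding S_def of_real_sum by (intro sum.cong refl) (simp add: complex_norm_square del: of_real_power)
  finally have 2: "Re (cinner z (\<Sum>i\<in>I. u i)) = S" by simp
  have "0 \<le> (norm (z - (\<Sum>i\<in>I. u i)))\<^sup>2" by simp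
  also have "\<dots> \<le> (norm z)\<^sup>2 - S"
    unfolding norm_diff_sq 2 using 1 by simp
  finally show ?thesis by (simp add: S_def)
qed simp

lemma bessel':
  assumes "ortho_fam x"
  shows "(\<Sum>i\<in>I. (cmod (cinner (x i) z))\<^sup>2) \<le> (norm z)\<^sup>2"
  using bessel[OF assms, where z = z and I = I] by (subst cmod_cinner_commute)

lemma orthogonal_series:
  fixes u :: "nat \<Rightarrow> 'a::complex_hilbert"
  assumes orth: "\<And>i j. i \<noteq> j \<Longrightarrow> cinner (u i) (u j) = 0"
    and sm: "summable (\<lambda>i. (norm (u i))\<^sup>2)"
  shows "summable u" and "(norm (suminf u))\<^sup>2 = (\<Sum>i. (norm (u i))\<^sup>2)"
proof -
  have eq: "(norm (\<Sum>i\<in>I. u i))\<^sup>2 = (\<Sum>i\<in>I. (norm (u i))\<^sup>2)" if "finite I" for I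
    by (rule pythagoras[OF that orth])
  show su: "summable u"
    unfolding summable_Cauchy
  proof (intro allI impI)
    fix e :: real assume e: "e > 0"
    then obtain N where N: "\<And>m n. m \<ge> N \<Longrightarrow> norm (\<Sum>i=m..<n. (norm (u i))\<^sup>2) < e\<^sup>2"
      using sm unfolding summable_Cauchy by (metis zero_less_power)
    have "norm (sum u {m..<n}) < e" if "m \<ge> N" for m n
    proof -
      have "(norm (sum u {m..<n}))\<^sup>2 < e\<^sup>2"
        using N[OF that, of n] by (simp add: eq)
      then show ?thesis using e by (simp add: power2_less_imp_less)
    qed
    then show "\<exists>N. \<forall>m\<ge>N. \<forall>n. norm (sum u {m..<n}) < e" by blast
  qed
  have "(\<lambda>n. (norm (\<Sum>i<n. u i))\<^sup>2) \<longlonglongrightarrow> (norm (suminf u))\<^sup>2"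
    by (intro tendsto_intros summable_LIMSEQ su)
  moreover have "(\<lambda>n. (norm (\<Sum>i<n. u i))\<^sup>2) \<longlonglongrightarrow> (\<Sum>i. (norm (u i))\<^sup>2)"
    unfolding eq[OF finite_lessThan] by (rule summable_LIMSEQ[OF sm])
  ultimately show "(norm (suminf u))\<^sup>2 = (\<Sum>i. (norm (u i))\<^sup>2)"
    by (rule LIMSEQ_unique)
qed

section \<open>Compact operators\<close>

text \<open>Total boundedness is easier to transport along sums and limits than compactness of the closure.\<close>

lemma compact_clinear_iff:
  "compact_clinear A \<longleftrightarrow> (\<forall>c x. A (c *\<^sub>C x) = c *\<^sub>C A x) \<and>
     (\<forall>e>0. \<exists>k. finite k \<and> blinfun_apply A ` cball 0 1 \<subseteq> (\<Union>x\<in>k. ball x e))"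
proof -
  let ?S = "blinfun_apply A ` cball 0 1"
  have "compact (closure ?S) \<longleftrightarrow> (\<forall>e>0. \<exists>k. finite k \<and> ?S \<subseteq> (\<Union>x\<in>k. ball x e))" (is "_ = ?R")
  proof
    assume "compact (closure ?S)"
    then show ?R
      unfolding compact_eq_totally_bounded by (meson closure_subset order_trans)
  next
    assume R: ?R
    show "compact (closure ?S)"
      unfolding compact_eq_totally_bounded
    proof (intro conjI allI impI)
      show "complete (closure ?S)" by (simp add: complete_eq_closed)
      fix e :: real assume "e > 0"
      then obtain k where k: "finite k" "?S \<subseteq> (\<Union>x\<in>k. ball x (e/2))"
        using R by (meson half_gt_zero)
      have "closure ?S \<subseteq> (\<Union>x\<in>k. cball x (e/2))"
      proof (rule closure_minimal)
        show "?S \<subseteq> (\<Union>x\<in>k. cball x (e/2))"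
          using k(2) ball_subset_cball by blast
      qed (use k(1) in auto)
      also have "\<dots> \<subseteq> (\<Union>x\<in>k. ball x e)"
        using \<open>e > 0\<close> by auto
      finally show "\<exists>k. finite k \<and> closure ?S \<subseteq> (\<Union>x\<in>k. ball x e)" using k(1) by blast
    qed
  qed
  then show ?thesis by (simp add: compact_clinear_def)
qed

lemma compact_clinear_add:
  assumes A: "compact_clinear A" and B: "compact_clinear B"
  shows "compact_clinear (A + B)"
  unfolding compact_clinear_iff
proof (intro conjI allI impI)
  show "(A + B) (c *\<^sub>C x) = c *\<^sub>C (A + B) x" for c x
    using A B by (simp add: compact_clinear_iff blinfun.add_left scaleC_add_right)
  fix e :: real assume "e > 0"
  then have e: "e / 2 > 0" by simp
  obtain k where k: "finite k" "A ` cball 0 1 \<subseteq> (\<Union>x\<in>k. ball x (e/2))"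
    using A e unfolding compact_clinear_iff by blast
  obtain l where l: "finite l" "B ` cball 0 1 \<subseteq> (\<Union>x\<in>l. ball x (e/2))"
    using B e unfolding compact_clinear_iff by blast
  have "(A + B) ` cball 0 1 \<subseteq> (\<Union>x\<in>(\<lambda>(x,y). x + y) ` (k \<times> l). ball x e)"
  proof (clarify)
    fix z :: 'a assume z: "z \<in> cball 0 1"
    obtain x y where xy: "x \<in> k" "y \<in> l" "dist x (A z) < e/2" "dist y (B z) < e/2"
      using k(2) l(2) z by (force simp: subset_iff)
    then have "dist (x + y) ((A + B) z) < e"
      using dist_triangle_add[of x y "A z" "B z"] by (simp add: blinfun.add_left)
    with xy show "(A + B) z \<in> (\<Union>x\<in>(\<lambda>(x,y). x + y) ` (k \<times> l). ball x e)"
      by force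
  qed
  then show "\<exists>k. finite k \<and> (A + B) ` cball 0 1 \<subseteq> (\<Union>x\<in>k. ball x e)"
    using k(1) l(1) by (meson finite_SigmaI finite_imageI)
qed

lemma compact_clinear_scaleC:
  assumes A: "compact_clinear A"
  shows "compact_clinear (c *\<^sub>C A)"
proof -
  have "compact ((*\<^sub>C) c ` closure (A ` cball 0 1))"
    using A unfolding compact_clinear_def
    by (intro compact_continuous_image linear_continuous_on bounded_linear_scaleC) auto
  moreover have "(c *\<^sub>C A) ` cball 0 1 \<subseteq> (*\<^sub>C) c ` closure (A ` cball 0 1)"
    using closure_subset by (fastforce simp: scaleC_blinfun.rep_eq)
  ultimately have "compact (closure ((c *\<^sub>C A) ` cball 0 1))"
    by (metis closure_minimal closed_closure compact_Int_closed compact_imp_closed inf.absorb2)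
  then show ?thesis
    using A by (simp add: compact_clinear_def scaleC_blinfun.rep_eq mult.commute)
qed

lemma compact_clinear_approx:
  assumes lin: "\<And>c x. blinfun_apply A (c *\<^sub>C x) = c *\<^sub>C A x"
    and ap: "\<And>e. e > 0 \<Longrightarrow> \<exists>B. compact_clinear B \<and> (\<forall>x. norm (A x - B x) \<le> e * norm x)"
  shows "compact_clinear A"
  unfolding compact_clinear_iff
proof (intro conjI allI impI)
  fix e :: real assume "e > 0"
  then have e: "e / 2 > 0" by simp
  obtain B where B: "compact_clinear B" "\<And>x. norm (A x - B x) \<le> e / 2 * norm x"
    using ap[OF e] by blast
  obtain k where k: "finite k" "B ` cball 0 1 \<subseteq> (\<Union>x\<in>k. ball x (e/2))"
    using B e unfolding compact_clinear_iff by blast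
  have "A ` cball 0 1 \<subseteq> (\<Union>x\<in>k. ball x e)"
  proof (clarify)
    fix z :: 'a assume z: "z \<in> cball 0 1"
    then obtain x where x: "x \<in> k" "dist x (B z) < e/2"
      using k(2) by (force simp: subset_iff)
    have "e / 2 * norm z \<le> e / 2" using z e by (simp add: mult_left_le)
    then have "dist (A z) (B z) \<le> e / 2" using B(2)[of z] by (simp add: dist_norm)
    then have "dist x (A z) < e" using x(2) dist_triangle_lt[of x "B z" "A z" e] by (simp add: dist_commute)
    with x show "A z \<in> (\<Union>x\<in>k. ball x e)" by auto
  qed
  then show "\<exists>k. finite k \<and> A ` cball 0 1 \<subseteq> (\<Union>x\<in>k. ball x e)" using k(1) by blast
qed (rule lin)

lemma compact_clinear_zero: "compact_clinear 0"
  by (auto simp: compact_clinear_iff intro: exI[of _ "{0}"])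

lemma compact_clinear_rank_one:
  assumes A: "\<And>z. blinfun_apply A z = cinner z a *\<^sub>C b"
  shows "compact_clinear A"
proof -
  have cont: "continuous_on UNIV (\<lambda>c. c *\<^sub>C b)"
    by (rule linear_continuous_on, rule bounded_linear_intro[where K = "norm b"])
      (simp_all add: scaleC_add_left scaleR_scaleC scaleR_conv_of_real norm_scaleC)
  have c: "compact ((\<lambda>c. c *\<^sub>C b) ` cball 0 (norm a))"
    by (intro compact_continuous_image continuous_on_subset[OF cont]) auto
  have sub: "A ` cball 0 1 \<subseteq> (\<lambda>c. c *\<^sub>C b) ` cball 0 (norm a)"
  proof (clarify)
    fix z :: 'a assume "z \<in> cball 0 1"
    then have "cmod (cinner z a) \<le> norm a"
      using cauchy_schwarz[of z a] mult_right_mono[of "norm z" 1 "norm a"] by simp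
    then show "A z \<in> (\<lambda>c. c *\<^sub>C b) ` cball 0 (norm a)"
      using A by auto
  qed
  have "compact (closure (A ` cball 0 1))"
    using c sub by (metis closure_minimal closed_closure compact_Int_closed compact_imp_closed inf.absorb2)
  then show ?thesis
    by (simp add: compact_clinear_def A)
qed

lemma compact_clinear_subseq:
  assumes A: "compact_clinear A" and x: "\<And>n. norm (x n) \<le> 1"
  shows "\<exists>r y. strict_mono (r :: nat \<Rightarrow> nat) \<and> (\<lambda>n. A (x (r n))) \<longlonglongrightarrow> y"
proof -
  have "seq_compact (closure (A ` cball 0 1))"
    using A by (simp add: compact_clinear_def compact_imp_seq_compact)
  moreover have "A (x n) \<in> closure (A ` cball 0 1)" for n
    using x closure_subset by fastforce
  ultimately obtain y r where "strict_mono r" "((\<lambda>n. A (x n)) \<circ> r) \<longlonglongrightarrow> y"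
    unfolding seq_compact_def by metis
  then show ?thesis by (auto simp: o_def)
qed

section \<open>Singular value decomposition\<close>

text \<open>By compactness, the images of a maximising sequence of unit vectors may be assumed to converge. The
  parallelogram law then forces the sequence itself to converge: the midpoint of two almost maximising unit
  vectors with close images must have almost norm 1.\<close>

lemma norm_maximiser:
  assumes A: "compact_clinear A" and M: "complex_vector.subspace M" "closed M"
    and x0: "x0 \<in> M" "norm x0 = 1"
  shows "\<exists>e\<in>M. norm e = 1 \<and> (\<forall>x\<in>M. norm (A x) \<le> norm (A e) * norm x)"
proof -
  define \<sigma> where "\<sigma> = (SUP x\<in>M \<inter> sphere 0 1. norm (A x))"
  have bdd: "bdd_above ((\<lambda>x. norm (A x)) ` (M \<inter> sphere 0 1))"
    by (rule bdd_aboveI2[where M = "norm A"]) (use norm_blinfun[of A] in \<open>metis IntD2 mem_sphere_0 mult.right_neutral\<close>)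
  have ne: "M \<inter> sphere 0 1 \<noteq> {}" using x0 by auto
  have up1: "norm (A x) \<le> \<sigma>" if "x \<in> M" "norm x = 1" for x
    unfolding \<sigma>_def by (rule cSUP_upper[OF _ bdd]) (use that in auto)
  have up: "norm (A x) \<le> \<sigma> * norm x" if x: "x \<in> M" for x
  proof (cases "x = 0")
    case False
    define u where "u = inverse (norm x) *\<^sub>R x"
    have "u \<in> M" "norm u = 1"
      using M(1) x False by (auto simp: u_def scaleR_scaleC[of "inverse (norm x)"]
          complex_vector.subspace_scale norm_scaleC norm_inverse)
    then have "norm (A u) \<le> \<sigma>" by (rule up1)
    moreover have "norm (A u) = inverse (norm x) * norm (A x)"
      by (simp add: u_def blinfun.scaleR_right)
    ultimately show ?thesis
      using False by (simp add: field_simps)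
  qed (simp add: blinfun.zero_right)
  show ?thesis
  proof (cases "\<sigma> \<le> 0")
    case True
    then have "norm (A x) \<le> norm (A x0) * norm x" if "x \<in> M" for x
      using up[OF that] mult_nonpos_nonneg[of \<sigma> "norm x"] mult_nonneg_nonneg[of "norm (A x0)" "norm x"]
      by (meson mult_nonneg_nonneg norm_ge_zero order_trans)
    then show ?thesis using x0 by blast
  next
    case False
    then have \<sigma>: "\<sigma> > 0" by simp
    have "\<exists>x. x \<in> M \<and> norm x = 1 \<and> norm (A x) > \<sigma> - inverse (real (Suc n))" for n
    proof -
      have "\<sigma> - inverse (real (Suc n)) < \<sigma>" by simp
      then show ?thesis
        using less_cSUP_iff[OF ne bdd, of "\<sigma> - inverse (real (Suc n))"] unfolding \<sigma>_def[symmetric] by auto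
    qed
    then obtain z where z: "\<And>n. z n \<in> M" "\<And>n. norm (z n) = 1"
        "\<And>n. norm (A (z n)) > \<sigma> - inverse (real (Suc n))"
      by metis
    have zl: "(\<lambda>n. norm (A (z n))) \<longlonglongrightarrow> \<sigma>"
    proof (rule tendsto_sandwich)
      show "(\<lambda>n. \<sigma> - inverse (real (Suc n))) \<longlonglongrightarrow> \<sigma>"
        using tendsto_diff[OF tendsto_const LIMSEQ_inverse_real_of_nat, of \<sigma>] by simp
      show "\<forall>\<^sub>F n in sequentially. \<sigma> - inverse (real (Suc n)) \<le> norm (A (z n))"
        using z(3) by (auto intro!: always_eventually less_imp_le)
      show "\<forall>\<^sub>F n in sequentially. norm (A (z n)) \<le> \<sigma>"
        using up1 z by (auto intro!: always_eventually)
    qed auto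
    obtain r y where r: "strict_mono r" and y: "(\<lambda>n. A (z (r n))) \<longlonglongrightarrow> y"
      using compact_clinear_subseq[OF A, of z] z(2) by auto
    define u where "u n = z (r n)" for n
    have u: "u n \<in> M" "norm (u n) = 1" for n by (simp_all add: u_def z)
    have ul: "(\<lambda>n. norm (A (u n))) \<longlonglongrightarrow> \<sigma>"
      using LIMSEQ_subseq_LIMSEQ[OF zl r] by (simp add: u_def o_def)
    \<comment> \<open>The parallelogram law on both sides bounds \<open>norm (u m - u n)\<close> by \<open>norm (A (u m) - A (u n))\<close>.\<close>
    have par: "(norm (u m - u n))\<^sup>2 \<le> 4 - (2 * (norm (A (u m)))\<^sup>2 + 2 * (norm (A (u n)))\<^sup>2
        - (norm (A (u m) - A (u n)))\<^sup>2) / \<sigma>\<^sup>2" for m n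
    proof -
      have "norm (A (u m + u n)) \<le> \<sigma> * norm (u m + u n)"
        using M(1) u by (intro up complex_vector.subspace_add)
      then have "(norm (A (u m) + A (u n)))\<^sup>2 \<le> \<sigma>\<^sup>2 * (norm (u m + u n))\<^sup>2"
        by (metis blinfun.add_right norm_ge_zero power_mono power_mult_distrib)
      then have "(norm (A (u m) + A (u n)))\<^sup>2 / \<sigma>\<^sup>2 \<le> (norm (u m + u n))\<^sup>2"
        using \<sigma> by (simp add: field_simps)
      moreover have "(norm (u m + u n))\<^sup>2 = 4 - (norm (u m - u n))\<^sup>2"
        by (simp add: norm_add_sq norm_diff_sq u)
      moreover have "(norm (A (u m) + A (u n)))\<^sup>2 =
          2 * (norm (A (u m)))\<^sup>2 + 2 * (norm (A (u n)))\<^sup>2 - (norm (A (u m) - A (u n)))\<^sup>2"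
        by (simp add: norm_add_sq norm_diff_sq)
      ultimately show ?thesis by simp
    qed
    have "Cauchy u"
      unfolding Cauchy_def
    proof (intro allI impI)
      fix e :: real assume e: "e > 0"
      \<comment> \<open>\<open>par\<close> loses \<open>5 * \<epsilon> / \<sigma>\<^sup>2\<close>, which has to stay below \<open>e\<^sup>2\<close>.\<close>
      define \<epsilon> where "\<epsilon> = e\<^sup>2 * \<sigma>\<^sup>2 / 6"
      have \<epsilon>: "\<epsilon> > 0" using e \<sigma> by (simp add: \<epsilon>_def)
      have "(\<lambda>n. (norm (A (u n)))\<^sup>2) \<longlonglongrightarrow> \<sigma>\<^sup>2"
        by (intro tendsto_intros ul)
      then have "\<forall>\<^sub>F n in sequentially. (norm (A (u n)))\<^sup>2 > \<sigma>\<^sup>2 - \<epsilon>"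
        by (rule order_tendstoD) (use \<epsilon> in simp)
      moreover have "Cauchy (\<lambda>n. A (u n))"
        using y by (auto intro!: LIMSEQ_imp_Cauchy simp: u_def)
      then obtain N1 where N1: "\<And>m n. m \<ge> N1 \<Longrightarrow> n \<ge> N1 \<Longrightarrow> dist (A (u m)) (A (u n)) < sqrt \<epsilon>"
        using \<epsilon> unfolding Cauchy_def by (metis real_sqrt_gt_zero)
      ultimately obtain N2 where N2: "\<And>n. n \<ge> N2 \<Longrightarrow> (norm (A (u n)))\<^sup>2 > \<sigma>\<^sup>2 - \<epsilon>"
        unfolding eventually_sequentially by blast
      have "dist (u m) (u n) < e" if "m \<ge> max N1 N2" "n \<ge> max N1 N2" for m n
      proof -
        have "norm (A (u m) - A (u n)) < sqrt \<epsilon>" using N1 that by (simp add: dist_norm)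
        then have "(norm (A (u m) - A (u n)))\<^sup>2 < (sqrt \<epsilon>)\<^sup>2"
          by (intro power_strict_mono) auto
        then have "(norm (A (u m) - A (u n)))\<^sup>2 < \<epsilon>" using \<epsilon> by simp
        then have "4 * \<sigma>\<^sup>2 - 5 * \<epsilon> < 2 * (norm (A (u m)))\<^sup>2 + 2 * (norm (A (u n)))\<^sup>2
            - (norm (A (u m) - A (u n)))\<^sup>2"
          using N2[of m] N2[of n] that by simp
        then have "(4 * \<sigma>\<^sup>2 - 5 * \<epsilon>) / \<sigma>\<^sup>2 \<le> (2 * (norm (A (u m)))\<^sup>2 + 2 * (norm (A (u n)))\<^sup>2
            - (norm (A (u m) - A (u n)))\<^sup>2) / \<sigma>\<^sup>2"
          by (intro divide_right_mono) auto
        moreover have "(4 * \<sigma>\<^sup>2 - 5 * \<epsilon>) / \<sigma>\<^sup>2 = 4 - 5 / 6 * e\<^sup>2"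
          using \<sigma> by (simp add: \<epsilon>_def field_simps)
        ultimately have "(norm (u m - u n))\<^sup>2 \<le> 5 / 6 * e\<^sup>2"
          using par[of m n] by simp
        also have "\<dots> < e\<^sup>2" using e by simp
        finally show ?thesis using e by (simp add: dist_norm power2_less_imp_less)
      qed
      then show "\<exists>N. \<forall>m\<ge>N. \<forall>n\<ge>N. dist (u m) (u n) < e" by blast
    qed
    then obtain e where e: "u \<longlonglongrightarrow> e" by (meson Cauchy_convergent convergent_def)
    have "e \<in> M" using M(2) e u(1) closed_sequentially by blast
    moreover have "norm e = 1"
      using LIMSEQ_unique[OF tendsto_norm[OF e]] u(2) by simp
    moreover have "norm (A e) = \<sigma>"
      using LIMSEQ_unique[OF tendsto_norm[OF blinfun.tendsto[OF tendsto_const e]] ul] .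
    ultimately show ?thesis using up by auto
  qed
qed

text \<open>First-order optimality: otherwise a small step from \<open>e\<close> in the direction of \<open>x\<close>, with suitable phase,
  would increase the quotient of \<open>norm (A e)\<close> and \<open>norm e\<close>.\<close>

lemma norm_maximiser_orthogonal:
  fixes A :: "'h::complex_hilbert \<Rightarrow>\<^sub>L 'h"
  assumes lin: "\<And>c x. A (c *\<^sub>C x) = c *\<^sub>C A x"
    and M: "complex_vector.subspace M" and e: "e \<in> M" "norm e = 1"
    and max: "\<And>x. x \<in> M \<Longrightarrow> norm (A x) \<le> norm (A e) * norm x"
    and x: "x \<in> M" "cinner x e = 0"
  shows "cinner (A x) (A e) = 0"
proof (rule ccontr)
  define q where "q = cinner (A e) (A x)"
  define K where "K = (norm (A e))\<^sup>2 * (norm x)\<^sup>2 + 1"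
  define t where "t = complex_of_real (inverse K) * q"
  assume "cinner (A x) (A e) \<noteq> 0"
  then have q: "cmod q > 0"
    unfolding q_def by (subst cinner_commute) simp
  have K: "K \<ge> 1" by (simp add: K_def)
  have ex: "cinner e x = 0" using x(2) cinner_commute[of e x] by simp
  have 1: "(norm (A (e + t *\<^sub>C x)))\<^sup>2 \<le> (norm (A e) * norm (e + t *\<^sub>C x))\<^sup>2"
    using M e x by (intro power_mono max complex_vector.subspace_add complex_vector.subspace_scale) auto
  have 2: "(norm (e + t *\<^sub>C x))\<^sup>2 = 1 + (cmod t)\<^sup>2 * (norm x)\<^sup>2"
    by (simp add: norm_add_sq ex e norm_scaleC power_mult_distrib)
  have 3: "(norm (A (e + t *\<^sub>C x)))\<^sup>2 =
      (norm (A e))\<^sup>2 + (cmod t)\<^sup>2 * (norm (A x))\<^sup>2 + 2 * Re (cnj t * q)"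
    by (simp add: norm_add_sq lin blinfun.add_right norm_scaleC power_mult_distrib q_def)
  have 4: "Re (cnj t * q) = inverse K * (cmod q)\<^sup>2"
  proof -
    have "cnj t * q = of_real (inverse K) * (q * cnj q)" by (simp add: t_def)
    also have "\<dots> = of_real (inverse K * (cmod q)\<^sup>2)"
      by (simp add: complex_norm_square del: of_real_power)
    finally show ?thesis by (simp only: Re_complex_of_real)
  qed
  have 5: "(cmod t)\<^sup>2 = (inverse K)\<^sup>2 * (cmod q)\<^sup>2"
    using K by (simp add: t_def norm_mult power_mult_distrib norm_inverse)
  have 6: "(norm (A e))\<^sup>2 * (1 + (cmod t)\<^sup>2 * (norm x)\<^sup>2) = (norm (A e))\<^sup>2 + (cmod t)\<^sup>2 * (K - 1)"
    by (simp add: K_def algebra_simps)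
  have "2 * (inverse K * (cmod q)\<^sup>2) + (cmod t)\<^sup>2 * (norm (A x))\<^sup>2 \<le> (cmod t)\<^sup>2 * (K - 1)"
    using 1 unfolding power_mult_distrib 2 3 4 6 by simp
  then have "2 * (inverse K * (cmod q)\<^sup>2) \<le> (cmod t)\<^sup>2 * (K - 1)"
    by (rule order_trans[rotated]) simp
  then have "2 * (inverse K * (cmod q)\<^sup>2) \<le> (inverse K)\<^sup>2 * (cmod q)\<^sup>2 * (K - 1)"
    by (simp only: 5)
  also have "\<dots> \<le> inverse K * (cmod q)\<^sup>2"
    using K by (simp add: field_simps power2_eq_square)
  finally show False
    using q K by (simp add: field_simps)
qed

lemma unit_perp_exists:
  fixes e :: "nat \<Rightarrow> 'h::complex_hilbert"
  assumes inf: "\<not> fin_dim (UNIV :: 'h set)"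
    and e: "\<And>i j. i < n \<Longrightarrow> j < n \<Longrightarrow> i \<noteq> j \<Longrightarrow> cinner (e i) (e j) = 0" "\<And>i. i < n \<Longrightarrow> norm (e i) = 1"
  shows "\<exists>x. norm x = 1 \<and> (\<forall>i<n. cinner x (e i) = 0)"
proof -
  obtain y where y: "y \<notin> complex_vector.span (e ` {..<n})"
    using inf unfolding fin_dim_def by blast
  define x where "x = y - (\<Sum>i<n. cinner y (e i) *\<^sub>C e i)"
  have "x \<noteq> 0"
  proof
    assume "x = 0"
    then have "y = (\<Sum>i<n. cinner y (e i) *\<^sub>C e i)" by (simp add: x_def)
    also have "\<dots> \<in> complex_vector.span (e ` {..<n})"
      by (intro complex_vector.span_sum complex_vector.span_scale complex_vector.span_base) auto
    finally show False using y by simp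
  qed
  have "cinner x (e j) = 0" if "j < n" for j
  proof -
    have "(\<Sum>i<n. cinner y (e i) * cinner (e i) (e j)) = (\<Sum>i<n. if i = j then cinner y (e j) else 0)"
      using e that by (intro sum.cong refl) (auto simp: cinner_self)
    then show ?thesis using that by (simp add: x_def cinner_sum_left)
  qed
  then show ?thesis
    using \<open>x \<noteq> 0\<close> by (intro exI[of _ "inverse (norm x) *\<^sub>R x"]) auto
qed

text \<open>Only the right singular vectors are orthonormal; a left singular vector may be 0 if its singular value
  is 0.\<close>

definition is_svd :: "('h::complex_hilbert \<Rightarrow>\<^sub>L 'h) \<Rightarrow> (nat \<Rightarrow> real) \<Rightarrow> (nat \<Rightarrow> 'h) \<Rightarrow> (nat \<Rightarrow> 'h) \<Rightarrow> bool"
  where "is_svd A s e f \<longleftrightarrow>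
    decseq s \<and> s \<longlonglongrightarrow> 0 \<and> ortho_fam e \<and> (\<forall>i. norm (e i) = 1) \<and>
    ortho_fam f \<and> (\<forall>i. 0 < s i \<longrightarrow> norm (f i) = 1) \<and> (\<forall>i. A (e i) = s i *\<^sub>R f i) \<and>
    (\<forall>x. (\<lambda>i. (of_real (s i) * cinner x (e i)) *\<^sub>C f i) sums A x)"

text \<open>The right singular vectors are chosen one after the other, each maximising the norm of its
  image among the unit vectors orthogonal to its predecessors. The images are then pairwise orthogonal, so
  compactness forces their norms to tend to 0.\<close>

theorem svd_exists:
  fixes A :: "'h::complex_hilbert \<Rightarrow>\<^sub>L 'h"
  assumes A: "compact_clinear A" and inf: "\<not> fin_dim (UNIV :: 'h set)"
  shows "\<exists>s e f. is_svd A s e f"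
proof -
  have lin: "A (c *\<^sub>C x) = c *\<^sub>C A x" for c x
    using A by (simp add: compact_clinear_def)
  define perp where "perp e n = {x :: 'h. \<forall>i<n. cinner x (e i) = 0}" for e :: "nat \<Rightarrow> 'h" and n
  have sub: "complex_vector.subspace (perp e n)" for e n
    by (auto simp: complex_vector.subspace_def perp_def)
  have "closed {x :: 'h. cinner x y = 0}" for y
    by (intro closed_Collect_eq linear_continuous_on bounded_linear_cinner_left continuous_on_const)
  then have cl: "closed (perp e n)" for e n
    unfolding perp_def by (intro closed_Collect_all closed_Collect_imp open_Collect_const)
  define P where "P e n v \<longleftrightarrow> ((\<forall>i<n. norm (e i) = 1) \<and> (\<forall>i<n. \<forall>j<n. i \<noteq> j \<longrightarrow> cinner (e i) (e j) = 0) \<longrightarrow>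
      v \<in> perp e n \<and> norm v = 1 \<and> (\<forall>x\<in>perp e n. norm (A x) \<le> norm (A v) * norm x))" for e n v
  have "\<exists>e. \<forall>n. P e n (e n)"
  proof (rule dependent_wellorder_choice)
    fix e e' :: "nat \<Rightarrow> 'h" and n v
    assume eq: "\<And>y. y < n \<Longrightarrow> e y = e' y"
    then have "perp e n = perp e' n" by (auto simp: perp_def)
    with eq show "P e n v = P e' n v" by (simp add: P_def)
  next
    fix n e
    show "\<exists>v. P e n v"
    proof (cases "(\<forall>i<n. norm (e i) = 1) \<and> (\<forall>i<n. \<forall>j<n. i \<noteq> j \<longrightarrow> cinner (e i) (e j) = 0)")
      case True
      then obtain x0 where "norm x0 = 1" "x0 \<in> perp e n"
        using unit_perp_exists[OF inf, of n e] by (auto simp: perp_def)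
      then show ?thesis
        using norm_maximiser[OF A sub cl] unfolding P_def by metis
    qed (auto simp: P_def)
  qed
  then obtain e where e: "\<And>n. P e n (e n)" by blast
  have on: "(\<forall>i<n. norm (e i) = 1) \<and> (\<forall>i<n. \<forall>j<n. i \<noteq> j \<longrightarrow> cinner (e i) (e j) = 0)" for n
  proof (induction n)
    case (Suc n)
    have n: "norm (e n) = 1" "e n \<in> perp e n" using e[of n] Suc by (auto simp: P_def)
    have p: "cinner (e n) (e i) = 0" "cinner (e i) (e n) = 0" if "i < n" for i
      using n(2) that cinner_commute[of "e i" "e n"] by (auto simp: perp_def)
    show ?case using Suc n(1) p by (auto simp: less_Suc_eq)
  qed simp
  have en: "norm (e n) = 1" for n using on[of "Suc n"] by blast
  have ee: "cinner (e i) (e j) = 0" if "i \<noteq> j" for i j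
    using on[of "Suc (max i j)"] that by auto
  have max: "norm (A x) \<le> norm (A (e n)) * norm x" if "x \<in> perp e n" for x n
    using e[of n] on[of n] that by (auto simp: P_def)
  have eM: "e j \<in> perp e n" if "n \<le> j" for j n
    using that ee by (auto simp: perp_def)
  define s where "s n = norm (A (e n))" for n
  define f where "f n = inverse (s n) *\<^sub>R A (e n)" for n
  have s0: "s n \<ge> 0" for n by (simp add: s_def)
  have Ae: "A (e i) = s i *\<^sub>R f i" for i
    by (cases "A (e i) = 0") (simp_all add: f_def s_def)
  have dec: "decseq s"
    unfolding decseq_Suc_iff s_def
  proof
    fix n show "norm (A (e (Suc n))) \<le> norm (A (e n))"
      using max[OF eM[of n "Suc n"]] by (simp add: en)
  qed
  have AA0: "cinner (A (e j)) (A (e i)) = 0" if "i < j" for i j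
    by (rule norm_maximiser_orthogonal[OF lin sub[of e i] eM en max eM ee]) (use that in auto)
  have AA: "cinner (A (e i)) (A (e j)) = 0" if "i \<noteq> j" for i j
    using that AA0[of i j] AA0[of j i] cinner_commute[of "A (e i)" "A (e j)"]
    by (cases "i < j") auto
  have f: "ortho_fam f"
    unfolding ortho_fam_def
  proof (intro conjI allI impI)
    show "norm (f i) \<le> 1" for i
      by (cases "A (e i) = 0") (simp_all add: f_def s_def)
  qed (simp add: f_def AA)
  have f1: "norm (f i) = 1" if "0 < s i" for i
    using that by (simp add: f_def s_def)
  have lim: "s \<longlonglongrightarrow> 0"
  proof (rule ccontr)
    assume n: "\<not> s \<longlonglongrightarrow> 0"
    obtain \<delta> where \<delta>: "\<delta> > 0" "\<And>i. s i \<ge> \<delta>"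
    proof -
      obtain r where "r > 0" "\<And>N. \<exists>n\<ge>N. \<not> norm (s n) < r"
        using n unfolding LIMSEQ_iff by auto
      then have "r \<le> s i" for i
        using s0 dec unfolding decseq_def
        by (metis abs_of_nonneg linorder_not_less order_trans real_norm_def)
      then show ?thesis using that \<open>r > 0\<close> by blast
    qed
    obtain r y where r: "strict_mono r" and y: "(\<lambda>n. A (e (r n))) \<longlonglongrightarrow> y"
      using compact_clinear_subseq[OF A, of e] en by auto
    then have "Cauchy (\<lambda>n. A (e (r n)))" by (simp add: LIMSEQ_imp_Cauchy)
    then obtain N where N: "\<And>m n. m \<ge> N \<Longrightarrow> n \<ge> N \<Longrightarrow> dist (A (e (r m))) (A (e (r n))) < \<delta>"
      using \<delta>(1) unfolding Cauchy_def by meson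
    have "r N \<noteq> r (Suc N)"
      using strict_mono_eq[OF r] by auto
    then have "(norm (A (e (r N)) - A (e (r (Suc N)))))\<^sup>2 = (s (r N))\<^sup>2 + (s (r (Suc N)))\<^sup>2"
      by (simp add: norm_diff_sq AA s_def)
    also have "\<dots> \<ge> \<delta>\<^sup>2 + \<delta>\<^sup>2"
      using \<delta> by (intro add_mono power_mono) auto
    finally have "\<delta>\<^sup>2 \<le> (norm (A (e (r N)) - A (e (r (Suc N)))))\<^sup>2"
      using zero_le_power2[of \<delta>] by linarith
    then have "\<delta> \<le> norm (A (e (r N)) - A (e (r (Suc N))))"
      by (rule power2_le_imp_le) simp
    then show False using N[of N "Suc N"] by (simp add: dist_norm)
  qed
  have "(\<lambda>i. (of_real (s i) * cinner x (e i)) *\<^sub>C f i) sums A x" for x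
  proof -
    define R where "R n = x - (\<Sum>i<n. cinner x (e i) *\<^sub>C e i)" for n
    have R: "R n \<in> perp e n" for n
      unfolding perp_def
    proof (intro CollectI allI impI)
      fix j assume j: "j < n"
      have "(\<Sum>i<n. cinner x (e i) * cinner (e i) (e j)) = (\<Sum>i<n. if i = j then cinner x (e j) else 0)"
        using ee en by (intro sum.cong refl) (auto simp: cinner_self)
      then show "cinner (R n) (e j) = 0"
        using j by (simp add: R_def cinner_sum_left)
    qed
    have "norm (R n) \<le> norm x" for n
    proof -
      have "cinner (R n) (\<Sum>i<n. cinner x (e i) *\<^sub>C e i) = 0"
        using R[of n] by (simp add: cinner_sum_right perp_def)
      then have "(norm (R n + (\<Sum>i<n. cinner x (e i) *\<^sub>C e i)))\<^sup>2 \<ge> (norm (R n))\<^sup>2"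
        by (simp only: norm_add_sq) simp
      moreover have "R n + (\<Sum>i<n. cinner x (e i) *\<^sub>C e i) = x" by (simp add: R_def)
      ultimately have "(norm (R n))\<^sup>2 \<le> (norm x)\<^sup>2" by (simp only:)
      then show ?thesis by (rule power2_le_imp_le) simp
    qed
    then have "norm (A (R n)) \<le> s n * norm x" for n
      using max[OF R[of n]] mult_left_mono[OF _ s0[of n]] by (metis order_trans s_def)
    then have "norm (- A (R n)) \<le> s n * norm x" for n by simp
    moreover have "- A (R n) = (\<Sum>i<n. (of_real (s i) * cinner x (e i)) *\<^sub>C f i) - A x" for n
      by (simp add: R_def blinfun.diff_right blinfun.sum_right lin Ae scaleR_scaleC mult.commute)
    ultimately have bd: "norm ((\<Sum>i<n. (of_real (s i) * cinner x (e i)) *\<^sub>C f i) - A x) \<le> s n * norm x" for n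
      by simp
    show ?thesis
      unfolding sums_def
      by (rule LIM_zero_cancel, rule Lim_null_comparison[where g = "\<lambda>n. s n * norm x"])
        (use bd tendsto_mult_left_zero[OF lim] in auto)
  qed
  then have "is_svd A s e f"
    using dec lim f f1 Ae ee en by (auto simp: is_svd_def ortho_fam_def)
  then show ?thesis by blast
qed

section \<open>Diagonal operators and the singular values\<close>

lemma bessel_summable:
  assumes "ortho_fam (x :: nat \<Rightarrow> _)"
  shows "summable (\<lambda>i. (cmod (cinner z (x i)))\<^sup>2)" and "(\<Sum>i. (cmod (cinner z (x i)))\<^sup>2) \<le> (norm z)\<^sup>2"
proof -
  show s: "summable (\<lambda>i. (cmod (cinner z (x i)))\<^sup>2)"
    by (rule summableI_nonneg_bounded[where x = "(norm z)\<^sup>2"]) (auto intro: bessel[OF assms])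
  show "(\<Sum>i. (cmod (cinner z (x i)))\<^sup>2) \<le> (norm z)\<^sup>2"
    by (rule suminf_le_const[OF s]) (rule bessel[OF assms])
qed

text \<open>The operator that maps \<open>x m\<close> to \<open>g m\<close> and vanishes on the orthogonal complement of \<open>x\<close>, if \<open>x\<close> is
  orthonormal and \<open>g\<close> is orthogonal and bounded. It yields the adjoint of a compact operator as well as the
  embeddings of sequence spaces below.\<close>

definition diag_op :: "(nat \<Rightarrow> 'h::complex_hilbert) \<Rightarrow> (nat \<Rightarrow> 'h) \<Rightarrow> 'h \<Rightarrow>\<^sub>L 'h" where
  "diag_op x g = Blinfun (\<lambda>z. \<Sum>m. cinner z (x m) *\<^sub>C g m)"

lemma
  assumes x: "ortho_fam x" and g: "\<And>i j. i \<noteq> j \<Longrightarrow> cinner (g i) (g j) = 0" "\<And>i. norm (g i) \<le> C"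
  shows diag_op_sums: "(\<lambda>m. cinner z (x m) *\<^sub>C g m) sums diag_op x g z" (is ?A)
    and norm_diag_op: "norm (diag_op x g z) \<le> C * norm z" (is ?B)
    and diag_op_scaleC: "diag_op x g (c *\<^sub>C z) = c *\<^sub>C diag_op x g z" (is ?C)
proof -
  define F where "F z = (\<Sum>m. cinner z (x m) *\<^sub>C g m)" for z
  have C: "C \<ge> 0" using g(2)[of 0] norm_ge_zero order_trans by blast
  have le: "(norm (cinner z (x m) *\<^sub>C g m))\<^sup>2 \<le> C\<^sup>2 * (cmod (cinner z (x m)))\<^sup>2" for z m
    using g(2)[of m] by (simp add: norm_scaleC power_mult_distrib mult.commute[of "C\<^sup>2"] mult_left_mono power_mono)
  have sm: "summable (\<lambda>m. C\<^sup>2 * (cmod (cinner z (x m)))\<^sup>2)" for z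
    by (intro summable_mult bessel_summable x)
  have sq: "summable (\<lambda>m. (norm (cinner z (x m) *\<^sub>C g m))\<^sup>2)" for z
    by (rule summable_comparison_test'[OF sm[of z], where N = 0]) (use le in simp)
  have su: "summable (\<lambda>m. cinner z (x m) *\<^sub>C g m)"
    and eq: "(norm (F z))\<^sup>2 = (\<Sum>m. (norm (cinner z (x m) *\<^sub>C g m))\<^sup>2)" for z
    unfolding F_def by (rule orthogonal_series[OF _ sq]; simp add: g(1))+
  have sF: "(\<lambda>m. cinner z (x m) *\<^sub>C g m) sums F z" for z
    using su[of z] by (simp add: F_def summable_sums)
  have nF: "norm (F z) \<le> C * norm z" for z
  proof (rule power2_le_imp_le)
    have "(norm (F z))\<^sup>2 \<le> (\<Sum>m. C\<^sup>2 * (cmod (cinner z (x m)))\<^sup>2)"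
      unfolding eq by (rule suminf_le[OF le sq sm])
    also have "\<dots> = C\<^sup>2 * (\<Sum>m. (cmod (cinner z (x m)))\<^sup>2)"
      by (rule suminf_mult[OF bessel_summable(1)[OF x]])
    also have "\<dots> \<le> C\<^sup>2 * (norm z)\<^sup>2"
      by (intro mult_left_mono bessel_summable x) simp
    finally show "(norm (F z))\<^sup>2 \<le> (C * norm z)\<^sup>2" by (simp add: power_mult_distrib)
  qed (use C in simp)
  have FC: "F (c *\<^sub>C z) = c *\<^sub>C F z" for c z
  proof -
    have "(\<lambda>m. c *\<^sub>C (cinner z (x m) *\<^sub>C g m)) sums (c *\<^sub>C F z)"
      by (rule bounded_linear.sums[OF bounded_linear_scaleC sF])
    then show ?thesis
      using sums_unique2[OF sF[of "c *\<^sub>C z"]] by simp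
  qed
  have "bounded_linear F"
  proof (rule bounded_linear_intro[where K = C])
    show "F (y + z) = F y + F z" for y z
    proof (rule sums_unique2[OF sF])
      show "(\<lambda>m. cinner (y + z) (x m) *\<^sub>C g m) sums (F y + F z)"
        using sums_add[OF sF[of y] sF[of z]] by (simp add: scaleC_add_left)
    qed
    show "F (r *\<^sub>R z) = r *\<^sub>R F z" for r z
      by (simp add: scaleR_scaleC FC)
  qed (use nF in \<open>simp add: mult.commute\<close>)
  then have D: "blinfun_apply (diag_op x g) = F"
    unfolding diag_op_def F_def by (rule bounded_linear_Blinfun_apply)
  show ?A ?B ?C
    unfolding D by (rule sF nF FC)+
qed

lemma is_svd_nonneg: "is_svd A s e f \<Longrightarrow> 0 \<le> s i"
  unfolding is_svd_def using decseq_ge by blast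

lemma adj_eqI:
  assumes "\<And>x y. cinner (blinfun_apply A x) y = cinner x (blinfun_apply B y)"
  shows "adj A = B"
  unfolding adj_def
proof (rule the_equality)
  fix B' assume B': "\<forall>x y. cinner (A x) y = cinner x (blinfun_apply B' y)"
  have "B' y - B y = 0" for y
    by (rule cinner_all_zero)
      (metis B' assms cinner_commute cinner_left.diff cinner_right.diff cancel_comm_monoid_add_class.diff_cancel)
  then show "B' = B" by (intro blinfun_eqI) simp
qed (use assms in simp)

lemma cinner_svd:
  assumes "is_svd A s e f"
  shows "(\<lambda>i. of_real (s i) * cinner x (e i) * cinner (f i) y) sums cinner (A x) y"
proof -
  have "(\<lambda>i. (of_real (s i) * cinner x (e i)) *\<^sub>C f i) sums A x"
    using assms by (simp add: is_svd_def)
  from bounded_linear.sums[OF bounded_linear_cinner_left this]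
  show ?thesis by simp
qed

text \<open>The definition of \<^const>\<open>adj\<close> presupposes existence of the adjoint; exchanging the two systems of singular
  vectors provides one.\<close>

lemma svd_adj:
  assumes svd: "is_svd A s e f"
  shows "cinner (A x) y = cinner x (adj A y)"
proof -
  define B where "B = diag_op f (\<lambda>i. s i *\<^sub>R e i)"
  have f: "ortho_fam f" and e: "ortho_fam e" "\<And>i. norm (e i) = 1" and s: "decseq s"
    using svd by (auto simp: is_svd_def)
  have 1: "cinner (s i *\<^sub>R e i) (s j *\<^sub>R e j) = 0" if "i \<noteq> j" for i j
    using e(1) that by (simp add: ortho_fam_def)
  have 2: "norm (s i *\<^sub>R e i) \<le> s 0" for i
    using decseqD[OF s, of 0 i] is_svd_nonneg[OF svd, of i] by (simp add: e)
  have "cinner (A x) y = cinner x (B y)" for x y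
  proof (rule sums_unique2[OF cinner_svd[OF svd]])
    have "(\<lambda>m. cinner y (f m) *\<^sub>C s m *\<^sub>R e m) sums B y"
      unfolding B_def by (rule diag_op_sums[OF f 1 2])
    from bounded_linear.sums[OF bounded_linear_cinner_right this]
    have "(\<lambda>m. cnj (cinner y (f m)) * (of_real (s m) * cinner x (e m))) sums cinner x (B y)"
      by simp
    also have "(\<lambda>m. cnj (cinner y (f m)) * (of_real (s m) * cinner x (e m))) =
        (\<lambda>i. of_real (s i) * cinner x (e i) * cinner (f i) y)"
      using cinner_commute[of "f _" y] by (simp add: ac_simps)
    finally show "(\<lambda>i. of_real (s i) * cinner x (e i) * cinner (f i) y) sums cinner x (B y)" .
  qed
  then show ?thesis by (simp add: adj_eqI)
qed

lemma decseq_null_level_finite: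
  fixes s :: "nat \<Rightarrow> real"
  assumes "s \<longlonglongrightarrow> 0" "t > 0"
  shows "finite {i. t \<le> s i}"
proof -
  obtain N where "\<And>i. i \<ge> N \<Longrightarrow> s i < t"
    using order_tendstoD(2)[OF assms] unfolding eventually_sequentially by blast
  then have "{i. t \<le> s i} \<subseteq> {..<N}" by (force simp: not_less[symmetric])
  then show ?thesis using finite_subset by blast
qed

text \<open>The multiplicities of the positive values determine a non-increasing null sequence. At the first place
  where two such sequences differ, the larger value has a larger multiplicity in the sequence that attains it
  there, because all further entries of the other one are smaller.\<close>

lemma level_counts_determine:
  fixes s s' :: "nat \<Rightarrow> real"
  assumes s: "decseq s" "s \<longlonglongrightarrow> 0" and s': "decseq s'" "s' \<longlonglongrightarrow> 0"
    and eq: "\<And>t. t > 0 \<Longrightarrow> card {i. s i = t} = card {i. s' i = t}"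
  shows "s = s'"
proof -
  have aux: "\<not> r i > r' i" if r: "decseq r" "r \<longlonglongrightarrow> 0" and r': "decseq r'" "r' \<longlonglongrightarrow> 0"
    and eq: "\<And>t. t > 0 \<Longrightarrow> card {i. r i = t} = card {i. r' i = t}"
    and below: "\<And>j. j < i \<Longrightarrow> r j = r' j" for r r' :: "nat \<Rightarrow> real" and i
  proof
    assume gt: "r i > r' i"
    have t: "r i > 0" using gt decseq_ge[OF r', of i] by simp
    have "{j. r' j = r i} \<subset> {j. r j = r i}"
    proof
      have "j < i" if "r' j = r i" for j
        using decseqD[OF r'(1), of i j] gt that by (cases "j < i") auto
      then show "{j. r' j = r i} \<subseteq> {j. r j = r i}" using below by auto
      show "{j. r' j = r i} \<noteq> {j. r j = r i}" using gt by (metis (mono_tags, lifting) less_irrefl mem_Collect_eq)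
    qed
    moreover have "finite {j. r j = r i}"
      by (rule finite_subset[OF _ decseq_null_level_finite[OF r(2) t]]) auto
    ultimately have "card {j. r' j = r i} < card {j. r j = r i}" by (rule psubset_card_mono[rotated])
    then show False using eq[OF t] by simp
  qed
  have "s i = s' i" for i
  proof (induction i rule: less_induct)
    case (less i)
    show ?case
      using aux[OF s s' eq, of i] aux[OF s' s eq[symmetric], of i] less by force
  qed
  then show ?thesis by blast
qed

text \<open>In coordinates, \<open>adj A \<circ> A\<close> multiplies the \<open>i\<close>-th coefficient by \<open>(s i)\<^sup>2\<close>, so an eigenvector
  for \<open>t\<^sup>2\<close> has coefficients only at the places where \<open>s i = t\<close>. Subtracting the part carried by these
  coordinates leaves a vector orthogonal to all \<open>e i\<close>, hence in the kernel of \<open>A\<close>, which is an eigenvector for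
  \<open>t\<^sup>2 > 0\<close> or 0, so it is 0.\<close>

lemma svd_eigenspace:
  assumes svd: "is_svd A s e f" and lin: "\<And>c x. A (c *\<^sub>C x) = c *\<^sub>C A x" and t: "t > 0"
  shows "{x. adj A (A x) = complex_of_real (t\<^sup>2) *\<^sub>C x} = complex_vector.span (e ` {i. s i = t})"
proof -
  have e: "ortho_fam e" "\<And>i. norm (e i) = 1" and f: "ortho_fam f" "\<And>i. 0 < s i \<Longrightarrow> norm (f i) = 1"
    and Ae: "\<And>i. A (e i) = s i *\<^sub>R f i" and lim: "s \<longlonglongrightarrow> 0"
    using svd by (auto simp: is_svd_def)
  define I where "I = {i. s i = t}"
  have fin: "finite I"
    unfolding I_def by (rule finite_subset[OF _ decseq_null_level_finite[OF lim t]]) auto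
  have adj': "cinner (adj A y) x = cinner y (A x)" for x y
    using svd_adj[OF svd, of x y] by (metis cinner_commute)
  have ee: "cinner (e i) (e j) = (if i = j then 1 else 0)" for i j
    using e by (auto simp: ortho_fam_def cinner_self)
  have Af: "cinner (A x) (f i) = of_real (s i) * cinner x (e i)" for x i
  proof (cases "s i > 0")
    case True
    have "cinner (f j) (f i) = (if j = i then 1 else 0)" for j
      using f(1) f(2)[OF True] by (auto simp: ortho_fam_def cinner_self)
    then have "(\<lambda>j. of_real (s j) * cinner x (e j) * cinner (f j) (f i)) =
        (\<lambda>j. if j = i then of_real (s i) * cinner x (e i) else 0)"
      by auto
    then show ?thesis
      using cinner_svd[OF svd, of x "f i"] sums_single[of i "\<lambda>_. of_real (s i) * cinner x (e i)"]
      by (simp add: sums_unique2)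
  next
    case False
    then have "s i = 0" using is_svd_nonneg[OF svd, of i] by simp
    moreover have "(\<lambda>j. of_real (s j) * cinner x (e j) * cinner (f j) (f i)) = (\<lambda>_. 0)"
    proof
      fix j show "of_real (s j) * cinner x (e j) * cinner (f j) (f i) = 0"
        using f(1) \<open>s i = 0\<close> by (cases "j = i") (auto simp: ortho_fam_def)
    qed
    ultimately show ?thesis
      using cinner_svd[OF svd, of x "f i"] by (simp add: sums_unique2)
  qed
  have AAe: "cinner (adj A (A x)) (e i) = of_real ((s i)\<^sup>2) * cinner x (e i)" for x i
    by (simp add: adj' Ae Af power2_eq_square)
  have perp0: "A x = 0" if "\<And>i. cinner x (e i) = 0" for x
  proof (rule cinner_all_zero)
    fix y show "cinner (A x) y = 0"
      using cinner_svd[OF svd, of x y] that by (simp add: sums_unique2)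
  qed
  define V where "V = {x. adj A (A x) = complex_of_real (t\<^sup>2) *\<^sub>C x}"
  have linadj: "adj A (c *\<^sub>C y) = c *\<^sub>C adj A y" for c y
  proof -
    have "adj A (c *\<^sub>C y) - c *\<^sub>C adj A y = 0"
      by (rule cinner_all_zero) (simp add: adj')
    then show ?thesis by simp
  qed
  have V: "complex_vector.subspace V"
    by (auto simp: V_def complex_vector.subspace_def blinfun.add_right blinfun.zero_right lin linadj scaleC_add_right mult.commute)
  have "e i \<in> V" if "i \<in> I" for i
  proof -
    have "adj A (A (e i)) - complex_of_real (t\<^sup>2) *\<^sub>C e i = 0"
    proof (rule cinner_all_zero)
      fix y
      have "cinner (adj A (A (e i))) y = of_real (s i) * cnj (cinner (A y) (f i))"
        by (simp add: adj' Ae cinner_commute[of "f i"])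
      also have "\<dots> = of_real ((s i)\<^sup>2) * cinner (e i) y"
        by (simp add: Af cinner_commute[of "e i" y] power2_eq_square)
      finally show "cinner (adj A (A (e i)) - complex_of_real (t\<^sup>2) *\<^sub>C e i) y = 0"
        using that by (simp add: I_def)
    qed
    then show ?thesis by (simp add: V_def)
  qed
  then have sup: "complex_vector.span (e ` I) \<subseteq> V"
    by (intro complex_vector.span_minimal V) auto
  have "x \<in> complex_vector.span (e ` I)" if x: "x \<in> V" for x
  proof -
    define p where "p = (\<Sum>i\<in>I. cinner x (e i) *\<^sub>C e i)"
    have p: "p \<in> complex_vector.span (e ` I)"
      unfolding p_def by (intro complex_vector.span_sum complex_vector.span_scale complex_vector.span_base) auto
    have "cinner (x - p) (e i) = 0" for i
    proof (cases "i \<in> I")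
      case True
      have "cinner p (e i) = (\<Sum>j\<in>I. if j = i then cinner x (e i) else 0)"
        unfolding p_def cinner_sum_left by (intro sum.cong refl) (auto simp: ee)
      then show ?thesis using fin True by simp
    next
      case False
      have "cinner p (e i) = 0" using False by (auto simp: p_def cinner_sum_left ee intro!: sum.neutral)
      moreover have "of_real ((s i)\<^sup>2) * cinner x (e i) = of_real (t\<^sup>2) * cinner x (e i)"
        using AAe[of x i] x by (auto simp: V_def)
      then have "(s i)\<^sup>2 = t\<^sup>2 \<or> cinner x (e i) = 0"
        by (metis mult_cancel_right of_real_eq_iff)
      moreover have "(s i)\<^sup>2 \<noteq> t\<^sup>2"
        using False is_svd_nonneg[OF svd, of i] t by (auto simp: I_def power2_eq_iff)
      ultimately show ?thesis by simp
    qed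
    then have "A (x - p) = 0" by (rule perp0)
    moreover have "x - p \<in> V"
      using x p sup V complex_vector.subspace_diff by blast
    ultimately have "complex_of_real (t\<^sup>2) *\<^sub>C (x - p) = 0"
      by (simp add: V_def blinfun.zero_right del: of_real_power)
    then have "norm (complex_of_real (t\<^sup>2) *\<^sub>C (x - p)) = 0" by (simp only: norm_zero)
    then have "x = p" using t by (simp add: norm_scaleC norm_power)
    then show ?thesis using p by simp
  qed
  with sup show ?thesis unfolding V_def I_def by blast
qed

theorem singular_values_svd:
  assumes svd: "is_svd A s e f" and lin: "\<And>c x. A (c *\<^sub>C x) = c *\<^sub>C A x"
  shows "singular_values A = s"
proof -
  have e: "ortho_fam e" "\<And>i. norm (e i) = 1" and s: "decseq s" "s \<longlonglongrightarrow> 0"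
    using svd by (auto simp: is_svd_def)
  have ee: "cinner (e i) (e j) = (if i = j then 1 else 0)" for i j
    using e by (auto simp: ortho_fam_def cinner_self)
  have inj: "inj e" by (metis ee injI zero_neq_one)
  have cd: "card {i. s i = t} = complex_vector.dim {x. adj A (A x) = complex_of_real (t\<^sup>2) *\<^sub>C x}"
    if t: "t > 0" for t
  proof -
    have fin: "finite {i. s i = t}"
      by (rule finite_subset[OF _ decseq_null_level_finite[OF s(2) t]]) auto
    have "complex_vector.independent (e ` {i. s i = t})"
    proof (rule complex_vector.independent_if_scalars_zero)
      fix c x assume 0: "(\<Sum>x\<in>e ` {i. s i = t}. c x *\<^sub>C x) = 0" and x: "x \<in> e ` {i. s i = t}"
      then obtain j where j: "x = e j" "s j = t" by auto
      have "0 = cinner (\<Sum>x\<in>e ` {i. s i = t}. c x *\<^sub>C x) x" by (simp add: 0)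
      also have "\<dots> = (\<Sum>i | s i = t. c (e i) * cinner (e i) (e j))"
        using inj by (simp add: cinner_sum_left sum.reindex inj_on_subset j)
      also have "\<dots> = (\<Sum>i | s i = t. if i = j then c x else 0)"
        by (intro sum.cong refl) (auto simp: ee j)
      also have "\<dots> = c x"
        using fin j by simp
      finally show "c x = 0" by simp
    qed (use fin in simp)
    then show ?thesis
      using inj complex_vector.dim_span_eq_card_independent
      by (metis card_image inj_on_subset subset_UNIV svd_eigenspace[OF svd lin t])
  qed
  show ?thesis
    unfolding singular_values_def
  proof (rule the_equality)
    fix s' assume s': "decseq s' \<and> s' \<longlonglongrightarrow> 0 \<and> (\<forall>t>0. card {i. s' i = t} =
        complex_vector.dim {x. adj A (A x) = complex_of_real (t\<^sup>2) *\<^sub>C x})"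
    show "s' = s"
      by (rule level_counts_determine) (use s s' cd in auto)
  qed (use s cd in auto)
qed

section \<open>Rearrangement inequalities\<close>

text \<open>Subtracting the constant \<open>w m\<close> from the weights makes those with index below \<open>m\<close> non-negative and the others
  non-positive; in either case the factor \<open>\<phi> k\<close> may be replaced by its optimal value 1 or 0.\<close>

lemma sum_weighted_le_initial:
  fixes w \<phi> :: "nat \<Rightarrow> real"
  assumes w: "decseq w" "\<And>k. 0 \<le> w k" and \<phi>: "\<And>k. k < K \<Longrightarrow> 0 \<le> \<phi> k \<and> \<phi> k \<le> 1"
    and le: "(\<Sum>k<K. \<phi> k) \<le> real m"
  shows "(\<Sum>k<K. w k * \<phi> k) \<le> (\<Sum>k<m. w k)"
proof -
  have "(\<Sum>k<K. (w k - w m) * \<phi> k) \<le> (\<Sum>k<K. max 0 (w k - w m))"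
  proof (rule sum_mono)
    fix k assume "k \<in> {..<K}"
    then have "0 \<le> \<phi> k" "\<phi> k \<le> 1" using \<phi> by auto
    then show "(w k - w m) * \<phi> k \<le> max 0 (w k - w m)"
      using mult_left_le[of "\<phi> k" "w k - w m"] mult_nonpos_nonneg[of "w k - w m" "\<phi> k"] by linarith
  qed
  also have "\<dots> = (\<Sum>k\<in>{..<K} \<inter> {..<m}. max 0 (w k - w m))"
  proof (rule sum.mono_neutral_right)
    show "\<forall>k\<in>{..<K} - {..<K} \<inter> {..<m}. max 0 (w k - w m) = 0"
      using decseqD[OF w(1), of m] by force
  qed auto
  also have "\<dots> \<le> (\<Sum>k<m. max 0 (w k - w m))"
    by (intro sum_mono2) auto
  also have "\<dots> = (\<Sum>k<m. w k - w m)"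
    using decseqD[OF w(1), of _ m] by (intro sum.cong) auto
  finally have "(\<Sum>k<K. (w k - w m) * \<phi> k) \<le> (\<Sum>k<m. w k) - real m * w m"
    by (simp add: sum_subtractf)
  moreover have "(\<Sum>k<K. w k * \<phi> k) = (\<Sum>k<K. (w k - w m) * \<phi> k) + w m * (\<Sum>k<K. \<phi> k)"
    by (simp add: algebra_simps sum_subtractf sum_distrib_left)
  moreover have "w m * (\<Sum>k<K. \<phi> k) \<le> real m * w m"
    using mult_left_mono[OF le w(2)[of m]] by (simp add: mult.commute)
  ultimately show ?thesis by linarith
qed

text \<open>Abel summation.\<close>

lemma sum_decreasing_majorised:
  fixes u a b :: "nat \<Rightarrow> real"
  assumes u: "decseq u" "\<And>i. 0 \<le> u i" and le: "\<And>m. m \<le> n \<Longrightarrow> (\<Sum>i<m. a i) \<le> (\<Sum>i<m. b i)"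
  shows "(\<Sum>i<n. a i * u i) \<le> (\<Sum>i<n. b i * u i)"
proof -
  define G where "G m = (\<Sum>i<m. b i) - (\<Sum>i<m. a i)" for m
  have "(\<Sum>i<m. b i * u i) - (\<Sum>i<m. a i * u i) \<ge> G m * u (m - 1)" if "m \<le> n" for m
    using that
  proof (induction m)
    case (Suc m)
    have "G m * u (m - 1) \<ge> G m * u m"
      using le[of m] Suc.prems decseqD[OF u(1), of "m - 1" m] by (intro mult_left_mono) (auto simp: G_def)
    then show ?case using Suc by (simp add: G_def algebra_simps)
  qed (simp add: G_def)
  from this[of n] have "(\<Sum>i<n. b i * u i) - (\<Sum>i<n. a i * u i) \<ge> G n * u (n - 1)" by simp
  moreover have "G n * u (n - 1) \<ge> 0" using le[of n] u(2) by (simp add: G_def)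
  ultimately show ?thesis by linarith
qed

text \<open>The mass missing to 1 may be thought of as sitting at 0, where the convex function \<open>t powr p\<close> vanishes.\<close>

lemma jensen_substochastic:
  fixes \<theta> x :: "'i \<Rightarrow> real"
  assumes I: "finite I" and \<theta>: "\<And>i. i \<in> I \<Longrightarrow> 0 \<le> \<theta> i" "(\<Sum>i\<in>I. \<theta> i) \<le> 1"
    and x: "\<And>i. i \<in> I \<Longrightarrow> 0 \<le> x i" and p: "1 \<le> p"
  shows "(\<Sum>i\<in>I. \<theta> i * x i) powr p \<le> (\<Sum>i\<in>I. \<theta> i * x i powr p)"
proof -
  \<comment> \<open>Convexity of \<open>\<lambda>t. t powr p\<close> is used on positive arguments only.\<close>
  define J where "J = {i \<in> I. 0 < \<theta> i \<and> 0 < x i}"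
  have z: "\<theta> i = 0 \<or> x i = 0" if "i \<in> I - J" for i
    using that \<theta>(1)[of i] x[of i] by (auto simp: J_def)
  have J: "finite J" "J \<subseteq> I" using I by (auto simp: J_def)
  have e1: "(\<Sum>i\<in>I. \<theta> i * x i) = (\<Sum>i\<in>J. \<theta> i * x i)"
    using z by (intro sum.mono_neutral_right I J) auto
  have e2: "(\<Sum>i\<in>I. \<theta> i * x i powr p) = (\<Sum>i\<in>J. \<theta> i * x i powr p)"
    using z by (intro sum.mono_neutral_right I J) auto
  show ?thesis
  proof (cases "J = {}")
    case True
    then show ?thesis using p by (simp add: e1 e2)
  next
    case False
    define S where "S = (\<Sum>i\<in>J. \<theta> i)"
    have S: "S > 0" unfolding S_def by (rule sum_pos) (use J False in \<open>auto simp: J_def\<close>)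
    have S1: "S \<le> 1"
      unfolding S_def using \<theta>(2) sum_mono2[OF I J(2), of \<theta>] \<theta>(1) by force
    have "(\<Sum>i\<in>J. (\<theta> i / S) *\<^sub>R x i) powr p \<le> (\<Sum>i\<in>J. (\<theta> i / S) * x i powr p)"
      using S by (intro convex_on_sum[OF J(1) False powr_convex[OF p]])
        (auto simp: S_def J_def \<theta> simp flip: sum_divide_distrib)
    then have le: "(\<Sum>i\<in>J. \<theta> i * x i / S) powr p \<le> (\<Sum>i\<in>J. \<theta> i * x i powr p / S)"
      by simp
    have "0 \<le> (\<Sum>i\<in>J. \<theta> i * x i powr p)"
      by (intro sum_nonneg mult_nonneg_nonneg) (use \<theta> J in auto)
    have "(\<Sum>i\<in>J. \<theta> i * x i) powr p = S powr p * (\<Sum>i\<in>J. \<theta> i * x i / S) powr p"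
      using S by (subst powr_mult[symmetric]) (auto simp: sum_nonneg J_def simp flip: sum_divide_distrib)
    also have "\<dots> \<le> S powr p * (\<Sum>i\<in>J. \<theta> i * x i powr p / S)"
      by (intro mult_left_mono le) simp
    also have "\<dots> \<le> S * (\<Sum>i\<in>J. \<theta> i * x i powr p / S)"
      using S S1 p \<theta> J powr_mono'[of 1 p S]
      by (intro mult_right_mono) (auto simp: J_def intro!: sum_nonneg)
    also have "\<dots> = (\<Sum>i\<in>J. \<theta> i * x i powr p)"
      using S by (simp flip: sum_divide_distrib)
    finally show ?thesis by (simp add: e1 e2)
  qed
qed

text \<open>Jensen's inequality in each row reduces the claim to \<open>p = 1\<close>. There, both sequences are positive combinations
  of indicator functions of initial segments, and a doubly substochastic matrix has at most
  the mass \<open>min m K\<close> in a corner with \<open>m\<close> columns and \<open>K\<close> rows.\<close>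

lemma substochastic_weighted_le:
  fixes \<theta> :: "nat \<Rightarrow> nat \<Rightarrow> real"
  assumes w: "decseq w" "\<And>k. 0 \<le> w k" and s: "decseq s" "\<And>i. 0 \<le> s i" and p: "1 \<le> p"
    and \<theta>: "\<And>k i. 0 \<le> \<theta> k i" "\<And>k n. (\<Sum>i<n. \<theta> k i) \<le> 1" "\<And>i K. (\<Sum>k<K. \<theta> k i) \<le> 1"
  shows "(\<Sum>k<K. w k * (\<Sum>i<n. \<theta> k i * s i) powr p) \<le> (\<Sum>i<n. w i * s i powr p)"
proof -
  have "(\<Sum>k<K. w k * (\<Sum>i<n. \<theta> k i * s i) powr p) \<le> (\<Sum>k<K. w k * (\<Sum>i<n. \<theta> k i * s i powr p))"
    by (intro sum_mono mult_left_mono jensen_substochastic) (use \<theta> s w p in auto)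
  also have "\<dots> = (\<Sum>i<n. (\<Sum>k<K. w k * \<theta> k i) * s i powr p)"
    unfolding sum_distrib_left sum_distrib_right by (subst sum.swap) (simp add: mult.assoc)
  also have "\<dots> \<le> (\<Sum>i<n. w i * s i powr p)"
  proof (rule sum_decreasing_majorised)
    show "decseq (\<lambda>i. s i powr p)"
      using s p by (auto simp: decseq_def intro!: powr_mono2)
    fix m
    have "(\<Sum>i<m. \<Sum>k<K. w k * \<theta> k i) = (\<Sum>k<K. w k * (\<Sum>i<m. \<theta> k i))"
      unfolding sum_distrib_left by (rule sum.swap)
    also have "\<dots> \<le> (\<Sum>k<m. w k)"
    proof (rule sum_weighted_le_initial[OF w])
      have "(\<Sum>k<K. \<Sum>i<m. \<theta> k i) = (\<Sum>i<m. \<Sum>k<K. \<theta> k i)" by (rule sum.swap)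
      also have "\<dots> \<le> (\<Sum>i<m. 1)" by (intro sum_mono \<theta>)
      finally show "(\<Sum>k<K. \<Sum>i<m. \<theta> k i) \<le> real m" by simp
    qed (use \<theta> in \<open>auto intro: sum_nonneg\<close>)
    finally show "(\<Sum>i<m. \<Sum>k<K. w k * \<theta> k i) \<le> (\<Sum>k<m. w k)" .
  qed simp
  finally show ?thesis .
qed

lemma ortho_fam_product_sum_le:
  assumes x: "ortho_fam x" and y: "ortho_fam y" and "norm z \<le> 1" "norm z' \<le> 1"
  shows "(\<Sum>i\<in>I. cmod (cinner z (x i)) * cmod (cinner (y i) z')) \<le> 1"
proof -
  have "(\<Sum>i\<in>I. cmod (cinner z (x i)) * cmod (cinner (y i) z'))
      \<le> (\<Sum>i\<in>I. ((cmod (cinner z (x i)))\<^sup>2 + (cmod (cinner (y i) z'))\<^sup>2) / 2)"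
  proof (rule sum_mono)
    fix i show "cmod (cinner z (x i)) * cmod (cinner (y i) z')
      \<le> ((cmod (cinner z (x i)))\<^sup>2 + (cmod (cinner (y i) z'))\<^sup>2) / 2"
      using sum_squares_bound[of "cmod (cinner z (x i))" "cmod (cinner (y i) z')"] by simp
  qed
  also have "\<dots> = ((\<Sum>i\<in>I. (cmod (cinner z (x i)))\<^sup>2) + (\<Sum>i\<in>I. (cmod (cinner (y i) z'))\<^sup>2)) / 2"
    by (simp add: sum.distrib flip: sum_divide_distrib)
  also have "\<dots> \<le> ((norm z)\<^sup>2 + (norm z')\<^sup>2) / 2"
    using bessel[OF x, of z I] bessel'[OF y, of z' I] by simp
  also have "\<dots> \<le> 1"
    using assms(3,4) power_le_one[of "norm z" 2] power_le_one[of "norm z'" 2] by simp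
  finally show ?thesis .
qed

text \<open>The matrix coefficients of an operator in any pair of orthonormal systems are dominated by its
  singular values, because the transition matrix is doubly substochastic. All norm estimates below
  rest on this inequality; the singular vectors give equality.\<close>

theorem matrix_coefficients_le_singular_values:
  assumes svd: "is_svd A s e f" and x: "ortho_fam x" and y: "ortho_fam y"
    and w: "decseq w" "\<And>k. 0 \<le> w k" and p: "1 \<le> p"
    and sm: "summable (\<lambda>k. w k * s k powr p)"
  shows "(\<Sum>k<K. w k * cmod (cinner (A (x k)) (y k)) powr p) \<le> (\<Sum>k. w k * s k powr p)"
proof -
  define c where "c k n = (\<Sum>i<n. of_real (s i) * cinner (x k) (e i) * cinner (f i) (y k))" for k n
  define \<theta> where "\<theta> k i = cmod (cinner (x k) (e i)) * cmod (cinner (f i) (y k))" for k i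
  have e: "ortho_fam e" and f: "ortho_fam f" and s: "decseq s" using svd by (auto simp: is_svd_def)
  have n: "norm (x k) \<le> 1" "norm (y k) \<le> 1" "norm (e k) \<le> 1" "norm (f k) \<le> 1" for k
    using x y e f by (auto simp: ortho_fam_def)
  have c: "(\<lambda>n. c k n) \<longlonglongrightarrow> cinner (A (x k)) (y k)" for k
    using cinner_svd[OF svd] unfolding sums_def c_def .
  show ?thesis
  proof (rule LIMSEQ_le_const2)
    show "(\<lambda>n. \<Sum>k<K. w k * cmod (c k n) powr p) \<longlonglongrightarrow> (\<Sum>k<K. w k * cmod (cinner (A (x k)) (y k)) powr p)"
      using p by (intro tendsto_sum tendsto_mult tendsto_const tendsto_powr' tendsto_norm c) auto
    have "(\<Sum>k<K. w k * cmod (c k n) powr p) \<le> (\<Sum>k. w k * s k powr p)" for n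
    proof -
      have "cmod (c k n) \<le> (\<Sum>i<n. \<theta> k i * s i)" for k
        unfolding c_def by (rule order_trans[OF norm_sum])
          (simp add: norm_mult \<theta>_def is_svd_nonneg[OF svd] mult_ac)
      then have "(\<Sum>k<K. w k * cmod (c k n) powr p) \<le> (\<Sum>k<K. w k * (\<Sum>i<n. \<theta> k i * s i) powr p)"
        by (intro sum_mono mult_left_mono powr_mono2 w) (use p in auto)
      also have "\<dots> \<le> (\<Sum>i<n. w i * s i powr p)"
      proof (rule substochastic_weighted_le[OF w s is_svd_nonneg[OF svd] p])
        show "(\<Sum>i<n. \<theta> k i) \<le> 1" for k n
          unfolding \<theta>_def by (rule ortho_fam_product_sum_le[OF e f]) (use n in auto)
        show "(\<Sum>k<K. \<theta> k i) \<le> 1" for i K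
          using ortho_fam_product_sum_le[OF x y, of "e i" "f i" "{..<K}"] n
          by (simp add: \<theta>_def cmod_cinner_commute[of "e i"] cmod_cinner_commute[of _ "f i"])
      qed (simp add: \<theta>_def)
      also have "\<dots> \<le> (\<Sum>k. w k * s k powr p)"
        by (rule sum_le_suminf[OF sm]) (use w in auto)
      finally show ?thesis .
    qed
    then show "\<exists>N. \<forall>n\<ge>N. (\<Sum>k<K. w k * cmod (c k n) powr p) \<le> (\<Sum>k. w k * s k powr p)" by blast
  qed
qed

text \<open>With \<open>R = \<alpha> + \<beta>\<close>, the number \<open>(a k + b k) / R\<close> is a convex combination of \<open>a k / \<alpha>\<close> and \<open>b k / \<beta>\<close>.\<close>

lemma weighted_minkowski:
  fixes a b w :: "nat \<Rightarrow> real"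
  assumes w: "\<And>k. 0 < w k" and p: "1 \<le> p" and ab: "\<And>k. 0 \<le> a k" "\<And>k. 0 \<le> b k"
    and \<alpha>: "0 \<le> \<alpha>" "(\<Sum>k<K. w k * a k powr p) \<le> \<alpha> powr p"
    and \<beta>: "0 \<le> \<beta>" "(\<Sum>k<K. w k * b k powr p) \<le> \<beta> powr p"
  shows "(\<Sum>k<K. w k * (a k + b k) powr p) \<le> (\<alpha> + \<beta>) powr p"
proof -
  have zero: "c k = 0" if "(\<Sum>k<K. w k * c k powr p) \<le> 0" "k < K" for c :: "nat \<Rightarrow> real" and k
  proof -
    have nn: "0 \<le> w k * c k powr p" for k using w[of k] by simp
    have "(\<Sum>k<K. w k * c k powr p) = 0"
      using that(1) sum_nonneg[of "{..<K}" "\<lambda>k. w k * c k powr p"] nn by force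
    then have "w k * c k powr p = 0"
      using that(2) nn by (simp add: sum_nonneg_eq_0_iff)
    then show ?thesis using w[of k] by auto
  qed
  consider "\<alpha> = 0" | "\<beta> = 0" | "\<alpha> > 0" "\<beta> > 0" using \<alpha>(1) \<beta>(1) by force
  then show ?thesis
  proof cases
    case 1
    then have "a k = 0" if "k < K" for k using zero[of a k] \<alpha> p that by simp
    then show ?thesis using \<beta> 1 by simp
  next
    case 2
    then have "b k = 0" if "k < K" for k using zero[of b k] \<beta> p that by simp
    then show ?thesis using \<alpha> 2 by simp
  next
    case 3
    define R where "R = \<alpha> + \<beta>"
    have R: "R > 0" using 3 by (simp add: R_def)
    have conv: "(a k + b k) powr p \<le> R powr p * (\<alpha> / R * (a k powr p / \<alpha> powr p) + \<beta> / R * (b k powr p / \<beta> powr p))" for k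
    proof -
      define X where "X i = (if i then a k / \<alpha> else b k / \<beta>)" for i
      define T where "T i = (if i then \<alpha> / R else \<beta> / R)" for i
      have "(\<Sum>i\<in>UNIV. T i * X i) powr p \<le> (\<Sum>i\<in>UNIV. T i * X i powr p)"
        by (rule jensen_substochastic) (use 3 R ab p in \<open>auto simp: T_def X_def UNIV_bool R_def simp flip: add_divide_distrib\<close>)
      then have "((a k + b k) / R) powr p \<le> \<alpha> / R * (a k / \<alpha>) powr p + \<beta> / R * (b k / \<beta>) powr p"
        using 3 by (simp add: UNIV_bool T_def X_def add_divide_distrib add.commute)
      then show ?thesis
        using 3 R ab by (simp add: powr_divide field_simps)
    qed
    have "(\<Sum>k<K. w k * (a k + b k) powr p) \<le>
        (\<Sum>k<K. w k * (R powr p * (\<alpha> / R * (a k powr p / \<alpha> powr p) + \<beta> / R * (b k powr p / \<beta> powr p))))"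
      by (intro sum_mono mult_left_mono conv) (use w in \<open>auto intro: less_imp_le\<close>)
    also have "\<dots> = R powr p * (\<alpha> / R * ((\<Sum>k<K. w k * a k powr p) / \<alpha> powr p)
        + \<beta> / R * ((\<Sum>k<K. w k * b k powr p) / \<beta> powr p))"
      by (simp add: sum_distrib_left sum.distrib distrib_left sum_divide_distrib mult_ac)
    also have "\<dots> \<le> R powr p * (\<alpha> / R * 1 + \<beta> / R * 1)"
      using 3 R \<alpha> \<beta> by (intro mult_left_mono add_mono) (auto simp: divide_le_eq_1)
    also have "\<dots> = (\<alpha> + \<beta>) powr p"
      using R by (simp add: R_def flip: add_divide_distrib)
    finally show ?thesis .
  qed
qed

section \<open>The norm of the Lorentz--Schatten classes\<close>

text \<open>The form with \<open>N > 0\<close> is the rearrangement of a tail of the sequence.\<close>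

lemma rearr_shifted:
  fixes s :: "nat \<Rightarrow> real"
  assumes s: "decseq s" "\<And>i. 0 \<le> s i"
  shows "rearr (\<lambda>i. if i < N then 0 else of_real (s i)) k = s (N + k)"
proof -
  have lev: "{j. t < cmod (if j < N then 0 else of_real (s j))} = (+) N ` {i. t < s (N + i)}" if "0 \<le> t" for t
  proof (intro set_eqI iffI)
    fix j assume "j \<in> {j. t < cmod (if j < N then 0 else of_real (s j))}"
    then have "j \<ge> N" "t < s j" using that s(2)[of j] by (auto split: if_splits)
    then show "j \<in> (+) N ` {i. t < s (N + i)}" by (intro image_eqI[of _ _ "j - N"]) auto
  qed (use s in auto)
  have "{t. 0 \<le> t \<and> finite {j. t < cmod (if j < N then 0 else of_real (s j))} \<and>
      card {j. t < cmod (if j < N then 0 else of_real (s j))} \<le> k} = {s (N + k)..}" (is "?L = _")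
  proof (intro set_eqI iffI)
    fix t assume t: "t \<in> ?L"
    then have fin: "finite {i. t < s (N + i)}" and cd: "card {i. t < s (N + i)} \<le> k"
      using lev[of t] by (auto dest: finite_imageD simp: card_image)
    have "s (N + k) \<le> t"
    proof (rule ccontr)
      assume "\<not> s (N + k) \<le> t"
      then have "{..k} \<subseteq> {i. t < s (N + i)}"
        using decseqD[OF s(1)] by (auto simp: not_le intro: less_le_trans)
      from card_mono[OF fin this] cd show False by simp
    qed
    then show "t \<in> {s (N + k)..}" by simp
  next
    fix t assume "t \<in> {s (N + k)..}"
    then have t: "s (N + k) \<le> t" "0 \<le> t" using s(2)[of "N + k"] by auto
    have sub: "{i. t < s (N + i)} \<subseteq> {..<k}"
    proof
      fix i assume "i \<in> {i. t < s (N + i)}"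
      then show "i \<in> {..<k}"
        using t decseqD[OF s(1), of "N + k" "N + i"] by (cases "i < k") auto
    qed
    show "t \<in> ?L"
      using t lev[of t] finite_subset[OF sub] card_mono[OF _ sub] by (auto simp: card_image)
  qed
  then show ?thesis by (simp add: rearr_def)
qed

lemma rearr_decseq:
  fixes s :: "nat \<Rightarrow> real"
  assumes s: "decseq s" "\<And>i. 0 \<le> s i"
  shows "rearr (\<lambda>i. of_real (s i)) = s"
  using rearr_shifted[OF s, of 0] by auto

text \<open>Truncations approximate: the norms of the tails tend to 0 by dominated convergence, as the rearrangement of
  a tail is a shifted copy of the sequence.\<close>

lemma lorentz_decseq_iff:
  fixes s :: "nat \<Rightarrow> real"
  assumes w: "\<And>k. 0 \<le> w k" and p: "1 \<le> p" and s: "decseq s" "s \<longlonglongrightarrow> 0"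
  shows "(\<lambda>i. complex_of_real (s i)) \<in> pts (lorentz w p) \<longleftrightarrow> summable (\<lambda>k. w k * s k powr p)"
proof
  have s0: "0 \<le> s i" for i using decseq_ge[OF s] .
  show "(\<lambda>i. complex_of_real (s i)) \<in> pts (lorentz w p) \<Longrightarrow> summable (\<lambda>k. w k * s k powr p)"
    by (simp add: lorentz_def rearr_decseq[OF s(1) s0])
  assume sm: "summable (\<lambda>k. w k * s k powr p)"
  have bd: "bounded (range (\<lambda>i. complex_of_real (s i)))"
    by (rule boundedI[where B = "s 0"]) (use s0 decseqD[OF s(1), of 0] in auto)
  have "\<exists>y\<in>c00. lorentz_norm w p (\<lambda>k. complex_of_real (s k) - y k) < \<epsilon>" if "\<epsilon> > 0" for \<epsilon>
  proof -
    have tail: "(\<lambda>N. \<Sum>k. w k * s (N + k) powr p) \<longlonglongrightarrow> (\<Sum>k. 0)"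
    proof (rule tannerys_theorem[THEN conjunct2, THEN conjunct2])
      fix k
      have "(\<lambda>N. s (N + k) powr p) \<longlonglongrightarrow> 0 powr p"
      proof (rule tendsto_powr')
        show "(\<lambda>N. s (N + k)) \<longlonglongrightarrow> 0" by (rule LIMSEQ_ignore_initial_segment[OF s(2)])
      qed (use p s0 in auto)
      then have "(\<lambda>N. s (N + k) powr p) \<longlonglongrightarrow> 0" using p by simp
      then show "(\<lambda>N. w k * s (N + k) powr p) \<longlonglongrightarrow> 0" by (rule tendsto_mult_right_zero)
    next
      show "\<forall>\<^sub>F (k, N) in sequentially \<times>\<^sub>F sequentially. norm (w k * s (N + k) powr p) \<le> w k * s k powr p"
        using w s0 p decseqD[OF s(1)]
        by (intro always_eventually) (auto simp: abs_mult intro!: mult_left_mono powr_mono2)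
    qed (use sm in auto)
    have "(\<lambda>N. (\<Sum>k. w k * s (N + k) powr p) powr (1 / p)) \<longlonglongrightarrow> 0 powr (1 / p)"
    proof (rule tendsto_powr')
      have "summable (\<lambda>k. w k * s (N + k) powr p)" for N
        by (rule summable_comparison_test'[OF sm, where N = 0])
          (use w s0 p decseqD[OF s(1)] in \<open>auto simp: abs_mult intro!: mult_left_mono powr_mono2\<close>)
      then have "(\<Sum>k. w k * s (N + k) powr p) \<ge> 0" for N
        using w by (intro suminf_nonneg) auto
      then show "0 \<noteq> 0 \<or> 0 < 1 / p \<and> (\<forall>\<^sub>F N in sequentially. 0 \<le> (\<Sum>k. w k * s (N + k) powr p))"
        using p by auto
    qed (use tail in auto)
    then have "(\<lambda>N. (\<Sum>k. w k * s (N + k) powr p) powr (1 / p)) \<longlonglongrightarrow> 0" using p by simp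
    from order_tendstoD(2)[OF this \<open>\<epsilon> > 0\<close>]
    obtain N where N: "(\<Sum>k. w k * s (N + k) powr p) powr (1 / p) < \<epsilon>"
      unfolding eventually_sequentially by blast
    define y where "y k = (if k < N then complex_of_real (s k) else 0)" for k
    have "(\<lambda>k. complex_of_real (s k) - y k) = (\<lambda>k. if k < N then 0 else of_real (s k))"
      by (auto simp: y_def)
    then have "lorentz_norm w p (\<lambda>k. complex_of_real (s k) - y k) < \<epsilon>"
      using N by (simp add: lorentz_norm_def rearr_shifted[OF s(1) s0])
    moreover have "y \<in> c00"
      by (auto simp: c00_def y_def)
    ultimately show ?thesis by blast
  qed
  then show "(\<lambda>i. complex_of_real (s i)) \<in> pts (lorentz w p)"
    using sm bd by (simp add: lorentz_def rearr_decseq[OF s(1) s0])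
qed

section \<open>Normed spaces on carrier sets\<close>

locale nspace_norm =
  fixes X :: "'a::complex_vector nspace"
  assumes pts_zero: "0 \<in> pts X"
    and pts_add: "x \<in> pts X \<Longrightarrow> y \<in> pts X \<Longrightarrow> x + y \<in> pts X"
    and pts_scaleC: "x \<in> pts X \<Longrightarrow> c *\<^sub>C x \<in> pts X"
    and nm_nonneg: "x \<in> pts X \<Longrightarrow> 0 \<le> nm X x"
    and nm_eq_zero: "x \<in> pts X \<Longrightarrow> nm X x = 0 \<Longrightarrow> x = 0"
    and nm_add: "x \<in> pts X \<Longrightarrow> y \<in> pts X \<Longrightarrow> nm X (x + y) \<le> nm X x + nm X y"
    and nm_scaleC: "x \<in> pts X \<Longrightarrow> nm X (c *\<^sub>C x) = cmod c * nm X x"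
begin

lemma pts_minus: "x \<in> pts X \<Longrightarrow> - x \<in> pts X"
  using pts_scaleC[of x "- 1"] by simp

lemma nm_minus: "x \<in> pts X \<Longrightarrow> nm X (- x) = nm X x"
  using nm_scaleC[of x "- 1"] by simp

lemma pts_diff: "x \<in> pts X \<Longrightarrow> y \<in> pts X \<Longrightarrow> x - y \<in> pts X"
  using pts_add[of x "- y"] pts_minus by simp

lemma nm_diff_commute: "x \<in> pts X \<Longrightarrow> y \<in> pts X \<Longrightarrow> nm X (x - y) = nm X (y - x)"
  using nm_minus[OF pts_diff, of x y] by simp

lemma nm_zero: "nm X 0 = 0"
  using nm_scaleC[OF pts_zero, of 0] by simp

lemma nm_diff_triangle:
  assumes "x \<in> pts X" "y \<in> pts X" "z \<in> pts X"
  shows "nm X (x - z) \<le> nm X (x - y) + nm X (y - z)"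
  using nm_add[OF pts_diff pts_diff, of x y y z] assms by simp

lemma nm_pos: "x \<in> pts X \<Longrightarrow> x \<noteq> 0 \<Longrightarrow> 0 < nm X x"
  using nm_nonneg nm_eq_zero by force

sublocale M: Metric_space "pts X" "\<lambda>x y. if x \<in> pts X \<and> y \<in> pts X then nm X (x - y) else 0"
proof
  show "(if x \<in> pts X \<and> y \<in> pts X then nm X (x - y) else 0) = 0 \<longleftrightarrow> x = y"
    if "x \<in> pts X" "y \<in> pts X" for x y
    using that nm_eq_zero[OF pts_diff[OF that]] by (auto simp: nm_zero)
qed (auto simp: nm_nonneg pts_diff nm_diff_commute nm_diff_triangle)

lemma ntop_eq: "ntop X = M.mtopology"
  by (simp add: ntop_def)

lemma in_mball: "y \<in> M.mball x r \<longleftrightarrow> x \<in> pts X \<and> y \<in> pts X \<and> nm X (x - y) < r"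
  by (auto simp: M.mball_def)

lemma subspace_normalise:
  assumes Z: "complex_vector.subspace Z" "Z \<subseteq> pts X" and z: "z \<in> Z" "z \<noteq> 0"
  obtains c where "c \<noteq> 0" "c *\<^sub>C z \<in> Z" "nm X (c *\<^sub>C z) = 1" "cmod c = 1 / nm X z"
proof
  let ?c = "complex_of_real (1 / nm X z)"
  have p: "nm X z > 0" using nm_pos Z z by blast
  then show "?c \<noteq> 0" by simp
  show "cmod ?c = 1 / nm X z" using p by (simp del: of_real_divide)
  then show "nm X (?c *\<^sub>C z) = 1" using Z z p by (subst nm_scaleC) auto
  show "?c *\<^sub>C z \<in> Z" using complex_vector.subspace_scale Z z by blast
qed

end

section \<open>Linear functionals on large subspaces\<close>

definition lin_on :: "'a::complex_vector set \<Rightarrow> ('a \<Rightarrow> complex) \<Rightarrow> bool" where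
  "lin_on S \<phi> \<longleftrightarrow> (\<forall>x\<in>S. \<forall>y\<in>S. \<phi> (x + y) = \<phi> x + \<phi> y) \<and> (\<forall>c. \<forall>x\<in>S. \<phi> (c *\<^sub>C x) = c * \<phi> x)"

text \<open>Dimension at least \<open>N\<close>, in a form that is stable under passing to the kernel of a functional
  and does not single out infinite-dimensional spaces.\<close>

definition dim_at_least :: "nat \<Rightarrow> 'a::complex_vector set \<Rightarrow> bool" where
  "dim_at_least N Z \<longleftrightarrow> (\<forall>B. finite B \<and> card B < N \<longrightarrow> \<not> Z \<subseteq> complex_vector.span B)"

lemma dim_at_leastI: "\<not> fin_dim Z \<or> N \<le> complex_vector.dim Z \<Longrightarrow> dim_at_least N Z"
  unfolding dim_at_least_def fin_dim_def
  by (meson complex_vector.dim_le_card linorder_not_le order_trans)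

lemma dim_at_least_mono: "dim_at_least N Z \<Longrightarrow> M \<le> N \<Longrightarrow> dim_at_least M Z"
  by (simp add: dim_at_least_def)

lemma dim_at_least_kernel:
  assumes Z: "complex_vector.subspace Z" and \<phi>: "lin_on Z \<phi>" and d: "dim_at_least (Suc N) Z"
  shows "dim_at_least N {z \<in> Z. \<phi> z = 0}"
  unfolding dim_at_least_def
proof (intro allI impI notI)
  fix B assume B: "finite B \<and> card B < N" and sub: "{z \<in> Z. \<phi> z = 0} \<subseteq> complex_vector.span B"
  have "\<exists>b. Z \<subseteq> complex_vector.span (insert b B)"
  proof (cases "\<forall>z\<in>Z. \<phi> z = 0")
    case True
    then have "Z \<subseteq> complex_vector.span B" using sub by auto
    also have "\<dots> \<subseteq> complex_vector.span (insert 0 B)" by (intro complex_vector.span_mono) auto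
    finally show ?thesis ..
  next
    case False
    then obtain b where b: "b \<in> Z" "\<phi> b \<noteq> 0" by blast
    have "z \<in> complex_vector.span (insert b B)" if z: "z \<in> Z" for z
    proof -
      define k where "k = (- \<phi> z / \<phi> b) *\<^sub>C b"
      have k: "k \<in> Z" unfolding k_def by (rule complex_vector.subspace_scale[OF Z b(1)])
      then have "z + k \<in> Z" using z Z complex_vector.subspace_add by blast
      moreover have "\<phi> (z + k) = \<phi> z + \<phi> k" using \<phi> z k by (simp add: lin_on_def)
      moreover have "\<phi> k = (- \<phi> z / \<phi> b) * \<phi> b"
        unfolding k_def using \<phi> b(1) unfolding lin_on_def by blast
      ultimately have "z + k \<in> complex_vector.span B" using sub b by auto
      then have "z + k \<in> complex_vector.span (insert b B)"
        using complex_vector.span_mono[of B "insert b B"] by auto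
      moreover have "k \<in> complex_vector.span (insert b B)"
        unfolding k_def by (intro complex_vector.span_scale complex_vector.span_base) simp
      ultimately show ?thesis
        using complex_vector.span_diff[of "z + k" "insert b B" k] by simp
    qed
    then show ?thesis by blast
  qed
  then obtain b where "Z \<subseteq> complex_vector.span (insert b B)" ..
  moreover have "finite (insert b B)" "card (insert b B) < Suc N"
    using B card_insert_le_m1[of "Suc N" B b] by (auto simp: card_insert_if)
  ultimately show False using d unfolding dim_at_least_def by blast
qed

lemma common_kernel_nontrivial:
  assumes fin: "finite \<Phi>" and "complex_vector.subspace Z" "\<And>\<phi>. \<phi> \<in> \<Phi> \<Longrightarrow> lin_on Z \<phi>"
    and "dim_at_least (Suc (card \<Phi>)) Z"
  shows "\<exists>z\<in>Z. z \<noteq> 0 \<and> (\<forall>\<phi>\<in>\<Phi>. \<phi> z = 0)"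
  using assms
proof (induction \<Phi> arbitrary: Z)
  case empty
  then have "\<not> Z \<subseteq> complex_vector.span {}" by (simp add: dim_at_least_def del: complex_vector.span_empty)
  then show ?case by auto
next
  case (insert \<phi> \<Phi>)
  define Z' where "Z' = {z \<in> Z. \<phi> z = 0}"
  have \<phi>: "lin_on Z \<phi>" using insert by simp
  have "\<phi> 0 = 0"
    using \<phi> insert.prems(1) complex_vector.subspace_0[of Z] unfolding lin_on_def
    by (metis mult_zero_left scaleC_simps(1))
  then have "complex_vector.subspace Z'"
    using insert.prems(1) \<phi> unfolding complex_vector.subspace_def Z'_def lin_on_def by auto
  moreover have "lin_on Z' \<psi>" if "\<psi> \<in> \<Phi>" for \<psi>
    using insert.prems(2)[of \<psi>] that by (auto simp: lin_on_def Z'_def)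
  moreover have "dim_at_least (Suc (card \<Phi>)) Z'"
    unfolding Z'_def
    by (rule dim_at_least_kernel[OF insert.prems(1) \<phi>]) (use insert in simp)
  ultimately obtain z where "z \<in> Z'" "z \<noteq> 0" "\<forall>\<psi>\<in>\<Phi>. \<psi> z = 0"
    using insert.IH[of Z'] by blast
  then show ?case by (auto simp: Z'_def)
qed

section \<open>General inclusions between the operator classes\<close>

lemma bounded_ops_D:
  assumes "T \<in> bounded_ops X Y"
  shows "x \<in> pts X \<Longrightarrow> T x \<in> pts Y"
    and "x \<in> pts X \<Longrightarrow> y \<in> pts X \<Longrightarrow> T (x + y) = T x + T y"
    and "x \<in> pts X \<Longrightarrow> T (c *\<^sub>C x) = c *\<^sub>C T x"
  using assms by (auto simp: bounded_ops_def)

text \<open>Continuity of the inverse at 0 gives a ball around 0 in which only images of vectors of norm less than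
  1 lie.\<close>

lemma embedding_bounded_below:
  assumes "nspace_norm X" "nspace_norm Y" and T: "T \<in> bounded_ops X Y"
    and Z: "complex_vector.subspace Z" "Z \<subseteq> pts X"
    and emb: "embedding_map (subtopology (ntop X) Z) (ntop Y) T"
  shows "\<exists>r>0. \<forall>z\<in>Z. nm X z = 1 \<longrightarrow> r \<le> nm Y (T z)"
proof -
  interpret X: nspace_norm X by fact
  interpret Y: nspace_norm Y by fact
  have top: "topspace (subtopology (ntop X) Z) = Z"
    using Z by (auto simp: X.ntop_eq)
  have hm: "homeomorphic_map (subtopology (ntop X) Z) (subtopology (ntop Y) (T ` Z)) T"
    using emb unfolding embedding_map_def top .
  define U where "U = Z \<inter> X.M.mball 0 1"
  have "openin (subtopology (ntop X) Z) U"
    unfolding U_def X.ntop_eq openin_subtopology by (auto intro!: X.M.openin_mball)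
  then have "openin (subtopology (ntop Y) (T ` Z)) (T ` U)"
    using homeomorphic_imp_open_map[OF hm] by (simp add: open_map_def)
  then obtain V where V: "openin (ntop Y) V" "T ` U = V \<inter> T ` Z"
    unfolding openin_subtopology by blast
  have T0: "T 0 = 0" using bounded_ops_D(3)[OF T X.pts_zero, of 0] by simp
  have "0 \<in> Z" using Z(1) by (rule complex_vector.subspace_0)
  moreover have "0 \<in> X.M.mball 0 1" by (simp add: X.in_mball X.pts_zero X.nm_zero)
  ultimately have "T 0 \<in> V" using V(2) by (auto simp: U_def)
  then obtain r where r: "r > 0" "Y.M.mball 0 r \<subseteq> V"
    using V(1) unfolding Y.ntop_eq Y.M.openin_mtopology T0 by blast
  have "r \<le> nm Y (T z)" if z: "z \<in> Z" "nm X z = 1" for z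
  proof (rule ccontr)
    assume "\<not> r \<le> nm Y (T z)"
    moreover have "T z \<in> pts Y" using T z Z by (auto intro: bounded_ops_D)
    ultimately have "T z \<in> Y.M.mball 0 r" by (simp add: Y.in_mball Y.pts_zero Y.nm_minus)
    then have "T z \<in> T ` U" using V(2) r(2) z(1) by blast
    then obtain u where u: "u \<in> U" "T z = T u" by blast
    then have "z = u"
      using homeomorphic_imp_injective_map[OF hm] z(1) unfolding top U_def by (auto dest: inj_onD)
    then show False using u z by (auto simp: U_def X.in_mball X.nm_minus)
  qed
  then show ?thesis using r(1) by blast
qed

lemma strictly_singularI:
  assumes X: "nspace_norm X" and Y: "nspace_norm Y" and T: "T \<in> bounded_ops X Y"
    and small: "\<And>Z \<epsilon>. complex_vector.subspace Z \<Longrightarrow> Z \<subseteq> pts X \<Longrightarrow> \<not> fin_dim Z \<Longrightarrow> \<epsilon> > 0 \<Longrightarrow>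
      \<exists>x\<in>Z. nm X x = 1 \<and> nm Y (T x) < \<epsilon>"
  shows "T \<in> strictly_singular_ops X Y"
  unfolding strictly_singular_ops_def
proof (intro CollectI conjI allI impI notI)
  fix Z assume Z: "complex_vector.subspace Z" "closedin (ntop X) Z" "\<not> fin_dim Z"
    and emb: "embedding_map (subtopology (ntop X) Z) (ntop Y) T"
  interpret X: nspace_norm X by fact
  have sub: "Z \<subseteq> pts X"
    using closedin_subset[OF Z(2)] by (simp add: X.ntop_eq)
  obtain r where "r > 0" "\<And>z. z \<in> Z \<Longrightarrow> nm X z = 1 \<Longrightarrow> r \<le> nm Y (T z)"
    using embedding_bounded_below[OF X Y T Z(1) sub emb] by blast
  with small[OF Z(1) sub Z(3), of r] show False by force
qed (rule T)

lemma finitely_strictly_singular_imp_strictly_singular: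
  assumes "nspace_norm X" "nspace_norm Y"
  shows "finitely_strictly_singular_ops X Y \<subseteq> strictly_singular_ops X Y"
proof
  fix T assume T: "T \<in> finitely_strictly_singular_ops X Y"
  show "T \<in> strictly_singular_ops X Y"
  proof (rule strictly_singularI[OF assms])
    show "\<exists>x\<in>Z. nm X x = 1 \<and> nm Y (T x) < \<epsilon>"
      if "complex_vector.subspace Z" "Z \<subseteq> pts X" "\<not> fin_dim Z" "\<epsilon> > 0" for Z \<epsilon>
    proof -
      from T \<open>\<epsilon> > 0\<close> obtain N :: nat where "\<forall>Z. complex_vector.subspace Z \<longrightarrow> Z \<subseteq> pts X \<longrightarrow>
          \<not> fin_dim Z \<or> N \<le> complex_vector.dim Z \<longrightarrow> (\<exists>x\<in>Z. nm X x = 1 \<and> nm Y (T x) < \<epsilon>)"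
        unfolding finitely_strictly_singular_ops_def by auto
      then show ?thesis using that by blast
    qed
  qed (use T in \<open>simp add: finitely_strictly_singular_ops_def\<close>)
qed

lemma compact_ops_totally_bounded:
  assumes "nspace_norm X" "nspace_norm Y" and T: "T \<in> compact_ops X Y" and \<delta>: "\<delta> > 0"
  obtains K where "finite K" "K \<subseteq> pts Y"
    "\<And>x. x \<in> pts X \<Longrightarrow> nm X x \<le> 1 \<Longrightarrow> \<exists>y\<in>K. nm Y (y - T x) < \<delta>"
proof -
  interpret X: nspace_norm X by fact
  interpret Y: nspace_norm Y by fact
  define S where "S = T ` {x \<in> pts X. nm X x \<le> 1}"
  have TB: "T \<in> bounded_ops X Y" and "compactin (ntop Y) (ntop Y closure_of S)"
    using T by (auto simp: compact_ops_def S_def)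
  then have "Y.M.mtotally_bounded (Y.M.mtopology closure_of S)"
    unfolding Y.ntop_eq by (intro Y.M.compactin_imp_mtotally_bounded)
  then have "\<exists>K. finite K \<and> K \<subseteq> Y.M.mtopology closure_of S \<and>
      Y.M.mtopology closure_of S \<subseteq> (\<Union>x\<in>K. Y.M.mball x \<delta>)"
    using \<delta> unfolding Y.M.mtotally_bounded_def by simp
  then obtain K where K: "finite K" "K \<subseteq> Y.M.mtopology closure_of S"
      "Y.M.mtopology closure_of S \<subseteq> (\<Union>x\<in>K. Y.M.mball x \<delta>)"
    by (elim exE conjE) (rule that)
  show ?thesis
  proof
    show "finite K" by fact
    show "K \<subseteq> pts Y" using K(2) closure_of_subset_topspace[of Y.M.mtopology S] by auto
    fix x assume x: "x \<in> pts X" "nm X x \<le> 1"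
    have "S \<subseteq> topspace Y.M.mtopology" using bounded_ops_D(1)[OF TB] by (auto simp: S_def)
    then have "S \<subseteq> (\<Union>x\<in>K. Y.M.mball x \<delta>)"
      using closure_of_subset K(3) by blast
    moreover have "T x \<in> S" using x by (auto simp: S_def)
    ultimately have "T x \<in> (\<Union>x\<in>K. Y.M.mball x \<delta>)" by (rule subsetD)
    then obtain y where "y \<in> K" "T x \<in> Y.M.mball y \<delta>" by blast
    then show "\<exists>y\<in>K. nm Y (y - T x) < \<delta>" unfolding Y.in_mball by blast
  qed
qed

text \<open>The hypothesis on \<open>Y\<close> is a substitute for norming functionals: up to \<open>\<delta>\<close>, finitely many
  functionals show that the distance of \<open>y\<close> from their common kernel is at least \<open>nm Y y\<close>. A large subspace contains a
  unit vector whose image is in the kernel of the functionals for a whole net of the image of the unit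
  ball; its image is close to a point of the net and therefore small.\<close>

lemma compact_imp_finitely_strictly_singular:
  assumes X: "nspace_norm X" and Y: "nspace_norm Y"
    and sep: "\<And>y \<delta>. y \<in> pts Y \<Longrightarrow> \<delta> > 0 \<Longrightarrow> \<exists>\<Phi>. finite \<Phi> \<and> (\<forall>\<phi>\<in>\<Phi>. lin_on (pts Y) \<phi>) \<and>
      (\<forall>z\<in>pts Y. (\<forall>\<phi>\<in>\<Phi>. \<phi> z = 0) \<longrightarrow> nm Y y \<le> nm Y (y - z) + \<delta>)"
  shows "compact_ops X Y \<subseteq> finitely_strictly_singular_ops X Y"
proof
  interpret X: nspace_norm X by fact
  interpret Y: nspace_norm Y by fact
  fix T assume T: "T \<in> compact_ops X Y"
  then have TB: "T \<in> bounded_ops X Y" by (simp add: compact_ops_def)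
  show "T \<in> finitely_strictly_singular_ops X Y"
    unfolding finitely_strictly_singular_ops_def
  proof (intro CollectI conjI allI impI TB)
    fix \<epsilon> :: real assume \<epsilon>: "\<epsilon> > 0"
    define \<delta> where "\<delta> = \<epsilon> / 4"
    have \<delta>: "\<delta> > 0" using \<epsilon> by (simp add: \<delta>_def)
    obtain K where K: "finite K" "K \<subseteq> pts Y"
        "\<And>x. x \<in> pts X \<Longrightarrow> nm X x \<le> 1 \<Longrightarrow> \<exists>y\<in>K. nm Y (y - T x) < \<delta>"
      using compact_ops_totally_bounded[OF X Y T \<delta>] by blast
    have "\<forall>y\<in>K. \<exists>\<Phi>. finite \<Phi> \<and> (\<forall>\<phi>\<in>\<Phi>. lin_on (pts Y) \<phi>) \<and>
      (\<forall>z\<in>pts Y. (\<forall>\<phi>\<in>\<Phi>. \<phi> z = 0) \<longrightarrow> nm Y y \<le> nm Y (y - z) + \<delta>)"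
      using sep[OF _ \<delta>] K(2) by blast
    then obtain \<Phi> where \<Phi>: "\<And>y. y \<in> K \<Longrightarrow> finite (\<Phi> y)" "\<And>y \<phi>. y \<in> K \<Longrightarrow> \<phi> \<in> \<Phi> y \<Longrightarrow> lin_on (pts Y) \<phi>"
      "\<And>y z. y \<in> K \<Longrightarrow> z \<in> pts Y \<Longrightarrow> (\<forall>\<phi>\<in>\<Phi> y. \<phi> z = 0) \<Longrightarrow> nm Y y \<le> nm Y (y - z) + \<delta>"
      by metis
    define \<Psi> where "\<Psi> = (\<lambda>\<phi> x. \<phi> (T x)) ` (\<Union>y\<in>K. \<Phi> y)"
    have fin: "finite \<Psi>" using K(1) \<Phi>(1) by (simp add: \<Psi>_def)
    have "\<exists>x\<in>Z. nm X x = 1 \<and> nm Y (T x) < \<epsilon>"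
      if Z: "complex_vector.subspace Z" "Z \<subseteq> pts X" and d: "\<not> fin_dim Z \<or> Suc (card \<Psi>) \<le> complex_vector.dim Z" for Z
    proof -
      have "\<exists>z\<in>Z. z \<noteq> 0 \<and> (\<forall>\<psi>\<in>\<Psi>. \<psi> z = 0)"
      proof (rule common_kernel_nontrivial[OF fin Z(1)])
        show "lin_on Z \<psi>" if "\<psi> \<in> \<Psi>" for \<psi>
          using that \<Phi>(2) bounded_ops_D[OF TB] Z(2) unfolding \<Psi>_def lin_on_def by (fastforce simp: subset_iff)
      qed (use d in \<open>rule dim_at_leastI\<close>)
      then obtain z where z: "z \<in> Z" "z \<noteq> 0" "\<And>\<psi>. \<psi> \<in> \<Psi> \<Longrightarrow> \<psi> z = 0" by blast
      obtain c where c: "c *\<^sub>C z \<in> Z" "nm X (c *\<^sub>C z) = 1"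
        using X.subspace_normalise[OF Z z(1,2)] by metis
      define x where "x = c *\<^sub>C z"
      have x: "x \<in> pts X" "T x \<in> pts Y" using c Z bounded_ops_D(1)[OF TB] by (auto simp: x_def)
      obtain y where y: "y \<in> K" "nm Y (y - T x) < \<delta>" using K(3)[of x] x c by (auto simp: x_def)
      have yp: "y \<in> pts Y" using y K by auto
      have "\<phi> (T x) = 0" if "\<phi> \<in> \<Phi> y" for \<phi>
      proof -
        have "\<phi> (T z) = 0" using z(3)[of "\<lambda>x. \<phi> (T x)"] that y by (auto simp: \<Psi>_def)
        moreover have "z \<in> pts X" using z Z by auto
        ultimately show ?thesis
          using \<Phi>(2)[OF y(1) that] bounded_ops_D[OF TB] by (simp add: x_def lin_on_def)
      qed
      then have "nm Y y \<le> nm Y (y - T x) + \<delta>" using \<Phi>(3)[OF y(1) x(2)] by blast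
      moreover have "nm Y (T x) \<le> nm Y (T x - y) + nm Y y"
        using Y.nm_diff_triangle[OF x(2) yp Y.pts_zero] by simp
      ultimately have "nm Y (T x) < \<epsilon>"
        using y(2) Y.nm_diff_commute[OF x(2) yp] \<delta> by (simp add: \<delta>_def)
      then show ?thesis using c by (auto simp: x_def)
    qed
    then show "\<exists>N. \<forall>Z. complex_vector.subspace Z \<longrightarrow> Z \<subseteq> pts X \<longrightarrow>
        \<not> fin_dim Z \<or> N \<le> complex_vector.dim Z \<longrightarrow> (\<exists>x\<in>Z. nm X x = 1 \<and> nm Y (T x) < \<epsilon>)" by blast
  qed
qed

section \<open>Flat vectors\<close>

text \<open>Milman's argument: if the supremum of the seminorms is attained at fewer than \<open>N\<close> places, move
  along a direction on which these seminorms vanish until a further one reaches the supremum.\<close>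

lemma flat_vector_exists:
  fixes q :: "nat \<Rightarrow> 'a::real_vector \<Rightarrow> real"
  assumes Z: "0 \<in> Z" "\<And>x y. x \<in> Z \<Longrightarrow> y \<in> Z \<Longrightarrow> x + y \<in> Z" "\<And>r x. x \<in> Z \<Longrightarrow> r *\<^sub>R x \<in> Z"
    and nn: "\<And>n x. 0 \<le> q n x"
    and tri: "\<And>n x y. x \<in> Z \<Longrightarrow> y \<in> Z \<Longrightarrow> q n (x + y) \<le> q n x + q n y"
    and hom: "\<And>n r x. x \<in> Z \<Longrightarrow> q n (r *\<^sub>R x) = \<bar>r\<bar> * q n x"
    and null: "\<And>x. x \<in> Z \<Longrightarrow> (\<lambda>n. q n x) \<longlonglongrightarrow> 0"
    and ex: "\<And>F. finite F \<Longrightarrow> card F < N \<Longrightarrow> \<exists>z\<in>Z. (\<forall>n\<in>F. q n z = 0) \<and> (\<exists>n. q n z \<noteq> 0)"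
  shows "\<exists>x\<in>Z. (\<forall>n. q n x \<le> 1) \<and> N \<le> card {n. q n x = 1}"
proof -
  have fin: "finite {n. q n x = 1}" if "x \<in> Z" for x
    by (rule finite_subset[OF _ decseq_null_level_finite[OF null[OF that], of 1]]) auto
  have "\<exists>x\<in>Z. (\<forall>n. q n x \<le> 1) \<and> M \<le> card {n. q n x = 1}" if "M \<le> N" for M
    using that
  proof (induction M)
    case 0
    show ?case using Z(1) hom[OF Z(1), of _ 0] by (intro bexI[of _ 0]) auto
  next
    case (Suc M)
    then obtain x where x: "x \<in> Z" "\<And>n. q n x \<le> 1" "M \<le> card {n. q n x = 1}" by auto
    define F where "F = {n. q n x = 1}"
    have finF: "finite F" using fin[OF x(1)] by (simp add: F_def)
    show ?case
    proof (cases "Suc M \<le> card F")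
      case True
      then show ?thesis using x by (auto simp: F_def)
    next
      case False
      then have "card F < N" using Suc.prems x by (simp add: F_def)
      then obtain z k where z: "z \<in> Z" "\<And>n. n \<in> F \<Longrightarrow> q n z = 0" "q k z \<noteq> 0"
        using ex[OF finF] by blast
      have kz: "q k z > 0" using z(3) nn[of k z] by simp
      have qd: "q n (x + t *\<^sub>R z) \<le> q n (x + s *\<^sub>R z) + \<bar>t - s\<bar> * q n z" for n s t
      proof -
        have "q n (x + t *\<^sub>R z) = q n ((x + s *\<^sub>R z) + (t - s) *\<^sub>R z)" by (simp add: algebra_simps)
        also have "\<dots> \<le> q n (x + s *\<^sub>R z) + q n ((t - s) *\<^sub>R z)" using Z x z by (intro tri) auto
        finally show ?thesis using hom[OF z(1)] by simp
      qed
      define S where "S = {t. 0 \<le> t \<and> (\<forall>n. q n (x + t *\<^sub>R z) \<le> 1)}"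
      have S0: "0 \<in> S" using x by (simp add: S_def)
      have Sb: "t \<le> 2 / q k z" if "t \<in> S" for t
      proof -
        have "t * q k z = q k (t *\<^sub>R z)" using that hom[OF z(1)] by (simp add: S_def)
        also have "t *\<^sub>R z = (x + t *\<^sub>R z) + (- 1) *\<^sub>R x" by simp
        also have "q k \<dots> \<le> q k (x + t *\<^sub>R z) + q k ((- 1) *\<^sub>R x)"
          by (intro tri Z(2,3) x(1) z(1))
        also have "\<dots> \<le> 2" using hom[OF x(1), of k "- 1"] x(2)[of k] that by (simp add: S_def) (smt (verit))
        finally show ?thesis using kz by (simp add: field_simps)
      qed
      then have bdd: "bdd_above S" by (intro bdd_aboveI)
      define t where "t = Sup S"
      have t0: "0 \<le> t" unfolding t_def by (rule cSup_upper[OF S0 bdd])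
      have tS: "q n (x + t *\<^sub>R z) \<le> 1" for n
      proof (rule field_le_epsilon)
        fix e :: real assume e: "e > 0"
        define B where "B = q n z + 1"
        have B: "B > 0" using nn[of n z] by (simp add: B_def)
        then obtain s where s: "s \<in> S" "t - e / B < s"
          using less_cSupD[of S "t - e / B"] S0 e by (auto simp: t_def)
        then have "s \<le> t" unfolding t_def by (intro cSup_upper bdd)
        then have "\<bar>t - s\<bar> * q n z \<le> (e / B) * B"
          using s(2) B nn[of n z] e by (intro mult_mono) (auto simp: B_def)
        then show "q n (x + t *\<^sub>R z) \<le> 1 + e"
          using qd[of n t s] s(1) B by (auto simp: S_def) (smt (verit))
      qed
      define x' where "x' = x + t *\<^sub>R z"
      have x': "x' \<in> Z" using Z x z by (simp add: x'_def)
      have "\<exists>n. n \<notin> F \<and> q n x' = 1"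
      proof (rule ccontr)
        assume "\<nexists>n. n \<notin> F \<and> q n x' = 1"
        then have lt: "q n x' < 1" if "n \<notin> F" for n
          using tS[of n] that by (force simp: x'_def)
        have "finite {n. 1 / 2 \<le> q n x'}" by (rule decseq_null_level_finite[OF null[OF x']]) simp
        \<comment> \<open>Including \<open>1/2\<close> bounds the infinitely many small values, too, and makes the set non-empty.\<close>
        define m where "m = Max (insert (1/2) ((\<lambda>n. q n x') ` ({n. 1 / 2 \<le> q n x'} - F)))"
        have fi: "finite (insert (1/2) ((\<lambda>n. q n x') ` ({n. 1 / 2 \<le> q n x'} - F)))"
          using \<open>finite {n. 1 / 2 \<le> q n x'}\<close> by simp
        have m1: "m < 1" unfolding m_def using fi lt by (subst Max_less_iff) auto
        have m2: "q n x' \<le> m" if "n \<notin> F" for n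
        proof (cases "1 / 2 \<le> q n x'")
          case True
          then show ?thesis unfolding m_def using fi that by (intro Max_ge) auto
        next
          case False
          have "1 / 2 \<le> m" unfolding m_def using fi by (intro Max_ge) auto
          with False show ?thesis by simp
        qed
        obtain B where B: "B > 0" "\<And>n. q n z \<le> B"
          using null[OF z(1)] nn by (metis BseqE convergentI convergent_imp_Bseq abs_of_nonneg real_norm_def)
        define \<eta> where "\<eta> = (1 - m) / B"
        have \<eta>: "\<eta> > 0" using m1 B by (simp add: \<eta>_def)
        have "q n (x + (t + \<eta>) *\<^sub>R z) \<le> 1" for n
        proof (cases "n \<in> F")
          case True
          then show ?thesis using qd[of n "t + \<eta>" 0] z(2)[OF True] x(2)[of n] by simp
        next
          case False
          have "\<eta> * q n z \<le> \<eta> * B" using B \<eta> by simp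
          also have "\<dots> = 1 - m" using B by (simp add: \<eta>_def)
          finally show ?thesis using qd[of n "t + \<eta>" t] m2[OF False] \<eta> by (simp add: x'_def)
        qed
        then have "t + \<eta> \<in> S" using t0 \<eta> by (simp add: S_def)
        then have "t + \<eta> \<le> t" unfolding t_def by (intro cSup_upper bdd)
        then show False using \<eta> by simp
      qed
      then obtain n where n: "n \<notin> F" "q n x' = 1" by blast
      have "q j x' = 1" if "j \<in> F" for j
        using qd[of j 0 t] z(2)[OF that] tS[of j] that by (simp add: x'_def F_def)
      then have "insert n F \<subseteq> {j. q j x' = 1}" using n by auto
      from card_mono[OF fin[OF x'] this] have "Suc (card F) \<le> card {j. q j x' = 1}"
        using n finF by simp
      then show ?thesis using x' tS x(3) by (intro bexI[of _ x']) (auto simp: x'_def F_def)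
    qed
  qed
  then show ?thesis by blast
qed

section \<open>Mixed sequence spaces\<close>

text \<open>\<open>ell a d\<close> is the \<open>\<ell>\<^sub>a\<close>-sum of Hilbert spaces of dimensions \<open>d n\<close>. The coordinates of a sequence of
  vectors form a matrix; entries outside the dimension of their block are 0, so that equality of elements is
  equality of matrices.\<close>

definition blk :: "(nat \<Rightarrow> nat) \<Rightarrow> (nat \<Rightarrow> nat \<Rightarrow> complex) \<Rightarrow> nat \<Rightarrow> real" where
  "blk d c n = L2_set (\<lambda>i. cmod (c n i)) {..<d n}"

definition ell :: "real \<Rightarrow> (nat \<Rightarrow> nat) \<Rightarrow> (nat \<Rightarrow> nat \<Rightarrow> complex) set" where
  "ell a d = {c. (\<forall>n i. d n \<le> i \<longrightarrow> c n i = 0) \<and> summable (\<lambda>n. blk d c n powr a)}"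

definition ell_norm :: "real \<Rightarrow> (nat \<Rightarrow> nat) \<Rightarrow> (nat \<Rightarrow> nat \<Rightarrow> complex) \<Rightarrow> real" where
  "ell_norm a d c = (\<Sum>n. blk d c n powr a) powr (1 / a)"

lemma blk_nonneg [simp]: "0 \<le> blk d c n"
  by (simp add: blk_def)

lemma blk_add: "blk d (\<lambda>n i. c n i + c' n i) n \<le> blk d c n + blk d c' n"
  unfolding blk_def
  by (rule order_trans[OF L2_set_mono L2_set_triangle_ineq]) (auto simp: norm_triangle_ineq)

lemma blk_scale: "blk d (\<lambda>n i. k * c n i) n = cmod k * blk d c n"
  by (simp add: blk_def norm_mult L2_set_right_distrib)

lemma blk_eq_zero_iff: "blk d c n = 0 \<longleftrightarrow> (\<forall>i<d n. c n i = 0)"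
  by (auto simp: blk_def L2_set_eq_0_iff)

lemma ell_null:
  assumes c: "c \<in> ell a d" and a: "0 < a"
  shows "blk d c \<longlonglongrightarrow> 0"
proof -
  have "(\<lambda>n. blk d c n powr a) \<longlonglongrightarrow> 0"
    using c by (intro summable_LIMSEQ_zero) (simp add: ell_def)
  then have "(\<lambda>n. (blk d c n powr a) powr (1 / a)) \<longlonglongrightarrow> 0 powr (1 / a)"
    using a by (intro tendsto_powr') auto
  then show ?thesis using a by (simp add: powr_powr)
qed

lemma blk_le_ell_norm:
  assumes c: "c \<in> ell a d" and a: "0 < a"
  shows "blk d c n \<le> ell_norm a d c"
proof -
  have "(\<Sum>k\<in>{n}. blk d c k powr a) \<le> (\<Sum>n. blk d c n powr a)"
    using c by (intro sum_le_suminf) (auto simp: ell_def)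
  then have "(blk d c n powr a) powr (1 / a) \<le> (\<Sum>n. blk d c n powr a) powr (1 / a)"
    using a by (intro powr_mono2) auto
  then show ?thesis using a by (simp add: powr_powr ell_norm_def)
qed

lemma ell_norm_nonneg [simp]: "0 \<le> ell_norm a d c"
  by (simp add: ell_norm_def)

lemma ell_norm_powr:
  assumes "c \<in> ell a d" "0 < a"
  shows "ell_norm a d c powr a = (\<Sum>n. blk d c n powr a)"
proof -
  have "0 \<le> (\<Sum>n. blk d c n powr a)" using assms by (intro suminf_nonneg) (auto simp: ell_def)
  then show ?thesis using assms by (simp add: ell_norm_def powr_powr)
qed

lemma ell_inclusion:
  assumes c: "c \<in> ell a d" and a: "0 < a" "a \<le> b"
  shows "c \<in> ell b d" and "ell_norm b d c \<le> ell_norm a d c"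
proof -
  define R where "R = ell_norm a d c"
  have sm: "summable (\<lambda>n. blk d c n powr a)" using c by (simp add: ell_def)
  have le: "blk d c n powr b \<le> R powr (b - a) * blk d c n powr a" for n
  proof -
    have "blk d c n powr b = blk d c n powr (b - a) * blk d c n powr a"
      by (simp flip: powr_add)
    also have "\<dots> \<le> R powr (b - a) * blk d c n powr a"
      unfolding R_def using a blk_le_ell_norm[OF c a(1)] by (intro mult_right_mono powr_mono2) auto
    finally show ?thesis .
  qed
  have sb: "summable (\<lambda>n. blk d c n powr b)"
    by (rule summable_comparison_test'[OF summable_mult[OF sm], where N = 0]) (use le in auto)
  then show cb: "c \<in> ell b d" using c by (simp add: ell_def)
  have "ell_norm b d c powr b = (\<Sum>n. blk d c n powr b)"
    using cb a by (simp add: ell_norm_powr)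
  also have "\<dots> \<le> (\<Sum>n. R powr (b - a) * blk d c n powr a)"
    by (rule suminf_le[OF le sb summable_mult[OF sm]])
  also have "\<dots> = R powr (b - a) * R powr a"
    unfolding R_def ell_norm_powr[OF c a(1)] by (rule suminf_mult[OF sm])
  also have "\<dots> = R powr b" by (simp flip: powr_add)
  finally have "(ell_norm b d c powr b) powr (1 / b) \<le> (R powr b) powr (1 / b)"
    by (rule powr_mono2[rotated 2]) (use a in auto)
  moreover have "(x powr b) powr (1 / b) = x" if "0 \<le> x" for x :: real
    using a that by (simp add: powr_powr)
  ultimately show "ell_norm b d c \<le> ell_norm a d c" by (simp only: R_def ell_norm_nonneg)
qed

definition one_block :: "(nat \<Rightarrow> nat) \<Rightarrow> nat \<Rightarrow> (nat \<Rightarrow> nat \<Rightarrow> complex) set" where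
  "one_block d n = {c. \<forall>m i. m \<noteq> n \<or> d m \<le> i \<longrightarrow> c m i = 0}"

lemma one_block_ell:
  assumes c: "c \<in> one_block d n" and a: "0 < a"
  shows "c \<in> ell a d" and "ell_norm a d c = blk d c n"
proof -
  have 0: "blk d c m = 0" if "m \<noteq> n" for m
    using c that by (auto simp: blk_eq_zero_iff one_block_def)
  have "(\<lambda>m. blk d c m powr a) sums (\<Sum>m\<in>{n}. blk d c m powr a)"
    by (rule sums_finite) (use 0 in auto)
  then have *: "(\<lambda>m. blk d c m powr a) sums (blk d c n powr a)" by simp
  then show "c \<in> ell a d" using c by (auto simp: ell_def one_block_def sums_iff)
  show "ell_norm a d c = blk d c n"
    using * a by (simp add: ell_norm_def sums_iff powr_powr)
qed

definition unit_block :: "nat \<Rightarrow> nat \<Rightarrow> nat \<Rightarrow> nat \<Rightarrow> complex" where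
  "unit_block n i m j = (if m = n \<and> j = i then 1 else 0)"

lemma unit_block_one_block: "i < d n \<Longrightarrow> unit_block n i \<in> one_block d n"
  by (auto simp: unit_block_def one_block_def)

lemma blk_unit_block: "i < d n \<Longrightarrow> blk d (unit_block n i) n = 1"
proof -
  assume i: "i < d n"
  have "(\<Sum>j<d n. (cmod (unit_block n i n j))\<^sup>2) = (\<Sum>j<d n. if j = i then 1 else 0)"
    by (intro sum.cong) (auto simp: unit_block_def)
  then show ?thesis using i by (simp add: blk_def L2_set_def)
qed

section \<open>Operators factoring through mixed sequence spaces\<close>

text \<open>\<open>J\<close> embeds the mixed space as a complemented subspace of \<open>X\<close>, with \<open>Q\<close> as a left inverse.\<close>

locale mixed_complement = nspace_norm X for X :: "'a::complex_vector nspace" +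
  fixes a :: real and d :: "nat \<Rightarrow> nat" and J :: "(nat \<Rightarrow> nat \<Rightarrow> complex) \<Rightarrow> 'a"
    and Q :: "'a \<Rightarrow> nat \<Rightarrow> nat \<Rightarrow> complex" and C :: real
  assumes a_ge_1: "1 \<le> a" and C_pos: "0 < C"
    and J_pts: "c \<in> ell a d \<Longrightarrow> J c \<in> pts X"
    and J_add: "c \<in> ell a d \<Longrightarrow> c' \<in> ell a d \<Longrightarrow> J (\<lambda>n i. c n i + c' n i) = J c + J c'"
    and J_scale: "c \<in> ell a d \<Longrightarrow> J (\<lambda>n i. k * c n i) = k *\<^sub>C J c"
    and J_norm: "c \<in> ell a d \<Longrightarrow> nm X (J c) \<le> C * ell_norm a d c"
    and Q_ell: "x \<in> pts X \<Longrightarrow> Q x \<in> ell a d"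
    and Q_add: "x \<in> pts X \<Longrightarrow> y \<in> pts X \<Longrightarrow> Q (x + y) = (\<lambda>n i. Q x n i + Q y n i)"
    and Q_scale: "x \<in> pts X \<Longrightarrow> Q (k *\<^sub>C x) = (\<lambda>n i. k * Q x n i)"
    and Q_norm: "x \<in> pts X \<Longrightarrow> ell_norm a d (Q x) \<le> C * nm X x"
    and Q_J: "c \<in> ell a d \<Longrightarrow> Q (J c) = c"
begin

lemma a_pos: "0 < a" using a_ge_1 by simp

lemma blk_Q_le: "x \<in> pts X \<Longrightarrow> blk d (Q x) n \<le> C * nm X x"
  using blk_le_ell_norm[OF Q_ell a_pos] Q_norm order_trans by blast

lemma Q_diff: "x \<in> pts X \<Longrightarrow> y \<in> pts X \<Longrightarrow> Q (x - y) = (\<lambda>n i. Q x n i - Q y n i)"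
  using Q_add[of x "- y"] Q_scale[of y "- 1"] pts_minus[of y] by simp

end

locale mixed_pair = X: mixed_complement X a d J Q C + Y: mixed_complement Y b d J' Q' C'
  for X :: "'a::complex_vector nspace" and Y :: "'b::complex_vector nspace"
    and a b d J Q C J' Q' C' +
  assumes ab: "a < b"
begin

definition T :: "'a \<Rightarrow> 'b" where
  "T = restrict (\<lambda>x. J' (Q x)) (pts X)"

lemma T_eq: "x \<in> pts X \<Longrightarrow> T x = J' (Q x)"
  by (simp add: T_def)

lemma Q_ell_b: "x \<in> pts X \<Longrightarrow> Q x \<in> ell b d"
  using ell_inclusion(1)[OF X.Q_ell X.a_pos] ab by simp

lemma norm_T_le: "x \<in> pts X \<Longrightarrow> nm Y (T x) \<le> C' * ell_norm b d (Q x)"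
  using Y.J_norm[OF Q_ell_b] by (simp add: T_eq)

lemma T_bounded: "T \<in> bounded_ops X Y"
proof -
  have "nm Y (T x) \<le> C' * C * nm X x" if x: "x \<in> pts X" for x
  proof -
    have "nm Y (T x) \<le> C' * ell_norm b d (Q x)" by (rule norm_T_le[OF x])
    also have "\<dots> \<le> C' * (C * nm X x)"
      using ell_inclusion(2)[OF X.Q_ell[OF x] X.a_pos, of b] X.Q_norm[OF x] ab Y.C_pos
      by (intro mult_left_mono) auto
    finally show ?thesis by simp
  qed
  moreover have "T (x + y) = T x + T y" if "x \<in> pts X" "y \<in> pts X" for x y
    using that by (simp add: T_eq X.pts_add X.Q_add Y.J_add Q_ell_b)
  moreover have "T (c *\<^sub>C x) = c *\<^sub>C T x" if "x \<in> pts X" for x c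
    using that by (simp add: T_eq X.pts_scaleC X.Q_scale Y.J_scale Q_ell_b)
  moreover have "T \<in> pts X \<rightarrow>\<^sub>E pts Y"
    unfolding T_def by (auto intro: Y.J_pts Q_ell_b)
  ultimately show ?thesis unfolding bounded_ops_def by blast
qed

text \<open>On a vector whose largest block norm 1 is attained at least \<open>N\<close> times, the \<open>a\<close>-norm of the
  blocks exceeds their \<open>b\<close>-norm at least by the factor \<open>N powr (1 / a - 1 / b)\<close>. A vector in the kernel of \<open>Q\<close> serves as well.\<close>

lemma small_image:
  assumes Z: "complex_vector.subspace Z" "Z \<subseteq> pts X" and N: "1 \<le> N"
    and ex: "\<And>F. finite F \<Longrightarrow> card F < N \<Longrightarrow> \<exists>z\<in>Z. z \<noteq> 0 \<and> (\<forall>n\<in>F. blk d (Q z) n = 0)"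
  shows "\<exists>x\<in>Z. nm X x = 1 \<and> nm Y (T x) \<le> C * C' * real N powr (1 / b - 1 / a)"
proof -
  have b: "b > 0" using ab X.a_pos by simp
  have "\<exists>x\<in>Z. x \<noteq> 0 \<and> nm Y (T x) \<le> C * C' * real N powr (1 / b - 1 / a) * nm X x"
  proof (cases "\<exists>z\<in>Z. z \<noteq> 0 \<and> (\<forall>n. blk d (Q z) n = 0)")
    case True
    then obtain z where z: "z \<in> Z" "z \<noteq> 0" "\<And>n. blk d (Q z) n = 0" by blast
    have zp: "z \<in> pts X" using z Z by auto
    have "nm Y (T z) \<le> 0"
      using norm_T_le[OF zp] z(3) b by (simp add: ell_norm_def)
    also have "0 \<le> C * C' * real N powr (1 / b - 1 / a) * nm X z"
      using X.C_pos Y.C_pos X.nm_nonneg[OF zp] by simp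
    finally show ?thesis using z by blast
  next
    case False
    have "\<exists>x\<in>Z. (\<forall>n. blk d (Q x) n \<le> 1) \<and> N \<le> card {n. blk d (Q x) n = 1}"
    proof (rule flat_vector_exists)
      show "0 \<in> Z" using Z complex_vector.subspace_0 by blast
      show "x + y \<in> Z" if "x \<in> Z" "y \<in> Z" for x y using Z that complex_vector.subspace_add by blast
      show "r *\<^sub>R x \<in> Z" if "x \<in> Z" for x r
        unfolding scaleR_scaleC using Z that complex_vector.subspace_scale by blast
      show "blk d (Q (x + y)) n \<le> blk d (Q x) n + blk d (Q y) n" if "x \<in> Z" "y \<in> Z" for x y n
      proof -
        have "x \<in> pts X" "y \<in> pts X" using that Z by auto
        then show ?thesis by (simp add: X.Q_add blk_add)
      qed
      show "blk d (Q (r *\<^sub>R x)) n = \<bar>r\<bar> * blk d (Q x) n" if "x \<in> Z" for x r n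
      proof -
        have "x \<in> pts X" using that Z by auto
        then show ?thesis by (simp add: scaleR_scaleC X.Q_scale blk_scale)
      qed
      show "(\<lambda>n. blk d (Q x) n) \<longlonglongrightarrow> 0" if "x \<in> Z" for x
        using ell_null[OF X.Q_ell X.a_pos] that Z by auto
      show "\<exists>z\<in>Z. (\<forall>n\<in>F. blk d (Q z) n = 0) \<and> (\<exists>n. blk d (Q z) n \<noteq> 0)" if "finite F" "card F < N" for F
        using ex[OF that] False by blast
    qed simp
    then obtain x where x: "x \<in> Z" "\<And>n. blk d (Q x) n \<le> 1" "N \<le> card {n. blk d (Q x) n = 1}" by blast
    have xp: "x \<in> pts X" using x Z by auto
    have ell: "Q x \<in> ell a d" by (rule X.Q_ell[OF xp])
    have fin: "finite {n. blk d (Q x) n = 1}"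
      by (rule finite_subset[OF _ decseq_null_level_finite[OF ell_null[OF ell X.a_pos], of 1]]) auto
    define S where "S = (\<Sum>n. blk d (Q x) n powr a)"
    have "real N \<le> (\<Sum>n | blk d (Q x) n = 1. blk d (Q x) n powr a)" using x(3) by simp
    also have "\<dots> \<le> S"
      unfolding S_def using ell fin by (intro sum_le_suminf) (auto simp: ell_def)
    finally have S: "real N \<le> S" .
    then have S0: "S > 0" using N by linarith
    have "ell_norm b d (Q x) \<le> S powr (1 / b)"
      unfolding ell_norm_def S_def
    proof (intro powr_mono2 suminf_le suminf_nonneg)
      show "blk d (Q x) n powr b \<le> blk d (Q x) n powr a" for n
        using x(2)[of n] ab by (intro powr_mono') auto
    qed (use ell Q_ell_b[OF xp] b in \<open>auto simp: ell_def\<close>)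
    then have "nm Y (T x) \<le> C' * S powr (1 / b)"
      using norm_T_le[OF xp] Y.C_pos by (smt (verit) mult_left_mono)
    also have "\<dots> = C' * S powr (1 / b - 1 / a) * S powr (1 / a)"
      using S0 by (simp flip: powr_add)
    also have "\<dots> \<le> C' * real N powr (1 / b - 1 / a) * (C * nm X x)"
    proof (intro mult_mono)
      show "S powr (1 / b - 1 / a) \<le> real N powr (1 / b - 1 / a)"
        using S N ab X.a_pos by (intro powr_mono2') (auto simp: field_simps)
      show "S powr (1 / a) \<le> C * nm X x"
        using X.Q_norm[OF xp] by (simp add: ell_norm_def S_def)
    qed (use Y.C_pos in auto)
    finally have le: "nm Y (T x) \<le> C * C' * real N powr (1 / b - 1 / a) * nm X x" by (simp add: mult_ac)
    have "x \<noteq> 0"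
    proof
      assume "x = 0"
      then have "blk d (Q x) n = 0" for n
        using blk_scale[of d 0 "Q x" n] X.Q_scale[OF xp, of 0] by simp
      then have "{n. blk d (Q x) n = 1} = {}" by simp
      then show False using x(3) N by simp
    qed
    then show ?thesis using x le by blast
  qed
  then obtain x where x: "x \<in> Z" "x \<noteq> 0" "nm Y (T x) \<le> C * C' * real N powr (1 / b - 1 / a) * nm X x" by blast
  obtain c where c: "c *\<^sub>C x \<in> Z" "nm X (c *\<^sub>C x) = 1" "cmod c = 1 / nm X x"
    using X.subspace_normalise[OF Z x(1,2)] by metis
  have xp: "x \<in> pts X" using x Z by auto
  have "nm Y (T (c *\<^sub>C x)) = nm Y (T x) / nm X x"
    using bounded_ops_D[OF T_bounded] xp c by (simp add: Y.nm_scaleC)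
  also have "\<dots> \<le> C * C' * real N powr (1 / b - 1 / a)"
    using x(3) X.nm_pos[OF xp x(2)] by (simp add: divide_le_eq)
  finally show ?thesis using c by blast
qed

lemma small_bound_exists:
  assumes "\<epsilon> > 0"
  obtains N :: nat where "1 \<le> N" "C * C' * real N powr (1 / b - 1 / a) < \<epsilon>"
proof -
  have e: "1 / b - 1 / a < 0" using ab X.a_pos by (simp add: field_simps)
  have "(\<lambda>N. C * C' * real N powr (1 / b - 1 / a)) \<longlonglongrightarrow> C * C' * 0"
    by (intro tendsto_mult tendsto_const tendsto_neg_powr[OF e] filterlim_real_sequentially)
  then have "\<forall>\<^sub>F N in sequentially. C * C' * real N powr (1 / b - 1 / a) < \<epsilon>"
    using assms by (intro order_tendstoD) auto
  then show ?thesis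
    using that eventually_conj[OF _ eventually_ge_at_top[of 1]] eventually_happens'[of sequentially]
    by (metis (mono_tags, lifting) eventually_sequentially linorder_linear)
qed

lemma Q_functional: "Z \<subseteq> pts X \<Longrightarrow> lin_on Z (\<lambda>z. Q z n i)"
  by (auto simp: lin_on_def X.Q_add X.Q_scale subset_iff)

text \<open>The vanishing of finitely many blocks amounts to finitely many linear conditions, which an
  infinite-dimensional subspace always allows.\<close>

lemma T_strictly_singular: "T \<in> strictly_singular_ops X Y"
proof (rule strictly_singularI[OF X.nspace_norm_axioms Y.nspace_norm_axioms T_bounded])
  fix Z and \<epsilon> :: real
  assume Z: "complex_vector.subspace Z" "Z \<subseteq> pts X" "\<not> fin_dim Z" and \<epsilon>: "\<epsilon> > 0"
  obtain N where N: "1 \<le> N" "C * C' * real N powr (1 / b - 1 / a) < \<epsilon>"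
    using small_bound_exists[OF \<epsilon>] by blast
  have "\<exists>x\<in>Z. nm X x = 1 \<and> nm Y (T x) \<le> C * C' * real N powr (1 / b - 1 / a)"
  proof (rule small_image[OF Z(1,2) N(1)])
    fix F :: "nat set" assume F: "finite F"
    define \<Phi> where "\<Phi> = (\<lambda>(n, i) z. Q z n i) ` (SIGMA n:F. {..<d n})"
    have "\<exists>z\<in>Z. z \<noteq> 0 \<and> (\<forall>\<phi>\<in>\<Phi>. \<phi> z = 0)"
    proof (rule common_kernel_nontrivial)
      show "finite \<Phi>" using F by (simp add: \<Phi>_def)
      show "lin_on Z \<phi>" if "\<phi> \<in> \<Phi>" for \<phi> using that Q_functional[OF Z(2)] by (auto simp: \<Phi>_def)
    qed (use Z in \<open>auto intro: dim_at_leastI\<close>)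
    then show "\<exists>z\<in>Z. z \<noteq> 0 \<and> (\<forall>n\<in>F. blk d (Q z) n = 0)"
      by (force simp: \<Phi>_def blk_eq_zero_iff)
  qed
  then show "\<exists>x\<in>Z. nm X x = 1 \<and> nm Y (T x) < \<epsilon>" using N by force
qed

text \<open>For one-dimensional blocks, fewer than \<open>N\<close> blocks amount to fewer than \<open>N\<close> linear conditions.\<close>

lemma T_finitely_strictly_singular:
  assumes d: "\<And>n. d n = 1"
  shows "T \<in> finitely_strictly_singular_ops X Y"
  unfolding finitely_strictly_singular_ops_def
proof (intro CollectI conjI allI impI T_bounded)
  fix \<epsilon> :: real assume \<epsilon>: "\<epsilon> > 0"
  obtain N where N: "1 \<le> N" "C * C' * real N powr (1 / b - 1 / a) < \<epsilon>"
    using small_bound_exists[OF \<epsilon>] by blast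
  have "\<exists>x\<in>Z. nm X x = 1 \<and> nm Y (T x) < \<epsilon>"
    if Z: "complex_vector.subspace Z" "Z \<subseteq> pts X" and dim: "\<not> fin_dim Z \<or> N \<le> complex_vector.dim Z" for Z
  proof -
    have "\<exists>x\<in>Z. nm X x = 1 \<and> nm Y (T x) \<le> C * C' * real N powr (1 / b - 1 / a)"
    proof (rule small_image[OF Z N(1)])
      fix F :: "nat set" assume F: "finite F" "card F < N"
      define \<Phi> where "\<Phi> = (\<lambda>n z. Q z n 0) ` F"
      have cd: "Suc (card \<Phi>) \<le> N" using F card_image_le[OF F(1), of "\<lambda>n z. Q z n 0"] by (simp add: \<Phi>_def)
      have "\<exists>z\<in>Z. z \<noteq> 0 \<and> (\<forall>\<phi>\<in>\<Phi>. \<phi> z = 0)"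
      proof (rule common_kernel_nontrivial)
        show "finite \<Phi>" using F by (simp add: \<Phi>_def)
        show "lin_on Z \<phi>" if "\<phi> \<in> \<Phi>" for \<phi> using that Q_functional[OF Z(2)] by (auto simp: \<Phi>_def)
        show "dim_at_least (Suc (card \<Phi>)) Z" by (rule dim_at_least_mono[OF dim_at_leastI[OF dim] cd])
      qed (rule Z)
      then show "\<exists>z\<in>Z. z \<noteq> 0 \<and> (\<forall>n\<in>F. blk d (Q z) n = 0)"
        by (force simp: \<Phi>_def blk_eq_zero_iff d)
    qed
    then show ?thesis using N by force
  qed
  then show "\<exists>N. \<forall>Z. complex_vector.subspace Z \<longrightarrow> Z \<subseteq> pts X \<longrightarrow>
      \<not> fin_dim Z \<or> N \<le> complex_vector.dim Z \<longrightarrow> (\<exists>x\<in>Z. nm X x = 1 \<and> nm Y (T x) < \<epsilon>)" by blast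
qed

text \<open>Suitable multiples of the images under \<open>J\<close> of the unit vectors lie in the unit ball. By means of \<open>Q'\<close>, their
  images under \<open>T\<close> are seen to have mutual distances of at least \<open>1 / (C * C')\<close>.\<close>

lemma T_not_compact:
  assumes d: "\<And>n. 0 < d n"
  shows "T \<notin> compact_ops X Y"
proof
  assume T: "T \<in> compact_ops X Y"
  define x where "x n = J (unit_block n 0)" for n
  define y where "y n = inverse (of_real C) *\<^sub>C x n" for n
  define \<delta> where "\<delta> = 1 / (2 * C * C')"
  have \<delta>: "\<delta> > 0" using X.C_pos Y.C_pos by (simp add: \<delta>_def)
  have ub: "unit_block n 0 \<in> ell a d" "ell_norm a d (unit_block n 0) = 1" for n
    using one_block_ell[OF unit_block_one_block[of 0 d n, OF d] X.a_pos] blk_unit_block[of 0 d n, OF d] by auto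
  have xp: "x n \<in> pts X" for n using X.J_pts ub by (simp add: x_def)
  have yp: "y n \<in> pts X" for n using xp X.pts_scaleC by (simp add: y_def)
  have "nm X (y n) \<le> 1" for n
  proof -
    have "nm X (x n) \<le> C" using X.J_norm[OF ub(1)[of n]] by (simp add: x_def ub(2))
    then show ?thesis
      using X.C_pos unfolding y_def X.nm_scaleC[OF xp] norm_inverse by (simp add: divide_simps)
  qed
  then obtain K where K: "finite K" "K \<subseteq> pts Y" "\<And>n. \<exists>k\<in>K. nm Y (k - T (y n)) < \<delta>"
    using compact_ops_totally_bounded[OF X.nspace_norm_axioms Y.nspace_norm_axioms T \<delta>] yp by metis
  then obtain g where g: "\<And>n. g n \<in> K" "\<And>n. nm Y (g n - T (y n)) < \<delta>" by metis
  have "\<not> inj g" using K(1) g(1) by (metis finite_subset image_subset_iff infinite_UNIV_nat finite_imageD)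
  then obtain m n where mn: "m \<noteq> n" "g m = g n" by (auto simp: inj_def)
  have Typ: "T (y n) \<in> pts Y" for n using T_bounded yp by (auto intro: bounded_ops_D)
  have gp: "g n \<in> pts Y" for n using g K by auto
  have "nm Y (T (y m) - T (y n)) \<le> nm Y (T (y m) - g m) + nm Y (g n - T (y n))"
    using Y.nm_diff_triangle[OF Typ gp Typ, of m n n] mn by simp
  also have "\<dots> < 2 * \<delta>"
    using g(2)[of m] g(2)[of n] Y.nm_diff_commute[OF Typ gp, of m m] by simp
  finally have lt: "nm Y (T (y m) - T (y n)) < 1 / (C * C')" by (simp add: \<delta>_def)
  have Qy: "Q (y k) = (\<lambda>n i. inverse (of_real C) * unit_block k 0 n i)" for k
    using X.Q_J[OF ub(1)[of k]] by (simp add: y_def X.Q_scale[OF xp]) (simp add: x_def)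
  have QT: "Q' (T (y k)) = (\<lambda>n i. inverse (of_real C) * unit_block k 0 n i)" for k
    using Y.Q_J[OF Q_ell_b[OF yp[of k]]] by (simp add: T_eq[OF yp] Qy)
  have "blk d (Q' (T (y m) - T (y n))) m = blk d (\<lambda>k i. inverse (of_real C) * unit_block m 0 k i) m"
    unfolding Y.Q_diff[OF Typ Typ] QT using mn(1) by (simp add: blk_def unit_block_def)
  also have "\<dots> = 1 / C"
    using X.C_pos unfolding blk_scale blk_unit_block[of 0 d m, OF d] norm_inverse
    by (simp add: inverse_eq_divide)
  finally have "1 / C \<le> C' * nm Y (T (y m) - T (y n))"
    using Y.blk_Q_le[OF Y.pts_diff[OF Typ Typ], of m n m] by simp
  then show False using lt X.C_pos Y.C_pos by (simp add: field_simps)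
qed

text \<open>On the part of \<open>X\<close> that corresponds to the \<open>n\<close>-th block, \<open>T\<close> is bounded below, uniformly in \<open>n\<close>.\<close>

lemma T_not_finitely_strictly_singular:
  assumes d: "\<And>N. \<exists>n. N \<le> d n"
  shows "T \<notin> finitely_strictly_singular_ops X Y"
proof
  define \<epsilon> where "\<epsilon> = 1 / (C * C')"
  have "\<epsilon> > 0" using X.C_pos Y.C_pos by (simp add: \<epsilon>_def)
  moreover assume "T \<in> finitely_strictly_singular_ops X Y"
  ultimately obtain N where N: "\<And>Z. complex_vector.subspace Z \<Longrightarrow> Z \<subseteq> pts X \<Longrightarrow>
      \<not> fin_dim Z \<or> N \<le> complex_vector.dim Z \<Longrightarrow> \<exists>x\<in>Z. nm X x = 1 \<and> nm Y (T x) < \<epsilon>"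
    unfolding finitely_strictly_singular_ops_def by force
  obtain n where n: "N \<le> d n" using d by blast
  define v where "v i = J (unit_block n i)" for i
  define W where "W = J ` one_block d n"
  define Z where "Z = complex_vector.span (v ` {..<d n})"
  note ell = one_block_ell(1)[OF _ X.a_pos]
  have W: "complex_vector.subspace W"
    unfolding complex_vector.subspace_def
  proof (intro conjI ballI allI)
    have "(\<lambda>_ _. 0) \<in> one_block d n" by (simp add: one_block_def)
    moreover from this have "J (\<lambda>_ _. 0) = 0" using X.J_scale[OF ell, of "\<lambda>_ _. 0" n 0] by simp
    ultimately show "0 \<in> W" unfolding W_def by (metis image_eqI)
    fix x assume "x \<in> W"
    then obtain c where c: "c \<in> one_block d n" "x = J c" by (auto simp: W_def)
    have "(\<lambda>n i. k * c n i) \<in> one_block d n" for k using c by (simp add: one_block_def)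
    then show "k *\<^sub>C x \<in> W" for k
      unfolding W_def c(2) by (rule image_eqI[where f = J, OF X.J_scale[OF ell[OF c(1)], symmetric]])
    fix y assume "y \<in> W"
    then obtain c' where c': "c' \<in> one_block d n" "y = J c'" by (auto simp: W_def)
    have "(\<lambda>n i. c n i + c' n i) \<in> one_block d n" using c c' by (simp add: one_block_def)
    then show "x + y \<in> W"
      unfolding W_def c(2) c'(2)
      by (rule image_eqI[where f = J, OF X.J_add[OF ell[OF c(1)] ell[OF c'(1)], symmetric]])
  qed
  have "v i \<in> W" if "i < d n" for i
    using unit_block_one_block[of i d n, OF that] by (simp add: v_def W_def)
  then have ZW: "Z \<subseteq> W" unfolding Z_def by (intro complex_vector.span_minimal W) auto
  have Wp: "W \<subseteq> pts X" by (auto simp: W_def intro: X.J_pts ell)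
  have Qv: "Q (v i) = unit_block n i" if "i < d n" for i
    unfolding v_def by (intro X.Q_J ell[OF unit_block_one_block[of i d n, OF that]])
  have inj: "inj_on v {..<d n}"
    by (rule inj_onI) (metis Qv lessThan_iff unit_block_def zero_neq_one)
  have vp: "v i \<in> pts X" if "i < d n" for i
    unfolding v_def by (intro X.J_pts ell[OF unit_block_one_block[of i d n, OF that]])
  have "complex_vector.independent (v ` {..<d n})"
  proof (rule complex_vector.independent_if_scalars_zero)
    fix f x assume 0: "(\<Sum>x\<in>v ` {..<d n}. f x *\<^sub>C x) = 0" and "x \<in> v ` {..<d n}"
    then obtain j where j: "x = v j" "j < d n" by auto
    have sum: "(\<Sum>i\<in>I. f (v i) *\<^sub>C v i) \<in> pts X \<and>
        Q (\<Sum>i\<in>I. f (v i) *\<^sub>C v i) n j = (\<Sum>i\<in>I. f (v i) * unit_block n i n j)"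
      if "finite I" "I \<subseteq> {..<d n}" for I
      using that
    proof (induction I)
      case empty
      then show ?case using X.Q_scale[OF X.pts_zero, of 0] by (simp add: X.pts_zero)
    next
      case (insert i I)
      then show ?case
        using vp[of i] Qv[of i] by (simp add: X.pts_add X.pts_scaleC X.Q_add X.Q_scale)
    qed
    have "0 = Q (\<Sum>i<d n. f (v i) *\<^sub>C v i) n j"
      using 0 sum[of "{}"] by (simp add: sum.reindex[OF inj])
    also have "\<dots> = (\<Sum>i<d n. if i = j then f (v j) else 0)"
    proof -
      have "(\<Sum>i<d n. f (v i) * unit_block n i n j) = (\<Sum>i<d n. if i = j then f (v j) else 0)"
        by (intro sum.cong) (auto simp: unit_block_def)
      then show ?thesis using sum[of "{..<d n}"] by simp
    qed
    also have "\<dots> = f x" using j by simp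
    finally show "f x = 0" by simp
  qed simp
  then have "complex_vector.dim Z = d n"
    unfolding Z_def using inj
    by (simp add: complex_vector.dim_eq_card_independent card_image)
  then obtain x where x: "x \<in> Z" "nm X x = 1" "nm Y (T x) < \<epsilon>"
    using N[of Z] n ZW Wp by (auto simp: Z_def)
  then obtain c where c: "c \<in> one_block d n" "x = J c" using ZW by (auto simp: W_def)
  have xp: "x \<in> pts X" using x ZW Wp by auto
  have Qx: "Q x = c" using X.Q_J[OF ell[OF c(1)]] c by simp
  have "1 \<le> C * blk d c n"
    using X.J_norm[OF ell[OF c(1)]] x(2) c one_block_ell(2)[OF c(1) X.a_pos] by simp
  moreover have "Q' (T x) = c"
    using Y.Q_J[OF Q_ell_b[OF xp]] by (simp add: T_eq[OF xp] Qx)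
  then have "blk d c n \<le> C' * nm Y (T x)"
    using Y.blk_Q_le[OF bounded_ops_D(1)[OF T_bounded xp], of n] by simp
  then have "C * blk d c n \<le> C * (C' * nm Y (T x))"
    using X.C_pos by simp
  ultimately have "1 \<le> C * (C' * nm Y (T x))" by linarith
  then show False using x(3) X.C_pos Y.C_pos by (simp add: \<epsilon>_def field_simps)
qed

end

section \<open>The Lorentz--Schatten classes as normed spaces\<close>

lemma sum_consecutive_blocks:
  fixes F :: "nat \<Rightarrow> real"
  assumes "M 0 = 0" "mono (M :: nat \<Rightarrow> nat)"
  shows "(\<Sum>m<M L. F m) = (\<Sum>n<L. \<Sum>m\<in>{M n..<M (Suc n)}. F m)"
proof (induction L)
  case (Suc L)
  have "{..<M (Suc L)} = {..<M L} \<union> {M L..<M (Suc L)}"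
    using monoD[OF assms(2), of L "Suc L"] by auto
  then have "(\<Sum>m<M (Suc L). F m) = (\<Sum>m<M L. F m) + (\<Sum>m\<in>{M L..<M (Suc L)}. F m)"
    by (simp add: sum.union_disjoint ivl_disj_int)
  then show ?case using Suc by simp
qed (simp add: assms)

lemma svd_coefficient:
  assumes svd: "is_svd A s e f"
  shows "cinner (A (e k)) (f k) = of_real (s k)"
proof (cases "s k = 0")
  case False
  then have "norm (f k) = 1" using svd is_svd_nonneg[OF svd, of k] by (simp add: is_svd_def)
  then show ?thesis using svd by (simp add: is_svd_def cinner_self)
qed (use svd in \<open>simp add: is_svd_def\<close>)

locale schatten_lorentz =
  fixes w :: "nat \<Rightarrow> real" and p :: real and X :: "('h::complex_hilbert \<Rightarrow>\<^sub>L 'h) nspace"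
  assumes X_def: "X = schatten (lorentz w p)"
    and inf_dim: "\<not> fin_dim (UNIV :: 'h set)"
    and p: "1 \<le> p" and w_dec: "decseq w" and w_pos: "\<And>k. 0 < w k" and w_div: "\<not> summable w"
begin

lemma w_nonneg: "0 \<le> w k"
  using w_pos[of k] by simp

lemma svd_obtain:
  assumes "compact_clinear (A :: 'h \<Rightarrow>\<^sub>L 'h)"
  obtains e f where "is_svd A (singular_values A) e f"
  using svd_exists[OF assms inf_dim] singular_values_svd assms unfolding compact_clinear_def by metis

lemma singular_values_props:
  assumes "compact_clinear (A :: 'h \<Rightarrow>\<^sub>L 'h)"
  shows "decseq (singular_values A)" and "singular_values A \<longlonglongrightarrow> 0" and "0 \<le> singular_values A i"
proof -
  obtain e f where svd: "is_svd A (singular_values A) e f" using svd_obtain[OF assms] .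
  then show "decseq (singular_values A)" "singular_values A \<longlonglongrightarrow> 0" "0 \<le> singular_values A i"
    by (auto simp: is_svd_def is_svd_nonneg[OF svd])
qed

lemma pts_iff: "A \<in> pts X \<longleftrightarrow> compact_clinear A \<and> summable (\<lambda>k. w k * singular_values A k powr p)"
  using lorentz_decseq_iff[OF w_nonneg p singular_values_props(1,2)]
  by (auto simp: X_def schatten_def)

lemma nm_eq:
  assumes "compact_clinear A"
  shows "nm X A = (\<Sum>k. w k * singular_values A k powr p) powr (1 / p)"
  using rearr_decseq[OF singular_values_props(1,3)[OF assms]]
  by (simp add: X_def schatten_def lorentz_def lorentz_norm_def)

lemma nm_powr:
  assumes "A \<in> pts X"
  shows "nm X A powr p = (\<Sum>k. w k * singular_values A k powr p)"
proof -
  have "0 \<le> (\<Sum>k. w k * singular_values A k powr p)"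
    using assms w_nonneg by (intro suminf_nonneg) (auto simp: pts_iff)
  then show ?thesis using assms p by (simp add: pts_iff nm_eq powr_powr)
qed

lemma nm_ge_0: "A \<in> pts X \<Longrightarrow> 0 \<le> nm X A"
  by (simp add: pts_iff nm_eq)

lemma coefficients_le_nm:
  assumes "A \<in> pts X" "ortho_fam x" "ortho_fam y"
  shows "(\<Sum>k<K. w k * cmod (cinner (A (x k)) (y k)) powr p) \<le> nm X A powr p"
proof -
  obtain e f where "is_svd A (singular_values A) e f" using svd_obtain assms(1) pts_iff by blast
  from matrix_coefficients_le_singular_values[OF this assms(2,3) w_dec w_nonneg p]
  show ?thesis using assms(1) by (simp add: nm_powr pts_iff)
qed

text \<open>To bound the norm, it suffices to bound the diagonal coefficients in one pair of singular systems. Together with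
  \<open>coefficients_le_nm\<close>, this replaces the computation of the singular values of sums and multiples.\<close>

lemma singular_values_le_coefficients:
  fixes A :: "'h \<Rightarrow>\<^sub>L 'h"
  assumes A: "compact_clinear A" and R: "0 \<le> R"
    and le: "\<And>e f K. is_svd A (singular_values A) e f \<Longrightarrow>
      (\<Sum>k<K. w k * cmod (cinner (A (e k)) (f k)) powr p) \<le> R powr p"
  shows "A \<in> pts X" and "nm X A \<le> R"
proof -
  obtain e f where svd: "is_svd A (singular_values A) e f" using svd_obtain[OF A] .
  have "cmod (cinner (A (e k)) (f k)) = singular_values A k" for k
    using svd_coefficient[OF svd] is_svd_nonneg[OF svd] by simp
  then have bd: "(\<Sum>k<K. w k * singular_values A k powr p) \<le> R powr p" for K
    using le[OF svd, of K] by simp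
  have sm: "summable (\<lambda>k. w k * singular_values A k powr p)"
    by (rule summableI_nonneg_bounded[where x = "R powr p"]) (use bd w_nonneg in auto)
  then show pts: "A \<in> pts X" by (simp add: pts_iff A)
  have "(\<Sum>k. w k * singular_values A k powr p) powr (1 / p) \<le> (R powr p) powr (1 / p)"
    using p w_nonneg by (intro powr_mono2[OF _ _ suminf_le_const[OF sm bd]] suminf_nonneg sm) auto
  also have "\<dots> = R" using p R by (simp add: powr_powr)
  finally show "nm X A \<le> R" by (simp add: nm_eq[OF A])
qed

sublocale nspace_norm X
proof
  have ef: "ortho_fam e" "ortho_fam f" if "is_svd A s e f" for A :: "'h \<Rightarrow>\<^sub>L 'h" and s e f
    using that by (auto simp: is_svd_def)
  show "0 \<in> pts X"
    by (rule singular_values_le_coefficients[OF compact_clinear_zero order_refl]) (use p in simp)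
  show nn: "0 \<le> nm X A" if "A \<in> pts X" for A using nm_ge_0[OF that] .
  show "A = 0" if A: "A \<in> pts X" and 0: "nm X A = 0" for A
  proof -
    obtain e f where svd: "is_svd A (singular_values A) e f" using svd_obtain A pts_iff by blast
    have sm: "summable (\<lambda>k. w k * singular_values A k powr p)" using A by (simp add: pts_iff)
    have "(\<Sum>k. w k * singular_values A k powr p) = 0"
      using nm_powr[OF A] 0 p by simp
    then have "w k * singular_values A k powr p = 0" for k
      using suminf_eq_zero_iff[OF sm] w_nonneg by simp
    then have s0: "singular_values A k = 0" for k using w_pos[of k] by (metis less_irrefl mult_eq_0_iff powr_eq_0_iff)
    have "A x = 0" for x
      using svd sums_unique2[of "\<lambda>_. 0" "A x" 0] by (simp add: is_svd_def s0)
    then show "A = 0" by (intro blinfun_eqI) simp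
  qed
  have add: "A + B \<in> pts X \<and> nm X (A + B) \<le> nm X A + nm X B" if A: "A \<in> pts X" and B: "B \<in> pts X" for A B
  proof -
    have c: "compact_clinear (A + B)" using A B by (simp add: pts_iff compact_clinear_add)
    have "(\<Sum>k<K. w k * cmod (cinner ((A + B) (e k)) (f k)) powr p) \<le> (nm X A + nm X B) powr p"
      if "is_svd (A + B) (singular_values (A + B)) e f" for e f K
    proof -
      have "(\<Sum>k<K. w k * cmod (cinner ((A + B) (e k)) (f k)) powr p) \<le>
          (\<Sum>k<K. w k * (cmod (cinner (A (e k)) (f k)) + cmod (cinner (B (e k)) (f k))) powr p)"
        using w_nonneg p
        by (intro sum_mono mult_left_mono powr_mono2) (auto simp: blinfun.add_left norm_triangle_ineq)
      also have "\<dots> \<le> (nm X A + nm X B) powr p"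
        by (rule weighted_minkowski[OF w_pos p _ _ nn[OF A] _ nn[OF B]])
          (auto intro: coefficients_le_nm A B ef[OF that])
      finally show ?thesis .
    qed
    from singular_values_le_coefficients[OF c add_nonneg_nonneg[OF nn[OF A] nn[OF B]] this]
    show ?thesis by blast
  qed
  show "A + B \<in> pts X" "nm X (A + B) \<le> nm X A + nm X B" if "A \<in> pts X" "B \<in> pts X" for A B
    using add[OF that] by auto
  have scale: "c *\<^sub>C A \<in> pts X \<and> nm X (c *\<^sub>C A) \<le> cmod c * nm X A" if A: "A \<in> pts X" for c A
  proof -
    have comp: "compact_clinear (c *\<^sub>C A)" using A by (simp add: pts_iff compact_clinear_scaleC)
    have "(\<Sum>k<K. w k * cmod (cinner ((c *\<^sub>C A) (e k)) (f k)) powr p) \<le> (cmod c * nm X A) powr p"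
      if "is_svd (c *\<^sub>C A) (singular_values (c *\<^sub>C A)) e f" for e f K
    proof -
      have "(\<Sum>k<K. w k * cmod (cinner ((c *\<^sub>C A) (e k)) (f k)) powr p) =
          cmod c powr p * (\<Sum>k<K. w k * cmod (cinner (A (e k)) (f k)) powr p)"
        by (simp add: scaleC_blinfun.rep_eq norm_mult powr_mult sum_distrib_left mult_ac)
      also have "\<dots> \<le> cmod c powr p * nm X A powr p"
        by (intro mult_left_mono coefficients_le_nm A ef[OF that]) auto
      also have "\<dots> = (cmod c * nm X A) powr p"
        using nn[OF A] by (simp add: powr_mult)
      finally show ?thesis .
    qed
    from singular_values_le_coefficients[OF comp mult_nonneg_nonneg[OF norm_ge_zero nn[OF A]] this]
    show ?thesis by blast
  qed
  show "c *\<^sub>C A \<in> pts X" if "A \<in> pts X" for c A using scale[OF that] by blast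
  show "nm X (c *\<^sub>C A) = cmod c * nm X A" if A: "A \<in> pts X" for c A
  proof (cases "c = 0")
    case True
    then show ?thesis using scale[OF A, of 0] nn[of "0 *\<^sub>C A"] by simp
  next
    case False
    have "A = inverse c *\<^sub>C (c *\<^sub>C A)" using False by simp
    then have "nm X A \<le> cmod (inverse c) * nm X (c *\<^sub>C A)"
      using scale[of "c *\<^sub>C A" "inverse c"] scale[OF A] by metis
    then have "cmod c * nm X A \<le> nm X (c *\<^sub>C A)"
      using False unfolding norm_inverse by (simp add: field_simps)
    then show ?thesis using scale[OF A, of c] by linarith
  qed
qed

text \<open>A finite section of the sum defining the norm of \<open>A\<close> involves finitely many matrix coefficients,
  and does not change if an operator on which these coefficients vanish is subtracted.\<close>

lemma finitely_many_functionals_almost_norm: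
  assumes A: "A \<in> pts X" and \<delta>: "\<delta> > 0"
  shows "\<exists>\<Phi>. finite \<Phi> \<and> (\<forall>\<phi>\<in>\<Phi>. lin_on (pts X) \<phi>) \<and>
      (\<forall>B\<in>pts X. (\<forall>\<phi>\<in>\<Phi>. \<phi> B = 0) \<longrightarrow> nm X A \<le> nm X (A - B) + \<delta>)"
proof -
  obtain e f where svd: "is_svd A (singular_values A) e f" using svd_obtain A pts_iff by blast
  have ef: "ortho_fam e" "ortho_fam f" using svd by (auto simp: is_svd_def)
  have sm: "summable (\<lambda>k. w k * singular_values A k powr p)" using A by (simp add: pts_iff)
  define S where "S K = (\<Sum>k<K. w k * singular_values A k powr p)" for K
  have "(\<lambda>K. S K powr (1 / p)) \<longlonglongrightarrow> (\<Sum>k. w k * singular_values A k powr p) powr (1 / p)"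
    unfolding S_def
    by (rule tendsto_powr'[OF summable_LIMSEQ[OF sm] tendsto_const])
      (use p w_nonneg in \<open>auto intro!: always_eventually sum_nonneg\<close>)
  also have "(\<Sum>k. w k * singular_values A k powr p) powr (1 / p) = nm X A"
    using A by (simp add: nm_eq pts_iff)
  finally have "\<forall>\<^sub>F K in sequentially. nm X A - \<delta> < S K powr (1 / p)"
    using \<delta> by (intro order_tendstoD) auto
  then obtain K where K: "nm X A - \<delta> < S K powr (1 / p)"
    unfolding eventually_sequentially by blast
  define \<Phi> where "\<Phi> = (\<lambda>k B. cinner (blinfun_apply B (e k)) (f k)) ` {..<K}"
  have "nm X A \<le> nm X (A - B) + \<delta>" if B: "B \<in> pts X" and 0: "\<forall>\<phi>\<in>\<Phi>. \<phi> B = 0" for B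
  proof -
    have "cmod (cinner ((A - B) (e k)) (f k)) = singular_values A k" if "k < K" for k
    proof -
      have "cinner (B (e k)) (f k) = 0" using 0 that by (auto simp: \<Phi>_def)
      then have "cinner ((A - B) (e k)) (f k) = of_real (singular_values A k)"
        by (simp add: blinfun.diff_left svd_coefficient[OF svd])
      then show ?thesis using is_svd_nonneg[OF svd, of k] by simp
    qed
    then have "S K \<le> nm X (A - B) powr p"
      using coefficients_le_nm[OF pts_diff[OF A B] ef, of K] by (simp add: S_def)
    then have "S K powr (1 / p) \<le> (nm X (A - B) powr p) powr (1 / p)"
      by (rule powr_mono2[rotated 2]) (use p w_nonneg in \<open>auto simp: S_def intro!: sum_nonneg\<close>)
    also have "\<dots> = nm X (A - B)"
      using p nm_nonneg[OF pts_diff[OF A B]] by (simp add: powr_powr)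
    finally show ?thesis using K by simp
  qed
  moreover have "finite \<Phi>" "\<forall>\<phi>\<in>\<Phi>. lin_on (pts X) \<phi>"
    by (auto simp: \<Phi>_def lin_on_def blinfun.add_left scaleC_blinfun.rep_eq)
  ultimately show ?thesis by blast
qed

section \<open>Diagonal operators in the Lorentz--Schatten classes\<close>

lemma diag_op_compact:
  fixes x g :: "nat \<Rightarrow> 'h"
  assumes x: "ortho_fam x" and g: "\<And>i j. i \<noteq> j \<Longrightarrow> cinner (g i) (g j) = 0" "(\<lambda>m. norm (g m)) \<longlonglongrightarrow> 0"
  shows "compact_clinear (diag_op x g)"
proof -
  obtain C where C: "\<And>m. norm (g m) \<le> C"
    using g(2) by (metis BseqE convergentI convergent_imp_Bseq real_norm_def abs_of_nonneg norm_ge_zero)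
  note sums = diag_op_sums[OF x g(1) C] and lin = diag_op_scaleC[OF x g(1) C]
  show ?thesis
  proof (rule compact_clinear_approx)
    fix \<epsilon> :: real assume \<epsilon>: "\<epsilon> > 0"
    obtain M where M: "\<And>m. m \<ge> M \<Longrightarrow> norm (g m) < \<epsilon>"
      using order_tendstoD(2)[OF g(2) \<epsilon>] unfolding eventually_sequentially by blast
    define h where "h m = (if m < M then 0 else g m)" for m
    have h: "cinner (h i) (h j) = 0" if "i \<noteq> j" for i j using g(1)[OF that] by (simp add: h_def)
    have hn: "norm (h m) \<le> \<epsilon>" for m using M[of m] \<epsilon> by (cases "m < M") (auto simp: h_def intro: less_imp_le)
    have "\<exists>B. compact_clinear B \<and> (\<forall>z. B z = (\<Sum>m<k. cinner z (x m) *\<^sub>C g m))" for k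
    proof (induction k)
      case 0
      show ?case by (rule exI[of _ 0]) (simp add: compact_clinear_zero)
    next
      case (Suc k)
      then obtain B where B: "compact_clinear B" "\<And>z. B z = (\<Sum>m<k. cinner z (x m) *\<^sub>C g m)" by blast
      have bl: "bounded_linear (\<lambda>z. cinner z (x k) *\<^sub>C g k)"
        by (rule bounded_linear_intro[where K = "norm (x k) * norm (g k)"])
          (auto simp: scaleC_add_left scaleR_scaleC norm_scaleC cauchy_schwarz mult_right_mono simp flip: mult.assoc)
      define R where "R = Blinfun (\<lambda>z. cinner z (x k) *\<^sub>C g k)"
      have R: "R z = cinner z (x k) *\<^sub>C g k" for z
        unfolding R_def by (simp add: bounded_linear_Blinfun_apply[OF bl])
      have "compact_clinear (B + R)"
        using B(1) compact_clinear_rank_one[OF R] by (rule compact_clinear_add)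
      then show ?case by (intro exI[of _ "B + R"]) (simp add: blinfun.add_left B(2) R)
    qed
    then obtain B where B: "compact_clinear B" "\<And>z. B z = (\<Sum>m<M. cinner z (x m) *\<^sub>C g m)" by blast
    have "norm (diag_op x g z - B z) \<le> \<epsilon> * norm z" for z
    proof -
      have "(\<lambda>m. cinner z (x m) *\<^sub>C h m) sums (diag_op x g z - B z)"
      proof -
        have "(\<lambda>m. if m < M then cinner z (x m) *\<^sub>C g m else 0) sums B z"
          using sums_If_finite_set[of "{..<M}" "\<lambda>m. cinner z (x m) *\<^sub>C g m"] by (simp add: B(2))
        from sums_diff[OF sums this]
        have "(\<lambda>m. cinner z (x m) *\<^sub>C g m - (if m < M then cinner z (x m) *\<^sub>C g m else 0))
            sums (diag_op x g z - B z)" .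
        also have "(\<lambda>m. cinner z (x m) *\<^sub>C g m - (if m < M then cinner z (x m) *\<^sub>C g m else 0)) =
            (\<lambda>m. cinner z (x m) *\<^sub>C h m)"
          by (auto simp: h_def)
        finally show ?thesis .
      qed
      then have "diag_op x g z - B z = diag_op x h z"
        by (rule sums_unique2[OF _ diag_op_sums[OF x h hn]])
      then show ?thesis using norm_diag_op[OF x h hn] by simp
    qed
    then show "\<exists>B. compact_clinear B \<and> (\<forall>z. norm (diag_op x g z - B z) \<le> \<epsilon> * norm z)"
      using B(1) by blast
  qed (rule lin)
qed

text \<open>The upper \<open>p\<close>-estimate for block diagonal operators. The index \<open>m\<close> of the \<open>n\<close>-th block runs
  through \<open>{M n..<M (Suc n)}\<close>, and the norm of a diagonal operator supported on this block, with
  constant entry \<open>b n\<close>, is \<open>b n * (sum w {..<M (Suc n) - M n}) powr (1 / p)\<close>.\<close>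

lemma block_diag_op:
  fixes x g :: "nat \<Rightarrow> 'h"
  assumes x: "ortho_fam x" and g: "\<And>i j. i \<noteq> j \<Longrightarrow> cinner (g i) (g j) = 0" "(\<lambda>m. norm (g m)) \<longlonglongrightarrow> 0"
    and M: "M 0 = 0" "strict_mono (M :: nat \<Rightarrow> nat)"
    and gb: "\<And>n m. M n \<le> m \<Longrightarrow> m < M (Suc n) \<Longrightarrow> norm (g m) \<le> b n"
    and b: "\<And>n. 0 \<le> b n" "summable (\<lambda>n. b n powr p * sum w {..<M (Suc n) - M n})"
  shows "diag_op x g \<in> pts X"
    and "nm X (diag_op x g) \<le> (\<Sum>n. b n powr p * sum w {..<M (Suc n) - M n}) powr (1 / p)"
proof -
  define R where "R = (\<Sum>n. b n powr p * sum w {..<M (Suc n) - M n})"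
  have term0: "0 \<le> b n powr p * sum w {..<M (Suc n) - M n}" for n
    using w_nonneg by (intro mult_nonneg_nonneg sum_nonneg) auto
  have R0: "0 \<le> R" unfolding R_def by (rule suminf_nonneg[OF b(2) term0])
  have comp: "compact_clinear (diag_op x g)" by (rule diag_op_compact[OF x g])
  obtain C where C: "\<And>m. norm (g m) \<le> C"
    using g(2) by (metis BseqE convergentI convergent_imp_Bseq real_norm_def abs_of_nonneg norm_ge_zero)
  define u where "u m = inverse (norm (g m)) *\<^sub>R g m" for m
  have gu: "g m = norm (g m) *\<^sub>R u m" for m by (cases "g m = 0") (simp_all add: u_def)
  have u: "ortho_fam u"
    unfolding ortho_fam_def
  proof (intro conjI allI impI)
    show "norm (u m) \<le> 1" for m by (cases "g m = 0") (simp_all add: u_def)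
  qed (simp add: u_def g(1))
  note blocks = sum_consecutive_blocks[OF M(1) strict_mono_mono[OF M(2)]]
  have main: "(\<Sum>k<K. w k * cmod (cinner (diag_op x g (e k)) (f k)) powr p) \<le> R"
    if e: "ortho_fam e" and f: "ortho_fam f" for e f K
  proof -
    define c where "c k n = (\<Sum>m<n. cinner (e k) (x m) * cinner (g m) (f k))" for k n
    define \<theta> where "\<theta> k m = cmod (cinner (e k) (x m)) * cmod (cinner (u m) (f k))" for k m
    have n: "norm (x k) \<le> 1" "norm (u k) \<le> 1" "norm (e k) \<le> 1" "norm (f k) \<le> 1" for k
      using x u e f by (auto simp: ortho_fam_def)
    have \<theta>0: "0 \<le> \<theta> k m" for k m by (simp add: \<theta>_def)
    have row: "(\<Sum>m\<in>I. \<theta> k m) \<le> 1" for k I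
      unfolding \<theta>_def by (rule ortho_fam_product_sum_le[OF x u]) (use n in auto)
    have col: "(\<Sum>k<K. \<theta> k m) \<le> 1" for m K
      using ortho_fam_product_sum_le[OF e f, of "x m" "u m" "{..<K}"] n
      by (simp add: \<theta>_def cmod_cinner_commute[of "x m"] cmod_cinner_commute[of _ "u m"])
    have c: "(\<lambda>L. c k (M L)) \<longlonglongrightarrow> cinner (diag_op x g (e k)) (f k)" for k
    proof -
      have "(\<lambda>m. cinner (e k) (x m) *\<^sub>C g m) sums diag_op x g (e k)"
        by (rule diag_op_sums[OF x g(1) C])
      from bounded_linear.sums[OF bounded_linear_cinner_left this]
      have "(\<lambda>n. c k n) \<longlonglongrightarrow> cinner (diag_op x g (e k)) (f k)"
        unfolding sums_def c_def by simp
      from LIMSEQ_subseq_LIMSEQ[OF this M(2)] show ?thesis by (simp add: o_def)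
    qed
    show ?thesis
    proof (rule LIMSEQ_le_const2)
      show "(\<lambda>L. \<Sum>k<K. w k * cmod (c k (M L)) powr p) \<longlonglongrightarrow>
          (\<Sum>k<K. w k * cmod (cinner (diag_op x g (e k)) (f k)) powr p)"
        using p by (intro tendsto_sum tendsto_mult tendsto_const tendsto_powr' tendsto_norm c) auto
      have "(\<Sum>k<K. w k * cmod (c k (M L)) powr p) \<le> R" for L
      proof -
        have cle: "cmod (c k (M L)) \<le> (\<Sum>m<M L. \<theta> k m * norm (g m))" for k
        proof -
          have "cmod (c k (M L)) \<le> (\<Sum>m<M L. cmod (cinner (e k) (x m) * cinner (g m) (f k)))"
            unfolding c_def by (rule norm_sum)
          also have "\<dots> = (\<Sum>m<M L. \<theta> k m * norm (g m))"
            by (intro sum.cong refl, subst gu) (simp add: norm_mult \<theta>_def)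
          finally show ?thesis .
        qed
        have "(\<Sum>k<K. w k * cmod (c k (M L)) powr p) \<le> (\<Sum>k<K. w k * (\<Sum>m<M L. \<theta> k m * norm (g m) powr p))"
        proof (intro sum_mono mult_left_mono w_nonneg)
          fix k
          have "cmod (c k (M L)) powr p \<le> (\<Sum>m<M L. \<theta> k m * norm (g m)) powr p"
            using p by (intro powr_mono2 cle) auto
          also have "\<dots> \<le> (\<Sum>m<M L. \<theta> k m * norm (g m) powr p)"
            by (rule jensen_substochastic) (use \<theta>0 row p in auto)
          finally show "cmod (c k (M L)) powr p \<le> (\<Sum>m<M L. \<theta> k m * norm (g m) powr p)" .
        qed
        also have "\<dots> = (\<Sum>m<M L. norm (g m) powr p * (\<Sum>k<K. w k * \<theta> k m))"
          unfolding sum_distrib_left by (subst sum.swap) (simp add: mult_ac)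
        also have "\<dots> = (\<Sum>n<L. \<Sum>m\<in>{M n..<M (Suc n)}. norm (g m) powr p * (\<Sum>k<K. w k * \<theta> k m))"
          by (rule blocks)
        also have "\<dots> \<le> (\<Sum>n<L. b n powr p * sum w {..<M (Suc n) - M n})"
        proof (rule sum_mono)
          fix n
          have "(\<Sum>m\<in>{M n..<M (Suc n)}. norm (g m) powr p * (\<Sum>k<K. w k * \<theta> k m)) \<le>
              (\<Sum>m\<in>{M n..<M (Suc n)}. b n powr p * (\<Sum>k<K. w k * \<theta> k m))"
            using p gb w_nonneg \<theta>0
            by (intro sum_mono mult_right_mono powr_mono2 sum_nonneg mult_nonneg_nonneg) auto
          also have "\<dots> = b n powr p * (\<Sum>k<K. w k * (\<Sum>m\<in>{M n..<M (Suc n)}. \<theta> k m))"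
            unfolding sum_distrib_left by (subst sum.swap) simp
          also have "\<dots> \<le> b n powr p * sum w {..<M (Suc n) - M n}"
          proof (intro mult_left_mono sum_weighted_le_initial w_dec w_nonneg)
            have "(\<Sum>k<K. \<Sum>m\<in>{M n..<M (Suc n)}. \<theta> k m) = (\<Sum>m\<in>{M n..<M (Suc n)}. \<Sum>k<K. \<theta> k m)"
              by (rule sum.swap)
            also have "\<dots> \<le> (\<Sum>m\<in>{M n..<M (Suc n)}. 1)" by (intro sum_mono col)
            finally show "(\<Sum>k<K. \<Sum>m\<in>{M n..<M (Suc n)}. \<theta> k m) \<le> real (M (Suc n) - M n)" by simp
          qed (use \<theta>0 row in \<open>auto intro: sum_nonneg\<close>)
          finally show "(\<Sum>m\<in>{M n..<M (Suc n)}. norm (g m) powr p * (\<Sum>k<K. w k * \<theta> k m)) \<le>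
            b n powr p * sum w {..<M (Suc n) - M n}" .
        qed
        also have "\<dots> \<le> R"
          unfolding R_def by (rule sum_le_suminf[OF b(2)]) (use term0 in auto)
        finally show ?thesis .
      qed
      then show "\<exists>N. \<forall>L\<ge>N. (\<Sum>k<K. w k * cmod (c k (M L)) powr p) \<le> R" by blast
    qed
  qed
  have "(\<Sum>k<K. w k * cmod (cinner (diag_op x g (e k)) (f k)) powr p) \<le> (R powr (1 / p)) powr p"
    if "is_svd (diag_op x g) (singular_values (diag_op x g)) e f" for e f K
  proof -
    have "ortho_fam e" "ortho_fam f" using that by (auto simp: is_svd_def)
    from main[OF this, of K] show ?thesis using R0 p by (simp add: powr_powr)
  qed
  from singular_values_le_coefficients[OF comp powr_ge_zero this]
  show "diag_op x g \<in> pts X" "nm X (diag_op x g) \<le> R powr (1 / p)" by auto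
qed

end

section \<open>Complemented mixed subspaces of the Lorentz--Schatten classes\<close>

lemma diag_op_add:
  assumes x: "ortho_fam x"
    and g: "\<And>i j. i \<noteq> j \<Longrightarrow> cinner (g i) (g j) = 0" "\<And>i. norm (g i) \<le> C"
    and h: "\<And>i j. i \<noteq> j \<Longrightarrow> cinner (h i) (h j) = 0" "\<And>i. norm (h i) \<le> D"
    and gh: "\<And>i j. i \<noteq> j \<Longrightarrow> cinner (g i) (h j) = 0"
  shows "diag_op x (\<lambda>i. g i + h i) = diag_op x g + diag_op x h"
proof (rule blinfun_eqI)
  fix z
  have hg: "cinner (h i) (g j) = 0" if "i \<noteq> j" for i j
    using gh[of j i] that cinner_commute[of "h i" "g j"] by simp
  have "norm (g i + h i) \<le> C + D" for i
    using norm_triangle_ineq[of "g i" "h i"] g(2)[of i] h(2)[of i] by simp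
  from diag_op_sums[where g = "\<lambda>i. g i + h i" and z = z, OF x _ this]
  have "(\<lambda>m. cinner z (x m) *\<^sub>C (g m + h m)) sums diag_op x (\<lambda>i. g i + h i) z"
    by (simp add: g(1) h(1) gh hg)
  moreover have "(\<lambda>m. cinner z (x m) *\<^sub>C (g m + h m)) sums (diag_op x g z + diag_op x h z)"
    using sums_add[OF diag_op_sums[where z = z, OF x g] diag_op_sums[where z = z, OF x h]] by (simp add: scaleC_add_right)
  ultimately show "diag_op x (\<lambda>i. g i + h i) z = (diag_op x g + diag_op x h) z"
    by (simp add: sums_unique2 blinfun.add_left)
qed

lemma diag_op_scale:
  assumes x: "ortho_fam x"
    and g: "\<And>i j. i \<noteq> j \<Longrightarrow> cinner (g i) (g j) = 0" "\<And>i. norm (g i) \<le> C"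
  shows "diag_op x (\<lambda>i. k *\<^sub>C g i) = k *\<^sub>C diag_op x g"
proof (rule blinfun_eqI)
  fix z
  have "norm (k *\<^sub>C g i) \<le> cmod k * C" for i
    using g(2)[of i] by (simp add: norm_scaleC mult_left_mono)
  from diag_op_sums[where g = "\<lambda>i. k *\<^sub>C g i" and z = z, OF x _ this]
  have "(\<lambda>m. cinner z (x m) *\<^sub>C (k *\<^sub>C g m)) sums diag_op x (\<lambda>i. k *\<^sub>C g i) z"
    by (simp add: g(1))
  moreover have "(\<lambda>m. k *\<^sub>C (cinner z (x m) *\<^sub>C g m)) sums (k *\<^sub>C diag_op x g z)"
    by (rule bounded_linear.sums[OF bounded_linear_scaleC diag_op_sums[OF x g]])
  then have "(\<lambda>m. cinner z (x m) *\<^sub>C (k *\<^sub>C g m)) sums (k *\<^sub>C diag_op x g z)"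
    by (simp add: mult.commute)
  ultimately show "diag_op x (\<lambda>i. k *\<^sub>C g i) z = (k *\<^sub>C diag_op x g) z"
    by (simp add: sums_unique2 scaleC_blinfun.rep_eq)
qed

text \<open>An orthonormal sequence \<open>u\<close>, also used as a doubly indexed orthonormal family. The vector
  \<open>bvec d c n m\<close> is a copy of the \<open>n\<close>-th block of \<open>c\<close>; different \<open>m\<close> give orthogonal copies.\<close>

locale orthonormal_sequence =
  fixes u :: "nat \<Rightarrow> 'h::complex_hilbert"
  assumes u: "ortho_fam u" "\<And>i. norm (u i) = 1"
begin

definition u2 :: "nat \<Rightarrow> nat \<Rightarrow> 'h" where
  "u2 i m = u (prod_encode (i, m))"

definition bvec :: "(nat \<Rightarrow> nat) \<Rightarrow> (nat \<Rightarrow> nat \<Rightarrow> complex) \<Rightarrow> nat \<Rightarrow> nat \<Rightarrow> 'h" where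
  "bvec d c n m = (\<Sum>i<d n. c n i *\<^sub>C u2 i m)"

lemma cinner_u: "cinner (u i) (u j) = (if i = j then 1 else 0)"
  using u by (auto simp: ortho_fam_def cinner_self)

lemma cinner_u2: "cinner (u2 i m) (u2 j k) = (if i = j \<and> m = k then 1 else 0)"
  by (simp add: u2_def cinner_u)

lemma bvec_orthogonal: "m \<noteq> m' \<Longrightarrow> cinner (bvec d c n m) (bvec d c' n' m') = 0"
  by (simp add: bvec_def cinner_left.sum cinner_right.sum cinner_u2)

lemma bvec_coeff:
  "cinner (bvec d c n m) (u2 i k) = (if m = k \<and> i < d n then c n i else 0)"
proof -
  have "cinner (bvec d c n m) (u2 i k) = (\<Sum>j<d n. if j = i then (if m = k then c n i else 0) else 0)"
    unfolding bvec_def cinner_left.sum by (intro sum.cong) (auto simp: cinner_u2)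
  then show ?thesis by simp
qed

lemma norm_bvec: "norm (bvec d c n m) = blk d c n"
proof -
  have "(norm (bvec d c n m))\<^sup>2 = (\<Sum>i<d n. (norm (c n i *\<^sub>C u2 i m))\<^sup>2)"
    unfolding bvec_def by (rule pythagoras) (auto simp: cinner_u2)
  also have "\<dots> = (\<Sum>i<d n. (cmod (c n i))\<^sup>2)"
    by (simp add: norm_scaleC u2_def u)
  finally have "sqrt ((norm (bvec d c n m))\<^sup>2) = blk d c n"
    by (simp add: blk_def L2_set_def)
  then show ?thesis by simp
qed

lemma bvec_add: "bvec d (\<lambda>n i. c n i + c' n i) n m = bvec d c n m + bvec d c' n m"
  by (simp add: bvec_def scaleC_add_left sum.distrib)

lemma bvec_scale: "bvec d (\<lambda>n i. k * c n i) n m = k *\<^sub>C bvec d c n m"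
  by (simp add: bvec_def complex_vector.scale_sum_right)

lemma diag_op_apply:
  assumes "\<And>i j. i \<noteq> j \<Longrightarrow> cinner (g i) (g j) = 0" "\<And>i. norm (g i) \<le> C"
  shows "diag_op u g (u m) = g m"
proof -
  have "(\<lambda>k. cinner (u m) (u k) *\<^sub>C g k) = (\<lambda>k. if k = m then g k else 0)"
    by (auto simp: cinner_u)
  then show ?thesis
    using diag_op_sums[where z = "u m" and g = g, OF u(1) assms] sums_single[of m g] by (simp add: sums_unique2)
qed

end

lemma orthonormal_sequence_exists:
  assumes "\<not> fin_dim (UNIV :: 'h::complex_hilbert set)"
  obtains u :: "nat \<Rightarrow> 'h::complex_hilbert" where "orthonormal_sequence u"
  using svd_exists[OF compact_clinear_zero assms] by (auto simp: is_svd_def orthonormal_sequence_def)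

context schatten_lorentz
begin

text \<open>The rank-one operators with fixed right singular vector form a complemented Hilbert space.\<close>

lemma complemented_hilbert:
  fixes d :: "nat \<Rightarrow> nat"
  shows "\<exists>J Q C. mixed_complement X 2 d J Q C"
proof -
  obtain u :: "nat \<Rightarrow> 'h" where "orthonormal_sequence u" using orthonormal_sequence_exists[OF inf_dim] .
  then interpret orthonormal_sequence u .
  define S where "S c = (\<Sum>n. bvec d c n n)" for c
  define g where "g c m = (if m = 0 then S c else 0)" for c and m :: nat
  define J where "J c = diag_op u (g c)" for c
  define Q where "Q A n i = (if i < d n then cinner (blinfun_apply A (u 0)) (u2 i n) else 0)" for A n i
  define \<kappa> where "\<kappa> = w 0 powr (1 / p)"
  define C where "C = \<kappa> + 1 / \<kappa>"
  have \<kappa>: "\<kappa> > 0" using w_pos[of 0] by (simp add: \<kappa>_def)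
  have \<kappa>p: "\<kappa> powr p = w 0" using w_pos[of 0] p by (simp add: \<kappa>_def powr_powr)
  have g: "cinner (g c i) (g c' j) = 0" if "i \<noteq> j" for c c' i j using that by (simp add: g_def)
  have gC: "norm (g c i) \<le> norm (S c)" for c i by (simp add: g_def)
  have sq: "summable (\<lambda>n. (norm (bvec d c n n))\<^sup>2)" if "c \<in> ell 2 d" for c
    using that by (simp add: ell_def norm_bvec)
  have S: "(\<lambda>n. bvec d c n n) sums S c" "norm (S c) = ell_norm 2 d c" if c: "c \<in> ell 2 d" for c
  proof -
    have *: "summable (\<lambda>n. bvec d c n n)" "(norm (S c))\<^sup>2 = (\<Sum>n. (norm (bvec d c n n))\<^sup>2)"
      unfolding S_def by (rule orthogonal_series[OF bvec_orthogonal sq[OF c]]; assumption)+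
    then show "(\<lambda>n. bvec d c n n) sums S c" by (simp add: S_def summable_sums)
    have "norm (S c) = sqrt ((norm (S c))\<^sup>2)" by simp
    also have "\<dots> = ell_norm 2 d c"
      unfolding *(2) by (simp add: ell_norm_def norm_bvec powr_half_sqrt suminf_nonneg[OF sq[OF c, unfolded norm_bvec]])
    finally show "norm (S c) = ell_norm 2 d c" .
  qed
  have J: "J c \<in> pts X \<and> nm X (J c) \<le> \<kappa> * ell_norm 2 d c" if c: "c \<in> ell 2 d" for c
  proof -
    define b where "b n = (if n = 0 then norm (S c) else 0)" for n :: nat
    have bs: "(\<lambda>n. b n powr p * sum w {..<Suc n - n}) sums (norm (S c) powr p * w 0)"
    proof -
      have "(\<lambda>n. b n powr p * sum w {..<Suc n - n}) = (\<lambda>n. if n = 0 then norm (S c) powr p * w 0 else 0)"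
        using p by (auto simp: b_def)
      then show ?thesis using sums_single[of 0 "\<lambda>_. norm (S c) powr p * w 0"] by simp
    qed
    have "(\<lambda>m. norm (g c m)) \<longlonglongrightarrow> 0"
      by (rule tendsto_eventually, rule eventually_mono[OF eventually_gt_at_top[of 0]]) (simp add: g_def)
    note J' = block_diag_op[OF u(1) g this, where M = "\<lambda>n. n" and b = b]
    have "J c \<in> pts X" "nm X (J c) \<le> (norm (S c) powr p * w 0) powr (1 / p)"
      unfolding J_def sums_unique[OF bs]
      by (rule J'; use bs in \<open>auto simp: strict_mono_def g_def b_def sums_iff\<close>)+
    moreover have "(norm (S c) powr p * w 0) powr (1 / p) = \<kappa> * ell_norm 2 d c"
      using p w_pos[of 0] by (simp add: powr_mult powr_powr \<kappa>_def S(2)[OF c])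
    ultimately show ?thesis by simp
  qed
  have Q: "summable (\<lambda>n. blk d (Q A) n powr 2) \<and> ell_norm 2 d (Q A) \<le> 1 / \<kappa> * nm X A" if A: "A \<in> pts X" for A
  proof -
    define z where "z = A (u 0)"
    have nz: "norm z \<le> 1 / \<kappa> * nm X A"
    proof (cases "z = 0")
      case False
      define x where "x k = (if k = 0 then u 0 else 0)" for k :: nat
      define y where "y k = (if k = 0 then inverse (norm z) *\<^sub>R z else 0)" for k :: nat
      have "ortho_fam x" "ortho_fam y" using False by (auto simp: ortho_fam_def x_def y_def u)
      from coefficients_le_nm[OF A this, of 1]
      have "w 0 * cmod (cinner z (inverse (norm z) *\<^sub>R z)) powr p \<le> nm X A powr p"
        by (simp add: x_def y_def z_def del: cinner_linear)
      also have "cmod (cinner z (inverse (norm z) *\<^sub>R z)) = norm z"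
        using False by (simp add: cinner_self norm_mult norm_power norm_inverse power2_eq_square)
      finally have "(\<kappa> * norm z) powr p \<le> nm X A powr p"
        using \<kappa> \<kappa>p by (simp add: powr_mult)
      then have "\<kappa> * norm z \<le> nm X A"
        using p nm_ge_0[OF A] \<kappa> by (meson less_le_trans linorder_not_le powr_less_mono2 zero_less_one norm_ge_zero mult_nonneg_nonneg less_imp_le)
      then show ?thesis using \<kappa> by (simp add: field_simps)
    qed (use \<kappa> nm_ge_0[OF A] in simp)
    have "ortho_fam (\<lambda>(i, n). u2 i n)"
      by (auto simp: ortho_fam_def u2_def cinner_u u)
    note be = bessel[OF this, of z]
    have part: "(\<Sum>n<L. blk d (Q A) n powr 2) \<le> (norm z)\<^sup>2" for L
    proof -
      have "blk d (Q A) n powr 2 = (\<Sum>i<d n. (cmod (cinner z (u2 i n)))\<^sup>2)" for n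
        by (simp add: blk_def L2_set_def Q_def z_def sum_nonneg)
      then have "(\<Sum>n<L. blk d (Q A) n powr 2) = (\<Sum>(n, i)\<in>(SIGMA n:{..<L}. {..<d n}). (cmod (cinner z (u2 i n)))\<^sup>2)"
        by (simp add: sum.Sigma)
      also have "\<dots> = (\<Sum>(i, n)\<in>prod.swap ` (SIGMA n:{..<L}. {..<d n}). (cmod (cinner z (u2 i n)))\<^sup>2)"
        by (subst sum.reindex) (auto simp: case_prod_beta)
      also have "\<dots> \<le> (norm z)\<^sup>2"
        using be[of "prod.swap ` (SIGMA n:{..<L}. {..<d n})"] by (simp add: case_prod_beta)
      finally show ?thesis .
    qed
    have sm: "summable (\<lambda>n. blk d (Q A) n powr 2)"
      by (rule summableI_nonneg_bounded[where x = "(norm z)\<^sup>2"]) (use part in auto)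
    have "ell_norm 2 d (Q A) \<le> ((norm z)\<^sup>2) powr (1 / 2)"
      unfolding ell_norm_def using suminf_le_const[OF sm part] suminf_nonneg[OF sm] by (intro powr_mono2) auto
    also have "\<dots> = norm z" by (simp add: powr_half_sqrt)
    finally show ?thesis using sm nz by simp
  qed
  have "mixed_complement X 2 d J Q C"
  proof unfold_locales
    show "0 < C" using \<kappa> by (simp add: C_def add_pos_pos)
    show "J (\<lambda>n i. c n i + c' n i) = J c + J c'" if "c \<in> ell 2 d" "c' \<in> ell 2 d" for c c'
    proof -
      have "S (\<lambda>n i. c n i + c' n i) = S c + S c'"
        using sums_add[OF S(1)[OF that(1)] S(1)[OF that(2)]]
        by (simp add: S_def[of "\<lambda>n i. c n i + c' n i"] bvec_add sums_iff)
      then have "g (\<lambda>n i. c n i + c' n i) = (\<lambda>m. g c m + g c' m)" by (auto simp: g_def)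
      then show ?thesis unfolding J_def by (simp add: diag_op_add[OF u(1) g gC g gC g])
    qed
    show "J (\<lambda>n i. k * c n i) = k *\<^sub>C J c" if "c \<in> ell 2 d" for c k
    proof -
      have "S (\<lambda>n i. k * c n i) = k *\<^sub>C S c"
        using bounded_linear.sums[OF bounded_linear_scaleC S(1)[OF that], of k]
        by (simp add: S_def[of "\<lambda>n i. k * c n i"] bvec_scale sums_iff)
      then have "g (\<lambda>n i. k * c n i) = (\<lambda>m. k *\<^sub>C g c m)" by (auto simp: g_def)
      then show ?thesis unfolding J_def by (simp add: diag_op_scale[OF u(1) g gC])
    qed
    show "J c \<in> pts X" if "c \<in> ell 2 d" for c using J[OF that] by simp
    show "nm X (J c) \<le> C * ell_norm 2 d c" if "c \<in> ell 2 d" for c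
      using J[OF that] \<kappa> mult_right_mono[of \<kappa> C "ell_norm 2 d c"] by (simp add: C_def)
    show "Q A \<in> ell 2 d" if "A \<in> pts X" for A using Q[OF that] by (simp add: ell_def Q_def)
    show "ell_norm 2 d (Q A) \<le> C * nm X A" if "A \<in> pts X" for A
      using Q[OF that] \<kappa> mult_right_mono[of "1 / \<kappa>" C "nm X A"] nm_ge_0[OF that] by (simp add: C_def)
    show "Q (A + B) = (\<lambda>n i. Q A n i + Q B n i)" for A B
      by (intro ext) (simp add: Q_def blinfun.add_left)
    show "Q (k *\<^sub>C A) = (\<lambda>n i. k * Q A n i)" for A k
      by (intro ext) (simp add: Q_def scaleC_blinfun.rep_eq)
    show "Q (J c) = c" if c: "c \<in> ell 2 d" for c
    proof (intro ext)
      fix n i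
      show "Q (J c) n i = c n i"
      proof (cases "i < d n")
        case True
        have "J c (u 0) = S c"
          unfolding J_def by (subst diag_op_apply[OF g gC]) (simp_all add: g_def)
        moreover have "cinner (S c) (u2 i n) = c n i"
        proof -
          have "(\<lambda>k. cinner (bvec d c k k) (u2 i n)) = (\<lambda>k. if k = n then c n i else 0)"
            using True by (auto simp: bvec_coeff)
          with bounded_linear.sums[OF bounded_linear_cinner_left[where y = "u2 i n"] S(1)[OF c]]
          have "(\<lambda>k. if k = n then c n i else 0) sums cinner (S c) (u2 i n)" by simp
          then show ?thesis using sums_single[of n "\<lambda>_. c n i"] by (simp add: sums_unique2)
        qed
        ultimately show ?thesis using True by (simp add: Q_def)
      qed (use c in \<open>simp add: Q_def ell_def\<close>)
    qed
  qed simp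
  then show ?thesis by blast
qed

text \<open>The condition makes the weights of the \<open>n\<close>-th block, \<open>{M n..<M (Suc n)}\<close>, comparable to the same number
  of initial weights, so that the norm of the block hardly depends on its position.\<close>

lemma growing_blocks:
  obtains M :: "nat \<Rightarrow> nat" where "M 0 = 0" "strict_mono M" "\<And>n. sum w {..<M n} \<le> sum w {M n..<M (Suc n)}"
proof -
  have step: "\<exists>m'>m. sum w {..<m} \<le> sum w {m..<m'}" for m
  proof -
    have "\<exists>n. 2 * sum w {..<m} + 1 < sum w {..<n}"
    proof (rule ccontr)
      assume "\<nexists>n. 2 * sum w {..<m} + 1 < sum w {..<n}"
      then have "summable w"
        by (intro summableI_nonneg_bounded[where x = "2 * sum w {..<m} + 1"] w_nonneg) (auto simp: not_less)
      then show False using w_div by simp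
    qed
    then obtain n where n: "2 * sum w {..<m} + 1 < sum w {..<n}" by blast
    have "0 \<le> sum w {..<m}" using w_nonneg by (intro sum_nonneg)
    have "m < n"
    proof (rule ccontr)
      assume "\<not> m < n"
      then have "sum w {..<n} \<le> sum w {..<m}" using w_nonneg by (intro sum_mono2) auto
      then show False using n \<open>0 \<le> sum w {..<m}\<close> by linarith
    qed
    then have "sum w {..<n} = sum w {..<m} + sum w {m..<n}"
      by (simp add: sum.atLeastLessThan_concat lessThan_atLeast0)
    then show ?thesis using n \<open>m < n\<close> by (intro exI[of _ n]) auto
  qed
  have "\<exists>M. \<forall>n. (n = 0 \<longrightarrow> M n = (0::nat)) \<and> (M n < M (Suc n) \<and> sum w {..<M n} \<le> sum w {M n..<M (Suc n)})"
    by (rule dependent_nat_choice) (use step in auto)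
  then show ?thesis using that strict_mono_Suc_iff by metis
qed

text \<open>Rapidly growing blocks of constant coefficients span a copy of the sequence space with exponent
  \<open>p\<close> in the Lorentz space; replacing the coefficient of the \<open>n\<close>-th block by a vector of dimension \<open>d n\<close>
  yields the mixed space. The left inverse averages matrix coefficients with respect to the weight
  \<open>w\<close>, which makes its boundedness a consequence of Jensen's inequality.\<close>

lemma complemented_lorentz_blocks:
  fixes d :: "nat \<Rightarrow> nat"
  shows "\<exists>J Q C. mixed_complement X p d J Q C"
proof -
  obtain u :: "nat \<Rightarrow> 'h" where "orthonormal_sequence u" using orthonormal_sequence_exists[OF inf_dim] .
  then interpret orthonormal_sequence u .
  obtain M where M: "M 0 = 0" "strict_mono M" "\<And>n. sum w {..<M n} \<le> sum w {M n..<M (Suc n)}"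
    using growing_blocks by blast
  have p0: "p > 0" using p by simp
  define I where "I n = {M n..<M (Suc n)}" for n
  define W where "W n = sum w (I n)" for n
  have Ine: "I n \<noteq> {}" "finite (I n)" for n using strict_monoD[OF M(2), of n "Suc n"] by (auto simp: I_def)
  have W: "W n > 0" for n unfolding W_def using Ine w_pos by (intro sum_pos) auto
  have W2: "sum w {..<M (Suc n) - M n} \<le> 2 * W n" for n
  proof -
    have "sum w {..<M (Suc n) - M n} \<le> sum w {..<M (Suc n)}"
      using w_nonneg by (intro sum_mono2) auto
    also have "\<dots> = sum w {..<M n} + W n"
      using strict_monoD[OF M(2), of n "Suc n"]
      by (simp add: W_def I_def sum.atLeastLessThan_concat lessThan_atLeast0)
    finally show ?thesis using M(3)[of n] by (simp add: W_def I_def)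
  qed
  define \<nu> where "\<nu> m = (LEAST n. m < M (Suc n))" for m
  have \<nu>: "m \<in> I (\<nu> m)" for m
  proof -
    have "m < M (Suc m)"
      using strict_mono_imp_increasing[OF M(2), of m] strict_monoD[OF M(2), of m "Suc m"] by simp
    then have "m < M (Suc (\<nu> m))" unfolding \<nu>_def by (rule LeastI)
    moreover have "M (\<nu> m) \<le> m"
    proof (cases "\<nu> m")
      case (Suc k)
      then have "\<not> m < M (Suc k)" unfolding \<nu>_def by (metis lessI not_less_Least)
      then show ?thesis using Suc by simp
    qed (simp add: M)
    ultimately show ?thesis by (simp add: I_def)
  qed
  have \<nu>_eq: "\<nu> m = n" if "m \<in> I n" for m n
  proof (rule ccontr)
    assume "\<nu> m \<noteq> n"
    then consider "Suc (\<nu> m) \<le> n" | "Suc n \<le> \<nu> m" by linarith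
    then show False
      using that \<nu>[of m] strict_mono_mono[OF M(2)] by cases (auto simp: I_def dest!: monoD)
  qed
  \<comment> \<open>This makes the norm of a block with all entries \<open>A n\<close> lie between 1 and 2.\<close>
  define A where "A n = W n powr (- 1 / p)" for n
  have A: "A n > 0" "A n powr p = 1 / W n" for n
  proof -
    show "A n > 0" using W[of n] by (simp add: A_def)
    have "A n powr p = W n powr (- 1 / p * p)" by (simp only: A_def powr_powr)
    also have "- 1 / p * p = - 1" using p0 by simp
    finally show "A n powr p = 1 / W n" using W[of n] by (simp add: powr_minus_divide)
  qed
  define g where "g c m = A (\<nu> m) *\<^sub>R bvec d c (\<nu> m) m" for c m
  define J where "J c = diag_op u (g c)" for c
  define Q where "Q B n i = (if i < d n then of_real (W n powr (1 / p - 1)) *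
      (\<Sum>j\<in>I n. of_real (w j) * cinner (blinfun_apply B (u j)) (u2 i j)) else 0)" for B n i
  have g: "cinner (g c i) (g c' j) = 0" if "i \<noteq> j" for c c' i j
    using that by (simp add: g_def bvec_orthogonal)
  have gn: "norm (g c m) = A n * blk d c n" if "m \<in> I n" for c m n
    using A(1)[of n] \<nu>_eq[OF that] by (simp add: g_def norm_bvec)
  have bp: "(A n * blk d c n) powr p * sum w {..<M (Suc n) - M n} \<le> 2 * blk d c n powr p" for c n
  proof -
    have "(A n * blk d c n) powr p * sum w {..<M (Suc n) - M n} \<le> (A n * blk d c n) powr p * (2 * W n)"
      by (intro mult_left_mono W2) simp
    also have "\<dots> = 2 * blk d c n powr p"
      using A(1)[of n] W[of n] by (simp add: powr_mult A(2))
    finally show ?thesis .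
  qed
  have gnull: "(\<lambda>m. norm (g c m)) \<longlonglongrightarrow> 0" if c: "c \<in> ell p d" for c
  proof -
    have le: "A n * blk d c n \<le> (2 / w 0) powr (1 / p) * blk d c n" for n
    proof -
      have "w 0 = sum w {..<Suc 0}" by simp
      also have "\<dots> \<le> sum w {..<M (Suc n) - M n}"
        using strict_monoD[OF M(2), of n "Suc n"] w_nonneg by (intro sum_mono2) auto
      also have "\<dots> \<le> 2 * W n" by (rule W2)
      finally have "1 / W n \<le> 2 / w 0" using w_pos[of 0] W[of n] by (simp add: field_simps)
      then have "(1 / W n) powr (1 / p) \<le> (2 / w 0) powr (1 / p)"
        using p0 W[of n] by (intro powr_mono2) auto
      moreover have "A n = (1 / W n) powr (1 / p)"
        using W[of n] by (simp add: A_def powr_divide powr_minus_divide)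
      ultimately show ?thesis by (intro mult_right_mono) auto
    qed
    have b0: "(\<lambda>n. A n * blk d c n) \<longlonglongrightarrow> 0"
    proof (rule tendsto_sandwich[OF _ _ tendsto_const])
      show "(\<lambda>n. (2 / w 0) powr (1 / p) * blk d c n) \<longlonglongrightarrow> 0"
        by (rule tendsto_mult_right_zero[OF ell_null[OF c p0]])
      show "\<forall>\<^sub>F n in sequentially. 0 \<le> A n * blk d c n"
        using A(1) by (intro always_eventually allI mult_nonneg_nonneg) (auto intro: less_imp_le)
    qed (use le in auto)
    show ?thesis
    proof (rule LIMSEQ_I)
      fix r :: real assume "r > 0"
      then obtain N where N: "\<And>n. n \<ge> N \<Longrightarrow> A n * blk d c n < r"
        using order_tendstoD(2)[OF b0, of r] unfolding eventually_sequentially by blast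
      have "norm (norm (g c m) - 0) < r" if "m \<ge> M N" for m
      proof -
        have "M N < M (Suc (\<nu> m))" using that \<nu>[of m] by (simp add: I_def)
        then have "N \<le> \<nu> m" using strict_mono_less[OF M(2)] by simp
        then have "norm (g c m) < r" using N gn[OF \<nu>] by simp
        then show ?thesis by simp
      qed
      then show "\<exists>no. \<forall>m\<ge>no. norm (norm (g c m) - 0) < r" by blast
    qed
  qed
  have gC: "\<exists>C. \<forall>m. norm (g c m) \<le> C" if "c \<in> ell p d" for c
    using gnull[OF that] by (metis BseqE convergentI convergent_imp_Bseq real_norm_def abs_of_nonneg norm_ge_zero)
  have J: "J c \<in> pts X \<and> nm X (J c) \<le> 2 * ell_norm p d c" if c: "c \<in> ell p d" for c
  proof -
    have sm: "summable (\<lambda>n. 2 * blk d c n powr p)" using c by (simp add: ell_def summable_mult)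
    have nn: "0 \<le> (A n * blk d c n) powr p * sum w {..<M (Suc n) - M n}" for n
      using w_nonneg by (intro mult_nonneg_nonneg sum_nonneg) auto
    have sb: "summable (\<lambda>n. (A n * blk d c n) powr p * sum w {..<M (Suc n) - M n})"
      by (rule summable_comparison_test'[OF sm, where N = 0]) (use bp nn in \<open>simp add: abs_of_nonneg\<close>)
    have gb: "norm (g c m) \<le> A n * blk d c n" if "M n \<le> m" "m < M (Suc n)" for n m
      using gn[of m n] that by (simp add: I_def)
    have b: "0 \<le> A n * blk d c n" for n using A(1)[of n] by simp
    note J' = block_diag_op[OF u(1) g gnull[OF c] M(1,2) gb b sb, folded J_def]
    have "(\<Sum>n. (A n * blk d c n) powr p * sum w {..<M (Suc n) - M n}) \<le> (\<Sum>n. 2 * blk d c n powr p)"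
      by (rule suminf_le[OF bp sb sm])
    also have "\<dots> = 2 * ell_norm p d c powr p"
      unfolding ell_norm_powr[OF c p0] using c by (intro suminf_mult) (simp add: ell_def)
    finally have "(\<Sum>n. (A n * blk d c n) powr p * sum w {..<M (Suc n) - M n}) powr (1 / p)
        \<le> (2 * ell_norm p d c powr p) powr (1 / p)"
      by (rule powr_mono2[rotated 2]) (use p0 suminf_nonneg[OF sb nn] in auto)
    also have "\<dots> = 2 powr (1 / p) * ell_norm p d c"
      using p0 by (simp add: powr_mult powr_powr)
    also have "\<dots> \<le> 2 * ell_norm p d c"
      using p powr_mono[of "1 / p" 1 2] by (intro mult_right_mono) auto
    finally show ?thesis using J' by auto
  qed
  have Q: "summable (\<lambda>n. blk d (Q B) n powr p) \<and> ell_norm p d (Q B) \<le> nm X B" if B: "B \<in> pts X" for B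
  proof -
    define \<beta> where "\<beta> n = blk d (Q B) n" for n
    \<comment> \<open>Inside a block, \<open>h\<close> is chosen so that averaging the coefficients \<open>cinner (B (u j)) (h j)\<close> yields the
      norm of the block of \<open>Q B\<close>.\<close>
    define h where "h j = inverse (\<beta> (\<nu> j)) *\<^sub>R bvec d (Q B) (\<nu> j) j" for j
    define \<alpha> where "\<alpha> j = cmod (cinner (B (u j)) (h j))" for j
    have \<beta>0: "0 \<le> \<beta> n" for n by (simp add: \<beta>_def)
    have h: "ortho_fam h"
      unfolding ortho_fam_def
    proof (intro conjI allI impI)
      show "norm (h j) \<le> 1" for j
        by (cases "\<beta> (\<nu> j) = 0") (simp_all add: h_def norm_bvec \<beta>_def[symmetric] abs_of_nonneg[OF \<beta>0])
    qed (simp add: h_def bvec_orthogonal)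
    have \<beta>le: "\<beta> n powr p \<le> (\<Sum>j\<in>I n. w j * \<alpha> j powr p)" for n
    proof (cases "\<beta> n = 0")
      case True
      then show ?thesis using p0 w_nonneg by (simp add: sum_nonneg)
    next
      case False
      define q where "q i = Q B n i" for i
      define k where "k = complex_of_real (W n powr (1 / p - 1))"
      define \<sigma> where "\<sigma> = (\<Sum>j\<in>I n. of_real (w j) * cinner (B (u j)) (h j))"
      have "cinner (B (u j)) (h j) = of_real (inverse (\<beta> n)) * (\<Sum>i<d n. cnj (q i) * cinner (B (u j)) (u2 i j))"
        if "j \<in> I n" for j
        using \<nu>_eq[OF that] by (simp add: h_def bvec_def q_def cinner_right.sum)
      then have "k * \<sigma> = k * (\<Sum>j\<in>I n. of_real (w j) * (of_real (inverse (\<beta> n)) *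
          (\<Sum>i<d n. cnj (q i) * cinner (B (u j)) (u2 i j))))"
        unfolding \<sigma>_def by (intro arg_cong[of _ _ "(*) k"] sum.cong) auto
      also have "\<dots> = of_real (inverse (\<beta> n)) * (\<Sum>i<d n. cnj (q i) *
          (k * (\<Sum>j\<in>I n. of_real (w j) * cinner (B (u j)) (u2 i j))))"
        unfolding sum_distrib_left by (subst sum.swap) (simp add: mult_ac)
      also have "\<dots> = of_real (inverse (\<beta> n)) * (\<Sum>i<d n. cnj (q i) * q i)"
        by (simp add: q_def Q_def k_def)
      also have "(\<Sum>i<d n. cnj (q i) * q i) = of_real ((\<beta> n)\<^sup>2)"
      proof -
        have "(\<beta> n)\<^sup>2 = (\<Sum>i<d n. (cmod (q i))\<^sup>2)"
          by (simp add: \<beta>_def blk_def L2_set_def q_def sum_nonneg)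
        moreover have "cnj (q i) * q i = of_real ((cmod (q i))\<^sup>2)" for i
          by (simp only: complex_norm_square mult.commute)
        ultimately show ?thesis by (simp only: of_real_sum)
      qed
      finally have "k * \<sigma> = of_real (\<beta> n)" using False by (simp add: power2_eq_square)
      then have "\<beta> n = cmod (k * \<sigma>)" using \<beta>0[of n] by simp
      also have "\<dots> = W n powr (1 / p - 1) * cmod \<sigma>" by (simp add: norm_mult k_def)
      also have "\<dots> \<le> W n powr (1 / p - 1) * (\<Sum>j\<in>I n. w j * \<alpha> j)"
        unfolding \<sigma>_def using w_nonneg
        by (intro mult_left_mono order_trans[OF norm_sum]) (auto simp: norm_mult \<alpha>_def)
      also have "(\<Sum>j\<in>I n. w j * \<alpha> j) = W n * (\<Sum>j\<in>I n. w j / W n * \<alpha> j)"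
        using W[of n] by (simp add: sum_distrib_left)
      also have "W n powr (1 / p - 1) * (W n * (\<Sum>j\<in>I n. w j / W n * \<alpha> j)) =
          W n powr (1 / p) * (\<Sum>j\<in>I n. w j / W n * \<alpha> j)"
        using W[of n] by (simp add: powr_diff)
      finally have "\<beta> n powr p \<le> (W n powr (1 / p) * (\<Sum>j\<in>I n. w j / W n * \<alpha> j)) powr p"
        using p0 \<beta>0 by (intro powr_mono2) auto
      also have "\<dots> = W n * (\<Sum>j\<in>I n. w j / W n * \<alpha> j) powr p"
        using W[of n] w_nonneg p0 by (simp add: powr_mult powr_powr sum_nonneg \<alpha>_def)
      also have "\<dots> \<le> W n * (\<Sum>j\<in>I n. w j / W n * \<alpha> j powr p)"
      proof (intro mult_left_mono jensen_substochastic p Ine)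
        show "(\<Sum>j\<in>I n. w j / W n) \<le> 1" using W[of n] by (simp add: W_def flip: sum_divide_distrib)
      qed (use W[of n] w_nonneg in \<open>auto simp: \<alpha>_def\<close>)
      also have "\<dots> = (\<Sum>j\<in>I n. w j * \<alpha> j powr p)"
        using W[of n] by (simp add: sum_distrib_left)
      finally show ?thesis .
    qed
    have part: "(\<Sum>n<L. \<beta> n powr p) \<le> nm X B powr p" for L
    proof -
      have "(\<Sum>n<L. \<beta> n powr p) \<le> (\<Sum>n<L. \<Sum>j\<in>I n. w j * \<alpha> j powr p)"
        by (intro sum_mono \<beta>le)
      also have "\<dots> = (\<Sum>j<M L. w j * \<alpha> j powr p)"
        unfolding I_def by (rule sum_consecutive_blocks[OF M(1) strict_mono_mono[OF M(2)], symmetric])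
      also have "\<dots> \<le> nm X B powr p"
        unfolding \<alpha>_def by (rule coefficients_le_nm[OF B u(1) h])
      finally show ?thesis .
    qed
    have sm: "summable (\<lambda>n. \<beta> n powr p)"
      by (rule summableI_nonneg_bounded[where x = "nm X B powr p"]) (use part in auto)
    have "ell_norm p d (Q B) \<le> (nm X B powr p) powr (1 / p)"
      unfolding ell_norm_def \<beta>_def[symmetric]
      by (rule powr_mono2[rotated 2, OF suminf_le_const[OF sm part]]) (use p0 suminf_nonneg[OF sm] in auto)
    then show ?thesis using sm p0 nm_ge_0[OF B] by (simp add: powr_powr \<beta>_def)
  qed
  have "mixed_complement X p d J Q 2"
  proof unfold_locales
    show "J (\<lambda>n i. c n i + c' n i) = J c + J c'" if c: "c \<in> ell p d" "c' \<in> ell p d" for c c'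
    proof -
      obtain C D where CD: "\<And>m. norm (g c m) \<le> C" "\<And>m. norm (g c' m) \<le> D"
        using gC[OF c(1)] gC[OF c(2)] by auto
      have "g (\<lambda>n i. c n i + c' n i) = (\<lambda>m. g c m + g c' m)"
        by (auto simp: g_def bvec_add scaleR_add_right)
      then show ?thesis
        unfolding J_def using diag_op_add[where g = "g c" and h = "g c'", OF u(1) g CD(1) g CD(2) g] by simp
    qed
    show "J (\<lambda>n i. k * c n i) = k *\<^sub>C J c" if c: "c \<in> ell p d" for c k
    proof -
      obtain C where C: "\<And>m. norm (g c m) \<le> C" using gC[OF c] by auto
      have "g (\<lambda>n i. k * c n i) = (\<lambda>m. k *\<^sub>C g c m)"
        by (auto simp: g_def bvec_scale scaleR_scaleC mult.commute)
      then show ?thesis unfolding J_def using diag_op_scale[where g = "g c", OF u(1) g C] by simp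
    qed
    show "J c \<in> pts X" "nm X (J c) \<le> 2 * ell_norm p d c" if "c \<in> ell p d" for c using J[OF that] by auto
    show "Q B \<in> ell p d" if "B \<in> pts X" for B using Q[OF that] by (simp add: ell_def Q_def)
    show "ell_norm p d (Q B) \<le> 2 * nm X B" if "B \<in> pts X" for B
      using Q[OF that] nm_ge_0[OF that] by simp
    show "Q (B + B') = (\<lambda>n i. Q B n i + Q B' n i)" for B B'
      by (intro ext) (simp add: Q_def blinfun.add_left distrib_left sum.distrib)
    show "Q (k *\<^sub>C B) = (\<lambda>n i. k * Q B n i)" for B k
      by (intro ext) (simp add: Q_def scaleC_blinfun.rep_eq sum_distrib_left mult_ac)
    show "Q (J c) = c" if c: "c \<in> ell p d" for c
    proof (intro ext)
      fix n i
      show "Q (J c) n i = c n i"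
      proof (cases "i < d n")
        case True
        obtain C where C: "\<And>m. norm (g c m) \<le> C" using gC[OF c] by auto
        have "cinner (J c (u j)) (u2 i j) = of_real (A n) * c n i" if "j \<in> I n" for j
        proof -
          have "J c (u j) = g c j" unfolding J_def by (rule diag_op_apply[OF g C])
          then show ?thesis using True \<nu>_eq[OF that] by (simp add: g_def bvec_coeff)
        qed
        then have "(\<Sum>j\<in>I n. of_real (w j) * cinner (J c (u j)) (u2 i j)) = of_real (W n * A n) * c n i"
          by (simp add: W_def sum_distrib_right mult.assoc)
        then have "Q (J c) n i = of_real (W n powr (1 / p - 1) * (W n * A n)) * c n i"
          using True by (simp add: Q_def)
        also have "W n powr (1 / p - 1) * (W n * A n) = 1"
          using W[of n] by (simp add: A_def powr_diff powr_minus_divide)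
        finally show ?thesis by simp
      qed (use c in \<open>simp add: Q_def ell_def\<close>)
    qed
  qed (use p in auto)
  then show ?thesis by blast
qed

end

section \<open>Strictness of the inclusions\<close>

theorem proposition3p5:
  fixes w1 w2 :: "nat \<Rightarrow> real" and p1 p2 :: real
    and X1 X2 :: "('h::complex_hilbert \<Rightarrow>\<^sub>L 'h) nspace"
  defines "X1 \<equiv> schatten (lorentz w1 p1)" and "X2 \<equiv> schatten (lorentz w2 p2)"
  assumes "separable_space (euclidean :: 'h topology)"
    and "\<not> fin_dim (UNIV :: 'h set)"
    and "1 \<le> p1" and "1 \<le> p2"
    and "decseq w1" and "\<And>k. 0 < w1 k" and "\<not> summable w1"
    and "decseq w2" and "\<And>k. 0 < w2 k" and "\<not> summable w2"
    and "p1 < max 2 p2 \<or> 2 < p2"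
  shows "compact_ops X1 X2 \<subset> finitely_strictly_singular_ops X1 X2 \<and>
         finitely_strictly_singular_ops X1 X2 \<subset> strictly_singular_ops X1 X2"
proof -
  interpret X1: schatten_lorentz w1 p1 X1
    using assms by unfold_locales (auto simp: X1_def)
  interpret X2: schatten_lorentz w2 p2 X2
    using assms by unfold_locales (auto simp: X2_def)
  obtain a b :: real where ab: "a < b" "a = p1 \<or> a = 2" "b = p2 \<or> b = 2"
    using \<open>p1 < max 2 p2 \<or> 2 < p2\<close> that[of p1 2] that[of p1 p2] that[of 2 p2] by (auto simp: max_def split: if_splits)
  have pair: "\<exists>J Q C J' Q' C'. mixed_pair X1 X2 a b d J Q C J' Q' C'" for d
  proof -
    obtain J Q C where X: "mixed_complement X1 a d J Q C"
      using ab(2) X1.complemented_hilbert X1.complemented_lorentz_blocks by metis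
    obtain J' Q' C' where Y: "mixed_complement X2 b d J' Q' C'"
      using ab(3) X2.complemented_hilbert X2.complemented_lorentz_blocks by metis
    show ?thesis
      using mixed_pair.intro[OF X Y] ab(1) unfolding mixed_pair_axioms_def by blast
  qed
  have "compact_ops X1 X2 \<subseteq> finitely_strictly_singular_ops X1 X2"
    by (rule compact_imp_finitely_strictly_singular[OF X1.nspace_norm_axioms X2.nspace_norm_axioms
        X2.finitely_many_functionals_almost_norm])
  moreover have "\<exists>T\<in>finitely_strictly_singular_ops X1 X2. T \<notin> compact_ops X1 X2"
  proof -
    obtain J Q C J' Q' C' where "mixed_pair X1 X2 a b (\<lambda>_. 1) J Q C J' Q' C'" using pair by blast
    then interpret mixed_pair X1 X2 a b "\<lambda>_. 1" J Q C J' Q' C' .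
    show ?thesis using T_finitely_strictly_singular T_not_compact by auto
  qed
  moreover have "finitely_strictly_singular_ops X1 X2 \<subseteq> strictly_singular_ops X1 X2"
    by (rule finitely_strictly_singular_imp_strictly_singular[OF X1.nspace_norm_axioms X2.nspace_norm_axioms])
  moreover have "\<exists>T\<in>strictly_singular_ops X1 X2. T \<notin> finitely_strictly_singular_ops X1 X2"
  proof -
    obtain J Q C J' Q' C' where "mixed_pair X1 X2 a b (\<lambda>n. n) J Q C J' Q' C'" using pair by blast
    then interpret mixed_pair X1 X2 a b "\<lambda>n. n" J Q C J' Q' C' .
    show ?thesis using T_strictly_singular T_not_finitely_strictly_singular by blast
  qed
  ultimately show ?thesis by blast
qed

end
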